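(* Let $M$ be a time-like surface in the static space-time $\mathbb L^3_1(c)\,{}_f\times I$ with light-like $\left(\frac{\partial}{\partial z}\right)^T$. (i) If $c=0$ or $c=1$, then $M$ cannot be totally umbilical. (ii) If $c=-1$, then $M$ is a totally umbilical surface of $\mathbb H^3_1\,{}_f\times I$ if and only if it is (locally) congruent to the flat surface given by $$\begin{aligned}\phi(u,v)=\Big(&\tfrac{(2kv+k_2)\cos\Theta-2k\sin\Theta}{2k},\ \tfrac{-k(2k^2+1)\cos\Theta-(2kv+k_2)\sin\Theta}{2\sqrt2k^2},\\&\tfrac{k(2k^2-1)\cos\Theta-(2kv+k_2)\sin\Theta}{2\sqrt2k^2},\ \tfrac{(2kv+k_2)\cos\Theta}{2k},\ u\Big),\qquad \Theta=F(u)+\tfrac{k_2}{k},\end{aligned}$$ for some constants $k\neq0$ and $k_2$.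
   Context: Let $c\in\{-1,0,1\}$. $\mathbb L^3_1(c)$ denotes the 3-dimensional Lorentzian space form with metric $g_c$ of constant curvature $c$: de Sitter space $\mathbb S^3_1$ for $c=1$, Minkowski space $\mathbb E^3_1$ for $c=0$, and for $c=-1$ the anti-de Sitter space $\mathbb H^3_1=\{x\in\mathbb R^4:-x_1^2-x_2^2+x_3^2+x_4^2=-1\}$ with the metric induced from $-dx_1^2-dx_2^2+dx_3^2+dx_4^2$. Let $I$ be an open interval with coordinate $z$, $f:I\to(0,\infty)$ smooth, and let $\mathbb L^3_1(c)\,{}_f\times I$ be $\mathbb L^3_1(c)\times I$ with the metric $\widetilde g=\langle\cdot,\cdot\rangle=f(z)^2g_c+dz^2$. Points are written (point of $\mathbb L^3_1(c)$, $z$). $F(z)=\int_{z_0}^z\frac{d\xi}{f(\xi)}$ for a fixed $z_0\in I$. For a time-like surface $M$ (induced metric Lorentzian), write $\frac{\partial}{\partial z}\big|_M=T+\eta$ with $T=\left(\frac{\partial}{\partial z}\right)^T$ tangent and $\eta$ normal to $M$. $T$ is light-like if $T\ne0$ and $\langle T,T\rangle=0$ at every point. Standing assumptions: $T$ and $\eta$ vanish nowhere, and no open subset of $M$ lies in a totally geodesic hypersurface of the ambient space. $M$ is totally umbilical if for every normal field $\xi$ there is a function $a_\xi$ with $A_\xi=a_\xi\,\mathrm{Id}$. "Congruent" means equal up to an isometry of the ambient space. *)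

theory Defs
  imports "HOL-Analysis.Analysis"
begin

section \<open>Smooth maps\<close>

abbreviation dif :: "('a::real_normed_vector \<Rightarrow> 'b::real_normed_vector) \<Rightarrow> 'a \<Rightarrow> 'a \<Rightarrow> 'b"
  where "dif X q \<equiv> frechet_derivative X (at q)"

(* C^k on an open set: all directional derivatives of order at most k exist and are continuous. *)
primrec Ck_on :: "nat \<Rightarrow> 'a::euclidean_space set \<Rightarrow> ('a \<Rightarrow> 'b::real_normed_vector) \<Rightarrow> bool" where
  "Ck_on 0 U X \<longleftrightarrow> continuous_on U X"
| "Ck_on (Suc k) U X \<longleftrightarrow>
     (\<forall>q\<in>U. X differentiable (at q)) \<and> (\<forall>e. Ck_on k U (\<lambda>q. dif X q e))"

(* Only used for open U. *)
definition smooth_on :: "'a::euclidean_space set \<Rightarrow> ('a \<Rightarrow> 'b::real_normed_vector) \<Rightarrow> bool"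
  where "smooth_on U X \<longleftrightarrow> (\<forall>k. Ck_on k U X)"

(* Smoothness on a subset that need not be open: local extendability to smooth maps. *)
definition smooth_map_on :: "'a::euclidean_space set \<Rightarrow> ('a \<Rightarrow> 'b::real_normed_vector) \<Rightarrow> bool"
  where "smooth_map_on S \<Psi> \<longleftrightarrow>
    (\<forall>p\<in>S. \<exists>W G. open W \<and> p \<in> W \<and> smooth_on W G \<and> (\<forall>x\<in>S \<inter> W. G x = \<Psi> x))"

section \<open>Submanifolds of a Euclidean space with a metric\<close>

text \<open>
  A pseudo-Riemannian manifold is given by a submanifold \<open>N\<close> of a Euclidean space \<open>'a\<close> and a
  map \<open>g\<close> such that \<open>g p\<close>, restricted to the tangent space of \<open>N\<close> at \<open>p\<close>, is the metric at \<open>p\<close>.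
  Although only this restriction matters geometrically, \<open>g\<close> is to be defined and smooth near \<open>N\<close>.
\<close>

definition tangent_space :: "'a::real_normed_vector set \<Rightarrow> 'a \<Rightarrow> 'a set"
  where "tangent_space N p =
    {v. \<exists>\<gamma>::real \<Rightarrow> 'a. \<gamma> 0 = p \<and> (\<forall>\<^sub>F t in nhds 0. \<gamma> t \<in> N) \<and>
          (\<gamma> has_vector_derivative v) (at 0)}"

(* (D_W g)(Y, Z) at p, with Y and Z held constant. *)
definition metric_deriv ::
    "('a \<Rightarrow> 'a \<Rightarrow> 'a \<Rightarrow> real) \<Rightarrow> 'a \<Rightarrow> 'a \<Rightarrow> 'a \<Rightarrow> 'a::euclidean_space \<Rightarrow> real"
  where "metric_deriv g p W Y Z = dif (\<lambda>x. g x Y Z) p W"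

text \<open>
  The Levi-Civita covariant derivative on \<open>(N, g)\<close> of a field \<open>V\<close> along \<open>X\<close> (with values tangent
  to \<open>N\<close>) in the parameter direction \<open>e\<close>. This is the Koszul formula
  \<open>2 g(\<nabla>\<^sub>X Y, Z) = X g(Y,Z) + Y g(X,Z) - Z g(X,Y) + g([X,Y],Z) - g([X,Z],Y) - g([Y,Z],X)\<close>
  for fields tangent to \<open>N\<close>, in which \<open>X g(Y,Z) = (D\<^sub>X g)(Y,Z) + g(D\<^sub>X Y, Z) + g(Y, D\<^sub>X Z)\<close> and
  \<open>[X,Y] = D\<^sub>X Y - D\<^sub>Y X\<close> are expanded with the derivative \<open>D\<close> of the surrounding vector space:
  all terms with a derivative of a field cancel except for \<open>2 g(D\<^sub>X Y, Z)\<close>.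
\<close>
definition cov_deriv ::
    "'a set \<Rightarrow> ('a \<Rightarrow> 'a \<Rightarrow> 'a \<Rightarrow> real) \<Rightarrow> ('b::euclidean_space \<Rightarrow> 'a::euclidean_space)
       \<Rightarrow> ('b \<Rightarrow> 'a) \<Rightarrow> 'b \<Rightarrow> 'b \<Rightarrow> 'a"
  where "cov_deriv N g X V e q =
    (THE W. W \<in> tangent_space N (X q) \<and>
       (\<forall>Z\<in>tangent_space N (X q).
          g (X q) W Z = g (X q) (dif V q e) Z +
            (metric_deriv g (X q) (dif X q e) (V q) Z
             + metric_deriv g (X q) (V q) (dif X q e) Z
             - metric_deriv g (X q) Z (dif X q e) (V q)) / 2))"

text \<open>
  An immersed submanifold is a set \<open>M\<close> in a topological space together with a map \<open>\<iota>\<close>, such that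
  \<open>M\<close> is covered by the following local parametrizations. No separate atlas is needed: since
  \<open>\<iota> \<circ> \<sigma>\<close> is an immersion, the smooth structure of \<open>M\<close> is determined by \<open>\<iota>\<close>, and transition
  maps between local parametrizations are automatically smooth.
\<close>
definition local_param ::
    "'m::topological_space set \<Rightarrow> ('m \<Rightarrow> 'a::euclidean_space)
       \<Rightarrow> 'b::euclidean_space set \<Rightarrow> ('b \<Rightarrow> 'm) \<Rightarrow> bool"
  where "local_param M \<iota> U \<sigma> \<longleftrightarrow>
    open U \<and> openin (top_of_set M) (\<sigma> ` U) \<and> (\<exists>\<tau>. homeomorphism U (\<sigma> ` U) \<sigma> \<tau>) \<and>
    smooth_on U (\<iota> \<circ> \<sigma>) \<and> (\<forall>q\<in>U. inj (dif (\<iota> \<circ> \<sigma>) q))"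

definition tangential ::
    "('a \<Rightarrow> 'a \<Rightarrow> 'a \<Rightarrow> real) \<Rightarrow> ('b::euclidean_space \<Rightarrow> 'a::euclidean_space) \<Rightarrow> 'b \<Rightarrow> 'a \<Rightarrow> 'a"
  where "tangential g X q w =
    (THE t. t \<in> range (dif X q) \<and> (\<forall>e. g (X q) (w - t) (dif X q e) = 0))"

definition timelike_surface ::
    "'a::euclidean_space set \<Rightarrow> ('a \<Rightarrow> 'a \<Rightarrow> 'a \<Rightarrow> real)
       \<Rightarrow> 'm::topological_space set \<Rightarrow> ('m \<Rightarrow> 'a) \<Rightarrow> bool"
  where "timelike_surface N g M \<iota> \<longleftrightarrow>
    M \<noteq> {} \<and> \<iota> ` M \<subseteq> N \<and>
    (\<forall>p\<in>M. \<exists>(U::(real^2) set) \<sigma>. local_param M \<iota> U \<sigma> \<and> p \<in> \<sigma> ` U) \<and>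
    (\<forall>(U::(real^2) set) \<sigma>. local_param M \<iota> U \<sigma> \<longrightarrow>
       (\<forall>q\<in>U. \<exists>a\<in>range (dif (\<iota> \<circ> \<sigma>) q). \<exists>b\<in>range (dif (\<iota> \<circ> \<sigma>) q).
          g (\<iota> (\<sigma> q)) a a = -1 \<and> g (\<iota> (\<sigma> q)) b b = 1 \<and> g (\<iota> (\<sigma> q)) a b = 0))"

definition normal_field ::
    "'a set \<Rightarrow> ('a \<Rightarrow> 'a \<Rightarrow> 'a \<Rightarrow> real) \<Rightarrow> 'b set \<Rightarrow> ('b::euclidean_space \<Rightarrow> 'a::euclidean_space)
       \<Rightarrow> ('b \<Rightarrow> 'a) \<Rightarrow> bool"
  where "normal_field N g U X \<xi> \<longleftrightarrow>
    smooth_on U \<xi> \<and>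
    (\<forall>q\<in>U. \<xi> q \<in> tangent_space N (X q) \<and> (\<forall>e. g (X q) (\<xi> q) (dif X q e) = 0))"

(* A_\<xi> applied to the tangent vector dif X q e. *)
definition shape_operator ::
    "'a set \<Rightarrow> ('a \<Rightarrow> 'a \<Rightarrow> 'a \<Rightarrow> real) \<Rightarrow> ('b::euclidean_space \<Rightarrow> 'a::euclidean_space)
       \<Rightarrow> ('b \<Rightarrow> 'a) \<Rightarrow> 'b \<Rightarrow> 'b \<Rightarrow> 'a"
  where "shape_operator N g X \<xi> q e = - tangential g X q (cov_deriv N g X \<xi> e q)"

(* The normal fields range over all smooth normal fields on parametrized open pieces of M. *)
definition totally_umbilical ::
    "'a::euclidean_space set \<Rightarrow> ('a \<Rightarrow> 'a \<Rightarrow> 'a \<Rightarrow> real)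
       \<Rightarrow> 'm::topological_space set \<Rightarrow> ('m \<Rightarrow> 'a) \<Rightarrow> bool"
  where "totally_umbilical N g M \<iota> \<longleftrightarrow>
    (\<forall>(U::(real^2) set) \<sigma> \<xi>. local_param M \<iota> U \<sigma> \<and> normal_field N g U (\<iota> \<circ> \<sigma>) \<xi> \<longrightarrow>
       (\<exists>a::real^2 \<Rightarrow> real. \<forall>q\<in>U. \<forall>e.
          shape_operator N g (\<iota> \<circ> \<sigma>) \<xi> q e = a q *\<^sub>R dif (\<iota> \<circ> \<sigma>) q e))"

text \<open>
  Embedded pseudo-Riemannian hypersurfaces of a four-dimensional \<open>N\<close> whose second fundamental
  form, the normal part of \<open>\<nabla>\<^sub>V W\<close> for tangent fields \<open>V\<close> and \<open>W\<close>, vanishes. By tensoriality it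
  suffices to take coordinate fields.
\<close>
definition totally_geodesic_hypersurface ::
    "'a::euclidean_space set \<Rightarrow> ('a \<Rightarrow> 'a \<Rightarrow> 'a \<Rightarrow> real) \<Rightarrow> 'a set \<Rightarrow> bool"
  where "totally_geodesic_hypersurface N g H \<longleftrightarrow>
    H \<subseteq> N \<and>
    (\<forall>p\<in>H. \<exists>(U::(real^3) set) \<sigma>. local_param H (\<lambda>x. x) U \<sigma> \<and> p \<in> \<sigma> ` U) \<and>
    (\<forall>(U::(real^3) set) \<sigma>. local_param H (\<lambda>x. x) U \<sigma> \<longrightarrow>
       (\<forall>q\<in>U. (\<forall>e. (\<forall>e'. g (\<sigma> q) (dif \<sigma> q e) (dif \<sigma> q e') = 0) \<longrightarrow> e = 0) \<and>
               (\<forall>e e'. cov_deriv N g \<sigma> (\<lambda>r. dif \<sigma> r e') e q \<in> range (dif \<sigma> q))))"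

definition locally_in_totally_geodesic ::
    "'a::euclidean_space set \<Rightarrow> ('a \<Rightarrow> 'a \<Rightarrow> 'a \<Rightarrow> real)
       \<Rightarrow> 'm::topological_space set \<Rightarrow> ('m \<Rightarrow> 'a) \<Rightarrow> bool"
  where "locally_in_totally_geodesic N g M \<iota> \<longleftrightarrow>
    (\<exists>W H. openin (top_of_set M) W \<and> W \<noteq> {} \<and>
       totally_geodesic_hypersurface N g H \<and> \<iota> ` W \<subseteq> H)"

definition isometry_of ::
    "'a::euclidean_space set \<Rightarrow> ('a \<Rightarrow> 'a \<Rightarrow> 'a \<Rightarrow> real) \<Rightarrow> ('a \<Rightarrow> 'a) \<Rightarrow> bool"
  where "isometry_of N g \<Psi> \<longleftrightarrow>
    bij_betw \<Psi> N N \<and> smooth_map_on N \<Psi> \<and> smooth_map_on N (inv_into N \<Psi>) \<and>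
    (\<forall>p\<in>N. \<exists>\<Psi>'. (\<Psi> has_derivative \<Psi>') (at p within N) \<and>
       (\<forall>v\<in>tangent_space N p. \<forall>w\<in>tangent_space N p.
          g (\<Psi> p) (\<Psi>' v) (\<Psi>' w) = g p v w))"

(* The surface X, with parameter domain V, is matched up to reparametrization: the local
   parametrization \<sigma> of M may be any. *)
definition locally_congruent ::
    "'a::euclidean_space set \<Rightarrow> ('a \<Rightarrow> 'a \<Rightarrow> 'a \<Rightarrow> real)
       \<Rightarrow> 'm::topological_space set \<Rightarrow> ('m \<Rightarrow> 'a) \<Rightarrow> (real^2) set \<Rightarrow> (real^2 \<Rightarrow> 'a) \<Rightarrow> bool"
  where "locally_congruent N g M \<iota> V X \<longleftrightarrow>
    (\<forall>p\<in>M. \<exists>\<Psi> U \<sigma>. isometry_of N g \<Psi> \<and> local_param M \<iota> U \<sigma> \<and> p \<in> \<sigma> ` U \<and>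
       U \<subseteq> V \<and> (\<forall>q\<in>U. \<Psi> (\<iota> (\<sigma> q)) = X q))"

definition induced_metric ::
    "('a \<Rightarrow> 'a \<Rightarrow> 'a \<Rightarrow> real) \<Rightarrow> ('b::euclidean_space \<Rightarrow> 'a::euclidean_space)
       \<Rightarrow> 'b \<Rightarrow> 'b \<Rightarrow> 'b \<Rightarrow> real"
  where "induced_metric g X q a b = g (X q) (dif X q a) (dif X q b)"

(* The last condition says R(a,b)V = 0 for the curvature tensor R of the induced metric, in the
   parameter domain; the constant fields a and b commute. *)
definition flat_surface ::
    "'a::euclidean_space set \<Rightarrow> ('a \<Rightarrow> 'a \<Rightarrow> 'a \<Rightarrow> real)
       \<Rightarrow> (real^2) set \<Rightarrow> (real^2 \<Rightarrow> 'a) \<Rightarrow> bool"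
  where "flat_surface N g U X \<longleftrightarrow>
    smooth_on U X \<and> X ` U \<subseteq> N \<and>
    (\<forall>q\<in>U. inj (dif X q) \<and> (\<forall>a. (\<forall>b. induced_metric g X q a b = 0) \<longrightarrow> a = 0)) \<and>
    (let nabla = cov_deriv U (induced_metric g X) (\<lambda>q. q) in
       \<forall>V. smooth_on U V \<longrightarrow>
         (\<forall>q\<in>U. \<forall>a b. nabla (nabla V b) a q = nabla (nabla V a) b q))"

section \<open>The static space-times\<close>

definition pseudo_inner :: "real \<Rightarrow> real^4 \<Rightarrow> real^4 \<Rightarrow> real"
  where "pseudo_inner c x y =
    (if c = -1 then - (x$1 * y$1) - x$2 * y$2 + x$3 * y$3 + x$4 * y$4
     else - (x$1 * y$1) + x$2 * y$2 + x$3 * y$3 + x$4 * y$4)"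

(* For c in {-1, 0, 1}. Minkowski 3-space is realized as the hyperplane x$4 = 0 of Minkowski
   4-space, so that all three space forms are hypersurfaces of real^4. *)
definition space_form :: "real \<Rightarrow> (real^4) set"
  where "space_form c = (if c = 0 then {x. x$4 = 0} else {x. pseudo_inner c x x = c})"

definition static_space :: "real \<Rightarrow> real set \<Rightarrow> ((real^4) \<times> real) set"
  where "static_space c I = space_form c \<times> I"

definition static_metric ::
    "real \<Rightarrow> (real \<Rightarrow> real) \<Rightarrow> (real^4) \<times> real \<Rightarrow> (real^4) \<times> real \<Rightarrow> (real^4) \<times> real \<Rightarrow> real"
  where "static_metric c f p v w =
    (f (snd p))\<^sup>2 * pseudo_inner c (fst v) (fst w) + snd v * snd w"

definition partial_z :: "(real^4) \<times> real"
  where "partial_z = (0, 1)"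

definition T_part ::
    "real \<Rightarrow> (real \<Rightarrow> real) \<Rightarrow> (real^2 \<Rightarrow> (real^4) \<times> real) \<Rightarrow> real^2 \<Rightarrow> (real^4) \<times> real"
  where "T_part c f X q = tangential (static_metric c f) X q partial_z"

definition eta_part ::
    "real \<Rightarrow> (real \<Rightarrow> real) \<Rightarrow> (real^2 \<Rightarrow> (real^4) \<times> real) \<Rightarrow> real^2 \<Rightarrow> (real^4) \<times> real"
  where "eta_part c f X q = partial_z - T_part c f X q"

definition lightlike_T ::
    "real \<Rightarrow> (real \<Rightarrow> real) \<Rightarrow> 'm::topological_space set \<Rightarrow> ('m \<Rightarrow> (real^4) \<times> real) \<Rightarrow> bool"
  where "lightlike_T c f M \<iota> \<longleftrightarrow>
    (\<forall>U \<sigma>. local_param M \<iota> U \<sigma> \<longrightarrow>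
       (\<forall>q\<in>U. T_part c f (\<iota> \<circ> \<sigma>) q \<noteq> 0 \<and>
          static_metric c f (\<iota> (\<sigma> q)) (T_part c f (\<iota> \<circ> \<sigma>) q) (T_part c f (\<iota> \<circ> \<sigma>) q) = 0))"

definition T_eta_nonvanishing ::
    "real \<Rightarrow> (real \<Rightarrow> real) \<Rightarrow> 'm::topological_space set \<Rightarrow> ('m \<Rightarrow> (real^4) \<times> real) \<Rightarrow> bool"
  where "T_eta_nonvanishing c f M \<iota> \<longleftrightarrow>
    (\<forall>U \<sigma>. local_param M \<iota> U \<sigma> \<longrightarrow>
       (\<forall>q\<in>U. T_part c f (\<iota> \<circ> \<sigma>) q \<noteq> 0 \<and> eta_part c f (\<iota> \<circ> \<sigma>) q \<noteq> 0))"

section \<open>The model surface in the anti-de Sitter case\<close>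

(* The interval integral is oriented, so z < z0 is covered. *)
definition F_int :: "(real \<Rightarrow> real) \<Rightarrow> real \<Rightarrow> real \<Rightarrow> real"
  where "F_int f z0 z = (LBINT x=ereal z0..ereal z. 1 / f x)"

definition phi_surface ::
    "(real \<Rightarrow> real) \<Rightarrow> real \<Rightarrow> real \<Rightarrow> real \<Rightarrow> real^2 \<Rightarrow> (real^4) \<times> real"
  where "phi_surface f z0 k k2 q =
    (let u = q$1; v = q$2; \<Theta> = F_int f z0 u + k2 / k in
      (vector
        [((2 * k * v + k2) * cos \<Theta> - 2*k * sin \<Theta>) / (2*k),
         (- k * (2*k\<^sup>2 + 1) * cos \<Theta> - (2 * k * v + k2) * sin \<Theta>) / (2 * sqrt 2 * k\<^sup>2),
         (k * (2*k\<^sup>2 - 1) * cos \<Theta> - (2 * k * v + k2) * sin \<Theta>) / (2 * sqrt 2 * k\<^sup>2),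
         ((2 * k * v + k2) * cos \<Theta>) / (2*k)],
       u))"

definition phi_domain :: "real set \<Rightarrow> (real^2) set"
  where "phi_domain I = {q. q$1 \<in> I}"

end

theory Submission
  imports Defs
begin

text \<open>
  The proof rests on the geometry of null geodesics. A time-like surface is totally umbilical exactly
  when its second fundamental form vanishes on the two null directions, that is, when it is ruled by two
  families of null geodesics of the ambient space, up to parametrization
  (\<open>umbilical_null_direction\<close>, \<open>umbilical_from_null_pair\<close>). Null geodesics are conformally
  invariant, and the metric is \<open>f\<^sup>2\<close> times the product of \<open>g\<^sub>c\<close> and \<open>dw\<^sup>2\<close> with \<open>w = F(z)\<close>. If the gradient
  \<open>T\<close> of the height is light-like, one null direction is tangent to the curves of constant height,
  which are then null lines of the space form; the curves of the other family are graphs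
  \<open>(\<gamma>(w), w)\<close> over unit-speed time-like geodesics \<open>\<gamma>\<close> of the space form. An umbilical surface is thus a
  family of time-like geodesics \<open>\<gamma>\<^sub>s\<close> such that for every \<open>w\<close> the points \<open>\<gamma>\<^sub>s(w)\<close> lie on one null line. All
  this is encoded in the locale \<open>null_frame\<close>, and \<open>null_frame_exists\<close> produces such a frame.

  The frame consists of vector fields \<open>K\<close> and \<open>L\<close> with \<open>[K, L] = \<kappa> K\<close>. Let \<open>x\<close> be the position in the
  space form, \<open>d = K x\<close>, \<open>y = L x\<close> and \<open>y' = K y\<close>. Comparing the derivatives of \<open>y'\<close> in the two orders
  shows that \<open>y'\<close> is null and constant along \<open>K\<close> (\<open>K_\<kappa>_y'_null\<close>). In a Lorentzian space form
  \<open>y'\<close> is moreover orthogonal to the time-like vector \<open>y\<close>, hence \<open>y' = 0\<close>. This excludes \<open>c = 1\<close>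
  (\<open>lorentzian_case\<close>), and for \<open>c = 0\<close> the surface lies in the product of a time-like plane with the
  interval, which is a totally geodesic hypersurface and therefore excluded as well
  (\<open>plane_cylinder_totally_geodesic\<close>).

  For \<open>c = -1\<close> the scalar product has signature \<open>(2, 2)\<close> and admits planes consisting of null vectors.
  The geodesics are \<open>cos w A + sin w B\<close>, and the pair \<open>(A, B)\<close> moves on a line
  \<open>(a + s n0, b + s n1)\<close> (\<open>anti_de_sitter_form\<close>). The Gram matrix of \<open>a, b, n0, n1\<close> is determined up to
  the scaling of \<open>s\<close>, so all these surfaces are congruent to each other by linear isometries, and
  \<open>phi_surface\<close> is one of them for every choice of its constants (\<open>phi_surface_ruled\<close>,
  \<open>umbilical_imp_locally_congruent\<close>). Conversely, the coordinate lines of \<open>phi_surface\<close> are null geodesics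
  up to parametrization. An arbitrary isometry preserves this, since the Koszul expression of a curve
  can be computed from the induced metrics of the variations of the curve (\<open>koszul_variation\<close>), and
  the two null directions make the surface umbilical (\<open>locally_congruent_imp_umbilical\<close>). In its
  coordinates the induced metric is \<open>2 f(u) du dv\<close>, which is flat (\<open>Y_flat\<close>).

  The rulings enter the proofs through vector fields, which act as derivations on smooth functions,
  and the straightness of a ruling through a direction whose derivatives are parallel to itself
  (\<open>parallel_direction_constant\<close>); this takes the place of integral curves.
\<close>

section \<open>Calculus of smooth maps\<close>

lemma dif_eqI: "(X has_derivative X') (at q) \<Longrightarrow> dif X q = X'"
  by (rule frechet_derivative_at[symmetric])

lemma dif_cong_open:
  assumes "open U" "q \<in> U" "\<And>r. r \<in> U \<Longrightarrow> X r = Y r"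
  shows "dif X q = dif Y q"
proof -
  have "(X has_derivative D) (at q) \<longleftrightarrow> (Y has_derivative D) (at q)" for D
    using has_derivative_transform_within_open[of X D q UNIV U Y]
      has_derivative_transform_within_open[of Y D q UNIV U X] assms by auto
  then show ?thesis by (simp add: frechet_derivative_def)
qed

lemma differentiable_cong_open:
  assumes "open U" "q \<in> U" "\<And>r. r \<in> U \<Longrightarrow> X r = Y r"
  shows "X differentiable (at q) \<longleftrightarrow> Y differentiable (at q)"
  unfolding differentiable_def
  using has_derivative_transform_within_open[of X _ q UNIV U Y]
      has_derivative_transform_within_open[of Y _ q UNIV U X] assms by metis

lemma Ck_on_cong:
  assumes "open U" "\<And>r. r \<in> U \<Longrightarrow> X r = Y r"
  shows "Ck_on k U X \<longleftrightarrow> Ck_on k U Y"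
  using assms(2)
proof (induction k arbitrary: X Y)
  case 0
  then show ?case by (auto intro: continuous_on_eq)
next
  case (Suc k)
  have "Ck_on k U (\<lambda>q. dif X q e) \<longleftrightarrow> Ck_on k U (\<lambda>q. dif Y q e)" for e
    by (intro Suc.IH) (use dif_cong_open[OF assms(1)] Suc.prems in metis)
  then show ?case
    using differentiable_cong_open[OF assms(1), of _ X Y] Suc.prems by auto
qed

lemma smooth_on_cong:
  assumes "open U" "\<And>r. r \<in> U \<Longrightarrow> X r = Y r"
  shows "smooth_on U X \<longleftrightarrow> smooth_on U Y"
  using Ck_on_cong[OF assms] by (simp add: smooth_on_def)

lemma Ck_on_subset: "Ck_on k U X \<Longrightarrow> V \<subseteq> U \<Longrightarrow> Ck_on k V X"
  by (induction k arbitrary: X) (auto intro: continuous_on_subset)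

lemma smooth_on_subset: "smooth_on U X \<Longrightarrow> V \<subseteq> U \<Longrightarrow> smooth_on V X"
  unfolding smooth_on_def by (blast intro: Ck_on_subset)

lemma Ck_on_Suc_imp: "Ck_on (Suc k) U X \<Longrightarrow> Ck_on k U X"
proof (induction k arbitrary: X)
  case 0
  then show ?case
    by (auto intro!: continuous_at_imp_continuous_on differentiable_imp_continuous_within)
next
  case (Suc k)
  then show ?case by simp
qed

lemma smooth_on_SucI:
  assumes "\<And>q. q \<in> U \<Longrightarrow> X differentiable (at q)" "\<And>e. smooth_on U (\<lambda>q. dif X q e)"
  shows "smooth_on U X"
  unfolding smooth_on_def
proof
  fix k
  have "Ck_on (Suc k) U X" using assms by (simp add: smooth_on_def)
  then show "Ck_on k U X" by (rule Ck_on_Suc_imp)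
qed

lemma smooth_on_differentiable: "smooth_on U X \<Longrightarrow> q \<in> U \<Longrightarrow> X differentiable (at q)"
  unfolding smooth_on_def using Ck_on.simps(2)[of 0 U X] by blast

lemma smooth_on_has_derivative:
  "smooth_on U X \<Longrightarrow> q \<in> U \<Longrightarrow> (X has_derivative dif X q) (at q)"
  using smooth_on_differentiable frechet_derivative_works by blast

lemma smooth_on_dif: "smooth_on U X \<Longrightarrow> smooth_on U (\<lambda>q. dif X q e)"
  by (metis Ck_on.simps(2) smooth_on_def)

lemma smooth_on_continuous: "smooth_on U X \<Longrightarrow> continuous_on U X"
  by (metis Ck_on.simps(1) smooth_on_def)

lemma dif_linear: "smooth_on U X \<Longrightarrow> q \<in> U \<Longrightarrow> linear (dif X q)"
  by (rule linear_frechet_derivative) (rule smooth_on_differentiable)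

lemma Ck_on_const: "Ck_on k U (\<lambda>_. c)"
  by (induction k arbitrary: c) auto

lemma smooth_on_const: "smooth_on U (\<lambda>_. c)"
  by (simp add: smooth_on_def Ck_on_const)

lemma Ck_on_linear:
  assumes "bounded_linear L" shows "Ck_on k U L"
proof (cases k)
  case 0
  then show ?thesis using assms by (simp add: linear_continuous_on)
next
  case (Suc j)
  have "dif L q = L" for q by (intro dif_eqI bounded_linear_imp_has_derivative assms)
  then show ?thesis
    using Suc assms by (auto simp: Ck_on_const bounded_linear_imp_differentiable)
qed

lemma smooth_on_linear: "bounded_linear L \<Longrightarrow> smooth_on U L"
  by (simp add: smooth_on_def Ck_on_linear)

lemma Ck_on_add:
  assumes "open U"
  shows "Ck_on k U X \<Longrightarrow> Ck_on k U Y \<Longrightarrow> Ck_on k U (\<lambda>q. X q + Y q)"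
proof (induction k arbitrary: X Y)
  case 0
  then show ?case by (simp add: continuous_on_add)
next
  case (Suc k)
  have d: "((\<lambda>q. X q + Y q) has_derivative (\<lambda>e. dif X q e + dif Y q e)) (at q)" if "q \<in> U" for q
    using Suc.prems that by (auto intro!: has_derivative_add simp: frechet_derivative_works)
  have "Ck_on k U (\<lambda>q. dif (\<lambda>q. X q + Y q) q e)" for e
  proof (subst Ck_on_cong[OF assms])
    show "dif (\<lambda>q. X q + Y q) r e = dif X r e + dif Y r e" if "r \<in> U" for r
      using dif_eqI[OF d[OF that]] by simp
    show "Ck_on k U (\<lambda>r. dif X r e + dif Y r e)" using Suc by simp
  qed
  then show ?case using d by (auto simp: differentiable_def)
qed

lemma smooth_on_add:
  "open U \<Longrightarrow> smooth_on U X \<Longrightarrow> smooth_on U Y \<Longrightarrow> smooth_on U (\<lambda>q. X q + Y q)"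
  by (simp add: smooth_on_def Ck_on_add)

lemma Ck_on_bilinear:
  assumes "open U" "bounded_bilinear b"
  shows "Ck_on k U X \<Longrightarrow> Ck_on k U Y \<Longrightarrow> Ck_on k U (\<lambda>q. b (X q) (Y q))"
proof (induction k arbitrary: X Y)
  case 0
  then show ?case using bounded_bilinear.continuous_on[OF assms(2)] by simp
next
  case (Suc k)
  have d: "((\<lambda>q. b (X q) (Y q)) has_derivative (\<lambda>e. b (X q) (dif Y q e) + b (dif X q e) (Y q))) (at q)"
    if "q \<in> U" for q
    using Suc.prems that by (auto intro!: bounded_bilinear.FDERIV[OF assms(2)] simp: frechet_derivative_works)
  have "Ck_on k U (\<lambda>q. dif (\<lambda>q. b (X q) (Y q)) q e)" for e
  proof (subst Ck_on_cong[OF assms(1)])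
    show "dif (\<lambda>q. b (X q) (Y q)) r e = b (X r) (dif Y r e) + b (dif X r e) (Y r)" if "r \<in> U" for r
      using dif_eqI[OF d[OF that]] by simp
    show "Ck_on k U (\<lambda>r. b (X r) (dif Y r e) + b (dif X r e) (Y r))"
      using Suc Ck_on_Suc_imp[of k U X] Ck_on_Suc_imp[of k U Y] by (intro Ck_on_add assms) auto
  qed
  then show ?case using d by (auto simp: differentiable_def)
qed

lemma smooth_on_bilinear:
  "bounded_bilinear b \<Longrightarrow> open U \<Longrightarrow> smooth_on U X \<Longrightarrow> smooth_on U Y
    \<Longrightarrow> smooth_on U (\<lambda>q. b (X q) (Y q))"
  by (simp add: smooth_on_def Ck_on_bilinear)

lemmas smooth_on_scaleR = smooth_on_bilinear[OF bounded_bilinear_scaleR]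
lemmas smooth_on_mult = smooth_on_bilinear[OF bounded_bilinear_mult]
lemmas smooth_on_inner = smooth_on_bilinear[OF bounded_bilinear_inner]

lemma smooth_on_minus:
  assumes "open U" "smooth_on U X" shows "smooth_on U (\<lambda>q. - X q)"
  using smooth_on_scaleR[OF assms(1) smooth_on_const assms(2), of "-1"] by simp

lemma smooth_on_diff:
  assumes "open U" "smooth_on U X" "smooth_on U Y" shows "smooth_on U (\<lambda>q. X q - Y q)"
  using smooth_on_add[OF assms(1,2) smooth_on_minus[OF assms(1,3)]] by simp

lemma smooth_on_power:
  fixes X :: "'a::euclidean_space \<Rightarrow> real"
  assumes "open U" "smooth_on U X" shows "smooth_on U (\<lambda>q. X q ^ n)"
  by (induction n) (auto intro!: smooth_on_mult smooth_on_const assms)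

lemma Ck_on_sum:
  assumes "open U" "finite S" "\<And>i. i \<in> S \<Longrightarrow> Ck_on k U (X i)"
  shows "Ck_on k U (\<lambda>q. \<Sum>i\<in>S. X i q)"
  using assms(2,3) by (induction S) (auto intro!: Ck_on_add Ck_on_const assms(1))

lemma Ck_on_compose:
  fixes X :: "'a::euclidean_space \<Rightarrow> 'b::euclidean_space"
  assumes "open U" "open V" "X ` U \<subseteq> V"
  shows "Ck_on k V G \<Longrightarrow> Ck_on k U X \<Longrightarrow> Ck_on k U (\<lambda>q. G (X q))"
proof (induction k arbitrary: G)
  case 0
  then show ?case using assms by (auto intro: continuous_on_compose2)
next
  case (Suc k)
  have d: "((\<lambda>q. G (X q)) has_derivative (\<lambda>e. dif G (X q) (dif X q e))) (at q)" if "q \<in> U" for q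
  proof (rule has_derivative_compose[of X "dif X q" q UNIV G "dif G (X q)"])
    show "(X has_derivative dif X q) (at q)" "(G has_derivative dif G (X q)) (at (X q))"
      using Suc.prems that assms by (auto simp: frechet_derivative_works[symmetric])
  qed
  have lin: "linear (dif G (X q))" if "q \<in> U" for q
    using Suc.prems that assms by (intro linear_frechet_derivative) auto
  have "Ck_on k U (\<lambda>q. dif (\<lambda>q. G (X q)) q e)" for e
  proof (subst Ck_on_cong[OF assms(1)])
    show "dif (\<lambda>q. G (X q)) r e = (\<Sum>b\<in>Basis. (dif X r e \<bullet> b) *\<^sub>R dif G (X r) b)" if "r \<in> U" for r
    proof -
      have "dif (\<lambda>q. G (X q)) r e = dif G (X r) (dif X r e)" using dif_eqI[OF d[OF that]] by simp
      also have "\<dots> = dif G (X r) (\<Sum>b\<in>Basis. (dif X r e \<bullet> b) *\<^sub>R b)" by (simp add: euclidean_representation)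
      also have "\<dots> = (\<Sum>b\<in>Basis. (dif X r e \<bullet> b) *\<^sub>R dif G (X r) b)"
        by (simp add: linear_sum[OF lin[OF that]] linear_cmul[OF lin[OF that]])
      finally show ?thesis .
    qed
    show "Ck_on k U (\<lambda>r. \<Sum>b\<in>Basis. (dif X r e \<bullet> b) *\<^sub>R dif G (X r) b)"
    proof (rule Ck_on_sum[OF assms(1) finite_Basis], rule Ck_on_bilinear[OF assms(1) bounded_bilinear_scaleR])
      fix b :: 'b assume "b \<in> Basis"
      show "Ck_on k U (\<lambda>r. dif X r e \<bullet> b)"
        using Suc.prems by (intro Ck_on_bilinear[OF assms(1) bounded_bilinear_inner] Ck_on_const) simp
      show "Ck_on k U (\<lambda>r. dif G (X r) b)"
        using Suc.prems by (intro Suc.IH Ck_on_Suc_imp[OF Suc.prems(2)]) simp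
    qed
  qed
  then show ?case using d by (auto simp: differentiable_def)
qed

lemma smooth_on_compose:
  fixes X :: "'a::euclidean_space \<Rightarrow> 'b::euclidean_space"
  assumes "open U" "open V" "X ` U \<subseteq> V" "smooth_on V G" "smooth_on U X"
  shows "smooth_on U (\<lambda>q. G (X q))"
  using Ck_on_compose[OF assms(1-3)] assms(4,5) by (auto simp: smooth_on_def)

lemma smooth_on_linear_compose:
  assumes "bounded_linear L" "open U" "smooth_on U X"
  shows "smooth_on U (\<lambda>q. L (X q))"
proof -
  interpret bounded_linear L by fact
  have "bounded_bilinear (\<lambda>(r::real) x. r *\<^sub>R L x)"
    using bounded_bilinear.comp[OF bounded_bilinear_scaleR bounded_linear_ident assms(1)] by simp
  from smooth_on_bilinear[OF this assms(2) smooth_on_const assms(3), of 1] show ?thesis by simp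
qed

lemma smooth_on_Pair:
  assumes "open U" "smooth_on U X" "smooth_on U Y"
  shows "smooth_on U (\<lambda>q. (X q, Y q))"
proof -
  have "smooth_on U (\<lambda>q. (X q, 0) + (0, Y q))"
    by (intro smooth_on_add assms smooth_on_linear_compose[of "\<lambda>x. (x, 0)"]
        smooth_on_linear_compose[of "\<lambda>x. (0, x)"] bounded_linear_Pair bounded_linear_ident bounded_linear_zero)
  then show ?thesis by simp
qed

lemmas smooth_on_fst = smooth_on_linear_compose[OF bounded_linear_fst]
lemmas smooth_on_snd = smooth_on_linear_compose[OF bounded_linear_snd]
lemmas smooth_on_vec_nth = smooth_on_linear_compose[OF bounded_linear_vec_nth]

lemma Ck_on_inverse:
  fixes h :: "'a::euclidean_space \<Rightarrow> real"
  assumes "open U" "\<And>q. q \<in> U \<Longrightarrow> h q \<noteq> 0"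
  shows "Ck_on k U h \<Longrightarrow> Ck_on k U (\<lambda>q. inverse (h q))"
proof (induction k)
  case 0
  then show ?case using assms by (auto intro!: continuous_intros)
next
  case (Suc k)
  have d: "((\<lambda>q. inverse (h q)) has_derivative (\<lambda>e. - (inverse (h q) * dif h q e * inverse (h q)))) (at q)"
    if "q \<in> U" for q
    using Suc.prems that assms by (intro Deriv.has_derivative_inverse) (auto simp: frechet_derivative_works[symmetric])
  have "Ck_on k U (\<lambda>q. dif (\<lambda>q. inverse (h q)) q e)" for e
  proof (subst Ck_on_cong[OF assms(1)])
    show "dif (\<lambda>q. inverse (h q)) r e = (-1) * (inverse (h r) * dif h r e * inverse (h r))" if "r \<in> U" for r
      using dif_eqI[OF d[OF that]] by simp
    show "Ck_on k U (\<lambda>r. (-1) * (inverse (h r) * dif h r e * inverse (h r)))"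
      using Suc Ck_on_Suc_imp[OF Suc.prems]
      by (intro Ck_on_bilinear[OF assms(1) bounded_bilinear_mult] Ck_on_const) auto
  qed
  then show ?case using d by (auto simp: differentiable_def)
qed

lemma smooth_on_divide:
  fixes h :: "'a::euclidean_space \<Rightarrow> real"
  assumes "open U" "smooth_on U g" "smooth_on U h" "\<And>q. q \<in> U \<Longrightarrow> h q \<noteq> 0"
  shows "smooth_on U (\<lambda>q. g q / h q)"
proof -
  have "smooth_on U (\<lambda>q. inverse (h q))"
    using assms(3,4) Ck_on_inverse[OF assms(1)] by (simp add: smooth_on_def)
  from smooth_on_mult[OF assms(1,2) this] show ?thesis by (simp add: divide_inverse)
qed

lemma smooth_on_real_antiderivative:
  fixes F :: "real \<Rightarrow> 'b::real_normed_vector"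
  assumes "open U" "\<And>t. t \<in> U \<Longrightarrow> (F has_vector_derivative h t) (at t)" "smooth_on U h"
  shows "smooth_on U F"
proof (rule smooth_on_SucI)
  show "F differentiable (at q)" if "q \<in> U" for q
    using assms(2)[OF that] by (auto simp: has_vector_derivative_def differentiable_def)
  show "smooth_on U (\<lambda>q. dif F q e)" for e
  proof (subst smooth_on_cong[OF assms(1)])
    show "dif F r e = e *\<^sub>R h r" if "r \<in> U" for r
      using dif_eqI assms(2)[OF that] by (simp add: has_vector_derivative_def dif_eqI)
    show "smooth_on U (\<lambda>r. e *\<^sub>R h r)" by (intro smooth_on_scaleR assms smooth_on_const)
  qed
qed

lemma Ck_on_sin_cos: "Ck_on k UNIV (sin :: real \<Rightarrow> real) \<and> Ck_on k UNIV (cos :: real \<Rightarrow> real)"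
proof (induction k)
  case 0
  show ?case by (auto intro!: continuous_intros)
next
  case (Suc k)
  have s: "dif sin q = (\<lambda>e. e * cos q)" and c: "dif cos q = (\<lambda>e. e * ((-1) * sin q))" for q :: real
    by (auto intro!: dif_eqI derivative_eq_intros)
  have ds: "sin differentiable (at q)" and dc: "cos differentiable (at q)" for q :: real
    by (auto simp: field_differentiable_at_sin field_differentiable_at_cos field_differentiable_imp_differentiable)
  show ?case
    using Suc unfolding Ck_on.simps s c
    by (intro conjI allI Ck_on_bilinear[OF open_UNIV bounded_bilinear_mult] Ck_on_const) (auto simp: ds dc)
qed

lemma smooth_on_sin: "open U \<Longrightarrow> smooth_on U X \<Longrightarrow> smooth_on U (\<lambda>q. sin (X q :: real))"
  and smooth_on_cos: "open U \<Longrightarrow> smooth_on U X \<Longrightarrow> smooth_on U (\<lambda>q. cos (X q :: real))"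
  by (rule smooth_on_compose[where V=UNIV]; simp add: smooth_on_def Ck_on_sin_cos)+

lemma dif_along_expand:
  fixes h :: "'a::euclidean_space \<Rightarrow> 'b::real_normed_vector"
  assumes "smooth_on U h" "r \<in> U"
  shows "dif h r w = (\<Sum>b\<in>Basis. (w \<bullet> b) *\<^sub>R dif h r b)"
proof -
  note lin = dif_linear[OF assms]
  have "dif h r w = dif h r (\<Sum>b\<in>Basis. (w \<bullet> b) *\<^sub>R b)" by (simp add: euclidean_representation)
  then show ?thesis by (simp add: linear_sum[OF lin] linear_cmul[OF lin])
qed

lemma smooth_on_dif_along:
  fixes h :: "'a::euclidean_space \<Rightarrow> 'b::real_normed_vector"
  assumes "open U" "smooth_on U h" "smooth_on U E"
  shows "smooth_on U (\<lambda>q. dif h q (E q))"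
proof (subst smooth_on_cong[OF assms(1)])
  show "dif h r (E r) = (\<Sum>b\<in>Basis. (E r \<bullet> b) *\<^sub>R dif h r b)" if "r \<in> U" for r
    by (rule dif_along_expand[OF assms(2) that])
  show "smooth_on U (\<lambda>r. \<Sum>b\<in>Basis. (E r \<bullet> b) *\<^sub>R dif h r b)"
    unfolding smooth_on_def
  proof (intro allI Ck_on_sum[OF assms(1) finite_Basis])
    fix k b
    have "smooth_on U (\<lambda>r. (E r \<bullet> b) *\<^sub>R dif h r b)"
      by (intro smooth_on_scaleR smooth_on_inner smooth_on_const smooth_on_dif assms)
    then show "Ck_on k U (\<lambda>r. (E r \<bullet> b) *\<^sub>R dif h r b)" by (simp add: smooth_on_def)
  qed
qed

text \<open>
  Both mixed second derivatives are limits of the second difference quotient over small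
  parallelograms, which is symmetric in the two directions.
\<close>
lemma second_difference_mvt:
  fixes h :: "'a::euclidean_space \<Rightarrow> real"
  assumes "smooth_on U h" "t > 0"
    and sub: "\<And>s r. \<lbrakk>0 \<le> s; s \<le> t; 0 \<le> r; r \<le> t\<rbrakk> \<Longrightarrow> q + s *\<^sub>R a + r *\<^sub>R b \<in> U"
  obtains s r where "0 \<le> s" "s \<le> t" "0 \<le> r" "r \<le> t"
    "h (q + t *\<^sub>R a + t *\<^sub>R b) - h (q + t *\<^sub>R a) - h (q + t *\<^sub>R b) + h q
       = t * t * dif (\<lambda>p. dif h p a) (q + s *\<^sub>R a + r *\<^sub>R b) b"
proof -
  define g where "g s = h (q + s *\<^sub>R a + t *\<^sub>R b) - h (q + s *\<^sub>R a)" for s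
  have line: "((\<lambda>s. k (p + s *\<^sub>R v)) has_derivative (\<lambda>e. e * dif k (p + s *\<^sub>R v) v)) (at s)"
    if "smooth_on U k" "p + s *\<^sub>R v \<in> U" for k :: "'a \<Rightarrow> real" and p v s
  proof -
    have "((\<lambda>s. k (p + s *\<^sub>R v)) has_derivative (\<lambda>e. dif k (p + s *\<^sub>R v) (e *\<^sub>R v))) (at s)"
      by (rule has_derivative_compose[of "\<lambda>s. p + s *\<^sub>R v" "\<lambda>e. e *\<^sub>R v" s UNIV, OF _ smooth_on_has_derivative[OF that]])
        (auto intro!: derivative_eq_intros)
    then show ?thesis by (simp add: linear_cmul[OF dif_linear[OF that]])
  qed
  have s0: "smooth_on U (\<lambda>p. dif h p a)" by (rule smooth_on_dif) fact
  have dg: "(g has_derivative (\<lambda>e. e * (dif h (q + s *\<^sub>R a + t *\<^sub>R b) a - dif h (q + s *\<^sub>R a) a))) (at s)"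
    if "0 \<le> s" "s \<le> t" for s
  proof -
    have "q + t *\<^sub>R b + s *\<^sub>R a \<in> U" "q + s *\<^sub>R a \<in> U"
      using sub[of s t] sub[of s 0] that assms(2) by (auto simp: algebra_simps)
    from has_derivative_diff[OF line[OF assms(1) this(1)] line[OF assms(1) this(2)]]
    show ?thesis unfolding g_def by (simp add: algebra_simps)
  qed
  have "\<exists>s\<in>{0<..<t}. g t - g 0 = (t - 0) * (dif h (q + s *\<^sub>R a + t *\<^sub>R b) a - dif h (q + s *\<^sub>R a) a)"
    by (rule mvt_simple[OF assms(2)], rule has_derivative_at_withinI, rule dg)
  then obtain s where s: "0 < s" "s < t"
    "g t - g 0 = t * (dif h (q + s *\<^sub>R a + t *\<^sub>R b) a - dif h (q + s *\<^sub>R a) a)"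
    by auto
  let ?k = "\<lambda>r. dif h (q + s *\<^sub>R a + r *\<^sub>R b) a"
  have dk: "(?k has_derivative (\<lambda>e. e * dif (\<lambda>p. dif h p a) (q + s *\<^sub>R a + r *\<^sub>R b) b)) (at r)"
    if "0 \<le> r" "r \<le> t" for r
    using sub[of s r] s that by (intro line s0) auto
  have "\<exists>r\<in>{0<..<t}. ?k t - ?k 0 = (t - 0) * dif (\<lambda>p. dif h p a) (q + s *\<^sub>R a + r *\<^sub>R b) b"
    by (rule mvt_simple[OF assms(2)], rule has_derivative_at_withinI, rule dk)
  then obtain r where r: "0 < r" "r < t" "?k t - ?k 0 = t * dif (\<lambda>p. dif h p a) (q + s *\<^sub>R a + r *\<^sub>R b) b"
    by auto
  have "g t - g 0 = t * t * dif (\<lambda>p. dif h p a) (q + s *\<^sub>R a + r *\<^sub>R b) b"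
    using s(3) r(3) by simp
  then show ?thesis using that[of s r] s r by (simp add: g_def algebra_simps)
qed

lemma Clairaut_real:
  fixes h :: "'a::euclidean_space \<Rightarrow> real"
  assumes "open U" "smooth_on U h" "q \<in> U"
  shows "dif (\<lambda>p. dif h p a) q b = dif (\<lambda>p. dif h p b) q a"
proof (rule ccontr)
  assume ne: "\<not> ?thesis"
  let ?A = "\<lambda>p. dif (\<lambda>p. dif h p a) p b" and ?B = "\<lambda>p. dif (\<lambda>p. dif h p b) p a"
  define \<epsilon> where "\<epsilon> = \<bar>?A q - ?B q\<bar> / 2"
  have "\<epsilon> > 0" using ne by (simp add: \<epsilon>_def)
  have cont: "isCont ?A q" "isCont ?B q"
    using smooth_on_continuous[OF smooth_on_dif[OF smooth_on_dif[OF assms(2)]]] assms(1,3)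
    by (auto simp: continuous_on_eq_continuous_at)
  obtain d1 where d1: "d1 > 0" "\<And>p. dist p q < d1 \<Longrightarrow> dist (?A p) (?A q) < \<epsilon>"
    using cont(1) \<open>\<epsilon> > 0\<close> unfolding continuous_at_eps_delta by metis
  obtain d2 where d2: "d2 > 0" "\<And>p. dist p q < d2 \<Longrightarrow> dist (?B p) (?B q) < \<epsilon>"
    using cont(2) \<open>\<epsilon> > 0\<close> unfolding continuous_at_eps_delta by metis
  obtain d3 where d3: "d3 > 0" "ball q d3 \<subseteq> U" using assms(1,3) openE by blast
  define d where "d = min d1 (min d2 d3)"
  define t where "t = d / (2 * (norm a + norm b + 1))"
  have "d > 0" using d1 d2 d3 by (simp add: d_def)
  have pos: "norm a + norm b + 1 > 0" by (smt (verit) norm_ge_zero)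
  then have "t > 0" using \<open>d > 0\<close> by (simp add: t_def)
  have near: "dist (q + s *\<^sub>R a + r *\<^sub>R b) q < d" if "0 \<le> s" "s \<le> t" "0 \<le> r" "r \<le> t" for s r
  proof -
    have "dist (q + s *\<^sub>R a + r *\<^sub>R b) q = norm (s *\<^sub>R a + r *\<^sub>R b)" by (simp add: dist_norm algebra_simps)
    also have "\<dots> \<le> s * norm a + r * norm b" using that norm_triangle_ineq[of "s *\<^sub>R a" "r *\<^sub>R b"] by simp
    also have "\<dots> \<le> t * norm a + t * norm b" using that by (intro add_mono mult_right_mono) auto
    also have "\<dots> < 2 * t * (norm a + norm b + 1)" using \<open>t > 0\<close> by (simp add: algebra_simps) (smt (verit) mult_nonneg_nonneg norm_ge_zero)
    also have "\<dots> = d" using pos by (simp add: t_def del: distrib_left_numeral)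
    finally show ?thesis .
  qed
  have inU: "q + s *\<^sub>R a + r *\<^sub>R b \<in> U" if "0 \<le> s" "s \<le> t" "0 \<le> r" "r \<le> t" for s r
    using near[OF that] d3 by (auto simp: d_def dist_commute)
  have inU': "q + s *\<^sub>R b + r *\<^sub>R a \<in> U" if "0 \<le> s" "s \<le> t" "0 \<le> r" "r \<le> t" for s r
    using inU[of r s] that by (simp add: algebra_simps)
  obtain s r where 1: "0 \<le> s" "s \<le> t" "0 \<le> r" "r \<le> t"
    "h (q + t *\<^sub>R a + t *\<^sub>R b) - h (q + t *\<^sub>R a) - h (q + t *\<^sub>R b) + h q = t * t * ?A (q + s *\<^sub>R a + r *\<^sub>R b)"
    using second_difference_mvt[OF assms(2) \<open>t > 0\<close> inU] by blast
  obtain s' r' where 2: "0 \<le> s'" "s' \<le> t" "0 \<le> r'" "r' \<le> t"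
    "h (q + t *\<^sub>R b + t *\<^sub>R a) - h (q + t *\<^sub>R b) - h (q + t *\<^sub>R a) + h q = t * t * ?B (q + s' *\<^sub>R b + r' *\<^sub>R a)"
    using second_difference_mvt[OF assms(2) \<open>t > 0\<close> inU'] by blast
  have "q + t *\<^sub>R b + t *\<^sub>R a = q + t *\<^sub>R a + t *\<^sub>R b" by (simp add: algebra_simps)
  then have "h (q + t *\<^sub>R b + t *\<^sub>R a) = h (q + t *\<^sub>R a + t *\<^sub>R b)" by (rule arg_cong)
  then have "t * t * ?A (q + s *\<^sub>R a + r *\<^sub>R b) = t * t * ?B (q + s' *\<^sub>R b + r' *\<^sub>R a)"
    unfolding 1(5)[symmetric] 2(5)[symmetric] by simp
  then have eq: "?A (q + s *\<^sub>R a + r *\<^sub>R b) = ?B (q + s' *\<^sub>R b + r' *\<^sub>R a)" using \<open>t > 0\<close> by simp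
  have "dist (?A (q + s *\<^sub>R a + r *\<^sub>R b)) (?A q) < \<epsilon>"
    using near[OF 1(1-4)] by (intro d1) (simp add: d_def)
  moreover have "dist (?B (q + s' *\<^sub>R b + r' *\<^sub>R a)) (?B q) < \<epsilon>"
    using near[OF 2(3,4,1,2)] by (intro d2) (simp add: d_def algebra_simps)
  ultimately show False using eq by (simp add: \<epsilon>_def dist_real_def abs_if split: if_splits)
qed

lemma Clairaut:
  fixes h :: "'a::euclidean_space \<Rightarrow> 'b::euclidean_space"
  assumes "open U" "smooth_on U h" "q \<in> U"
  shows "dif (\<lambda>p. dif h p a) q b = dif (\<lambda>p. dif h p b) q a"
proof (rule euclidean_eqI)
  fix i :: 'b assume "i \<in> Basis"
  have inn: "dif (\<lambda>p. k p \<bullet> i) r e = dif k r e \<bullet> i" if "smooth_on U k" "r \<in> U" for k :: "'a \<Rightarrow> 'b" and r e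
    using dif_eqI[OF has_derivative_inner_left[OF smooth_on_has_derivative[OF that]]] by simp
  have step: "dif (\<lambda>p. dif h p a) q b \<bullet> i = dif (\<lambda>p. dif (\<lambda>p. h p \<bullet> i) p a) q b" for a b
  proof -
    have "dif (\<lambda>p. dif h p a) q b \<bullet> i = dif (\<lambda>p. dif h p a \<bullet> i) q b"
      by (intro inn[symmetric] smooth_on_dif assms)
    also have "\<dots> = dif (\<lambda>p. dif (\<lambda>p. h p \<bullet> i) p a) q b"
      using inn[OF assms(2)] by (subst dif_cong_open[OF assms(1,3)]) auto
    finally show ?thesis .
  qed
  show "dif (\<lambda>p. dif h p a) q b \<bullet> i = dif (\<lambda>p. dif h p b) q a \<bullet> i"
    unfolding step by (intro Clairaut_real[OF assms(1) _ assms(3)] smooth_on_inner smooth_on_const assms)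
qed

section \<open>The scalar product of the space forms\<close>

lemma pseudo_inner_commute: "pseudo_inner c x y = pseudo_inner c y x"
  by (simp add: pseudo_inner_def mult.commute)

lemma bounded_bilinear_pseudo_inner: "bounded_bilinear (pseudo_inner c)"
proof
  show "pseudo_inner c (a + a') b = pseudo_inner c a b + pseudo_inner c a' b"
    "pseudo_inner c a (b + b') = pseudo_inner c a b + pseudo_inner c a b'"
    "pseudo_inner c (r *\<^sub>R a) b = r *\<^sub>R pseudo_inner c a b"
    "pseudo_inner c a (r *\<^sub>R b) = r *\<^sub>R pseudo_inner c a b" for a a' b b' :: "real^4" and r
    by (simp_all add: pseudo_inner_def algebra_simps)
  have "\<bar>pseudo_inner c a b\<bar> \<le> norm a * norm b * 4" for a b
  proof -
    have 1: "\<bar>a$i * b$i\<bar> \<le> norm a * norm b" for i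
      by (simp add: abs_mult mult_mono component_le_norm_cart)
    show ?thesis
      using 1[of 1] 1[of 2] 1[of 3] 1[of 4] by (auto simp: pseudo_inner_def)
  qed
  then show "\<exists>K. \<forall>a b. norm (pseudo_inner c a b) \<le> norm a * norm b * K" by auto
qed

interpretation psi: bounded_bilinear "pseudo_inner c" for c
  by (rule bounded_bilinear_pseudo_inner)

lemmas psi_simps = psi.add_left psi.add_right psi.diff_left psi.diff_right
  psi.scaleR_left psi.scaleR_right psi.minus_left psi.minus_right psi.zero_left psi.zero_right

lemmas smooth_on_psi = smooth_on_bilinear[OF bounded_bilinear_pseudo_inner]

lemma pseudo_inner_nondegenerate:
  assumes "\<And>w. pseudo_inner c v w = 0" shows "v = 0"
proof -
  have "v $ i = 0" for i
    using assms[of "axis i 1"] exhaust_4[of i]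
    by (auto simp: pseudo_inner_def axis_def split: if_splits)
  then show ?thesis by (simp add: vec_eq_iff)
qed

text \<open>
  A normal vector of the hypersurface \<open>space_form c\<close> at \<open>x\<close>. The position vector serves for the two
  quadrics, a constant vector for the hyperplane \<open>c = 0\<close>; this lets the three cases share most proofs.
\<close>
definition nvec :: "real \<Rightarrow> real^4 \<Rightarrow> real^4"
  where "nvec c x = (if c = 0 then axis 4 1 else x)"

definition nsign :: "real \<Rightarrow> real"
  where "nsign c = (if c = 0 then 1 else c)"

lemma nsign_square: "c \<in> {-1, 0, 1} \<Longrightarrow> nsign c * nsign c = 1"
  by (auto simp: nsign_def)

lemma nvec_square: "x \<in> space_form c \<Longrightarrow> pseudo_inner c (nvec c x) (nvec c x) = nsign c"
  by (auto simp: nvec_def nsign_def space_form_def pseudo_inner_def axis_def)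

text \<open>Orthogonal projection onto the tangent space of \<open>space_form c\<close> at \<open>x\<close>.\<close>
definition tproj :: "real \<Rightarrow> real^4 \<Rightarrow> real^4 \<Rightarrow> real^4"
  where "tproj c x v = v - (nsign c * pseudo_inner c v (nvec c x)) *\<^sub>R nvec c x"

lemma tproj_orthogonal:
  assumes "c \<in> {-1, 0, 1}" "x \<in> space_form c"
  shows "pseudo_inner c (tproj c x v) (nvec c x) = 0"
proof -
  have "pseudo_inner c (tproj c x v) (nvec c x) = pseudo_inner c v (nvec c x) * (1 - nsign c * nsign c)"
    by (simp add: tproj_def psi_simps nvec_square[OF assms(2)] algebra_simps)
  then show ?thesis using nsign_square[OF assms(1)] by simp
qed

lemma tproj_pseudo_inner:
  "pseudo_inner c w (nvec c x) = 0 \<Longrightarrow> pseudo_inner c (tproj c x v) w = pseudo_inner c v w"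
  by (simp add: tproj_def psi_simps pseudo_inner_commute[of c "nvec c x" w])

lemma tproj_tangent: "pseudo_inner c v (nvec c x) = 0 \<Longrightarrow> tproj c x v = v"
  by (simp add: tproj_def)

text \<open>
  A rational parametrization of a curve in \<open>space_form c\<close> from \<open>x\<close> in the tangent direction \<open>Z\<close>
  (stereographic projection); rationality keeps smooth families of such curves elementary.
\<close>
definition sf_move :: "real \<Rightarrow> real^4 \<Rightarrow> real^4 \<Rightarrow> real \<Rightarrow> real^4"
  where "sf_move c x Z s =
    (1 / (1 + c * s\<^sup>2 * pseudo_inner c Z Z / 4)) *\<^sub>R
      ((1 - c * s\<^sup>2 * pseudo_inner c Z Z / 4) *\<^sub>R x + s *\<^sub>R Z)"

lemma sf_move_in_space_form:
  assumes "c \<in> {-1, 0, 1}" "x \<in> space_form c" "pseudo_inner c Z (nvec c x) = 0"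
    and "1 + c * s\<^sup>2 * pseudo_inner c Z Z / 4 \<noteq> 0"
  shows "sf_move c x Z s \<in> space_form c"
proof (cases "c = 0")
  case True
  then have "Z $ 4 = 0" using assms(3) by (simp add: nvec_def pseudo_inner_def axis_def)
  then show ?thesis using True assms by (simp add: sf_move_def space_form_def)
next
  case False
  define \<zeta> where "\<zeta> = pseudo_inner c Z Z"
  define \<beta> where "\<beta> = 1 + c * s\<^sup>2 * \<zeta> / 4"
  define \<alpha> where "\<alpha> = 1 - c * s\<^sup>2 * \<zeta> / 4"
  have "c * c = 1" using False assms(1) by auto
  have x: "pseudo_inner c x x = c" and Z: "pseudo_inner c Z x = 0" "pseudo_inner c x Z = 0"
    using False assms(2,3) by (auto simp: space_form_def nvec_def pseudo_inner_commute)
  have b: "\<beta> \<noteq> 0" using assms(4) by (simp add: \<beta>_def \<zeta>_def)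
  have "\<alpha> * \<alpha> * c + s * s * \<zeta> = c * (\<beta> * \<beta>)"
  proof -
    have "c * (\<beta> * \<beta>) - \<alpha> * \<alpha> * c = (c * c) * (s * s * \<zeta>)"
      unfolding \<alpha>_def \<beta>_def by (simp add: field_simps power2_eq_square)
    then show ?thesis using \<open>c * c = 1\<close> by simp
  qed
  moreover have "pseudo_inner c (sf_move c x Z s) (sf_move c x Z s) = (\<alpha> * \<alpha> * c + s * s * \<zeta>) / (\<beta> * \<beta>)"
    unfolding sf_move_def \<zeta>_def[symmetric] \<alpha>_def[symmetric] \<beta>_def[symmetric]
    by (simp add: psi_simps x Z \<zeta>_def[symmetric] add_divide_distrib mult_ac)
  ultimately show ?thesis using b False by (simp add: space_form_def)
qed

lemma sf_move_0: "sf_move c x Z 0 = x"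
  by (simp add: sf_move_def)

lemma sf_move_has_derivative: "((\<lambda>s. sf_move c x Z s) has_vector_derivative Z) (at 0)"
  unfolding sf_move_def has_vector_derivative_def
  by (auto intro!: derivative_eq_intros simp: fun_eq_iff)

section \<open>The static space-time and its Levi-Civita connection\<close>

text \<open>
  A curve in the space form satisfies the equation of the hypersurface, whose derivative is
  orthogonality to \<open>nvec\<close>; conversely \<open>sf_move\<close> supplies a curve with a prescribed velocity.
\<close>
lemma tangent_space_static:
  assumes c: "c \<in> {-1, 0, 1}" and "open I" and p: "p \<in> static_space c I"
  shows "tangent_space (static_space c I) p = {v. pseudo_inner c (fst v) (nvec c (fst p)) = 0}"
proof (intro set_eqI iffI; clarsimp)
  fix v :: "real^4" and r
  assume "(v, r) \<in> tangent_space (static_space c I) p"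
  then obtain \<gamma> where \<gamma>: "\<gamma> 0 = p" "\<forall>\<^sub>F t in nhds 0. \<gamma> t \<in> static_space c I"
    "(\<gamma> has_vector_derivative (v, r)) (at (0::real))"
    by (auto simp: tangent_space_def)
  then obtain S where S: "open S" "0 \<in> S" "\<And>t. t \<in> S \<Longrightarrow> fst (\<gamma> t) \<in> space_form c"
    unfolding eventually_nhds static_space_def by fastforce
  have d: "((\<lambda>t. fst (\<gamma> t)) has_vector_derivative v) (at 0)"
    using bounded_linear.has_vector_derivative[OF bounded_linear_fst \<gamma>(3)] by simp
  have zero: "((\<lambda>t. k) has_derivative D) (at 0) \<Longrightarrow> D (1::real) = (0::real)" for k D
    using has_derivative_unique[OF _ has_derivative_const] by metis
  show "pseudo_inner c v (nvec c (fst p)) = 0"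
  proof (cases "c = 0")
    case True
    have "((\<lambda>t. fst (\<gamma> t) $ 4) has_derivative (\<lambda>e. (e *\<^sub>R v) $ 4)) (at 0)"
      using bounded_linear.has_derivative[OF bounded_linear_vec_nth d[unfolded has_vector_derivative_def]] .
    then have "((\<lambda>t. 0) has_derivative (\<lambda>e. (e *\<^sub>R v) $ 4)) (at (0::real))"
      by (rule has_derivative_transform_within_open[OF _ S(1,2)])
        (use S(3) True in \<open>auto simp: space_form_def\<close>)
    from zero[OF this] show ?thesis using True by (simp add: nvec_def pseudo_inner_def axis_def)
  next
    case False
    have "((\<lambda>t. pseudo_inner c (fst (\<gamma> t)) (fst (\<gamma> t))) has_derivative
       (\<lambda>e. pseudo_inner c (fst (\<gamma> 0)) (e *\<^sub>R v) + pseudo_inner c (e *\<^sub>R v) (fst (\<gamma> 0)))) (at 0)"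
      using psi.FDERIV d unfolding has_vector_derivative_def by blast
    then have "((\<lambda>t. c) has_derivative
       (\<lambda>e. pseudo_inner c (fst (\<gamma> 0)) (e *\<^sub>R v) + pseudo_inner c (e *\<^sub>R v) (fst (\<gamma> 0)))) (at (0::real))"
      by (rule has_derivative_transform_within_open[OF _ S(1,2)])
        (use S(3) False in \<open>auto simp: space_form_def\<close>)
    from zero[OF this] show ?thesis
      using False \<gamma>(1) by (simp add: nvec_def pseudo_inner_commute)
  qed
next
  fix v :: "real^4" and r :: real
  assume v: "pseudo_inner c v (nvec c (fst p)) = 0"
  let ?b = "\<lambda>s::real. 1 + c * s\<^sup>2 * pseudo_inner c v v / 4"
  define \<gamma> where "\<gamma> s = (sf_move c (fst p) v s, snd p + s * r)" for s
  let ?S = "{s. ?b s \<noteq> 0} \<inter> (\<lambda>s. snd p + s * r) -` I"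
  have "open ?S"
    by (intro open_Int open_Collect_neq continuous_intros open_vimage \<open>open I\<close>) (auto intro!: continuous_intros)
  moreover have "0 \<in> ?S" using p by (auto simp: static_space_def)
  moreover have "\<gamma> s \<in> static_space c I" if "s \<in> ?S" for s
    using that p sf_move_in_space_form[OF c _ v] by (auto simp: \<gamma>_def static_space_def)
  ultimately have "\<forall>\<^sub>F s in nhds 0. \<gamma> s \<in> static_space c I"
    unfolding eventually_nhds by blast
  moreover have "(\<gamma> has_vector_derivative (v, r)) (at 0)"
    unfolding \<gamma>_def
    by (intro has_vector_derivative_Pair sf_move_has_derivative)
      (auto intro!: derivative_eq_intros simp: has_vector_derivative_def)
  moreover have "\<gamma> 0 = p" by (simp add: \<gamma>_def sf_move_0)
  ultimately show "(v, r) \<in> tangent_space (static_space c I) p"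
    unfolding tangent_space_def by blast
qed

text \<open>
  The right-hand side of the Koszul formula for the warped metric: \<open>E\<close> is the velocity, \<open>V\<close> the
  field, \<open>dV\<close> its derivative in the surrounding space and \<open>Z\<close> the test vector. The metric
  depends on the point only through \<open>f\<^sup>2\<close>, whose derivative contributes the factor \<open>f * f'\<close>.
\<close>
definition koszul :: "real \<Rightarrow> (real \<Rightarrow> real) \<Rightarrow> (real^4) \<times> real \<Rightarrow> (real^4) \<times> real \<Rightarrow> (real^4) \<times> real
    \<Rightarrow> (real^4) \<times> real \<Rightarrow> (real^4) \<times> real \<Rightarrow> real"
  where "koszul c f p E V dV Z = static_metric c f p dV Z +
    f (snd p) * dif f (snd p) 1 * (snd E * pseudo_inner c (fst V) (fst Z)
      + snd V * pseudo_inner c (fst E) (fst Z) - snd Z * pseudo_inner c (fst E) (fst V))"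

lemma static_metric_commute: "static_metric c f p v w = static_metric c f p w v"
  by (simp add: static_metric_def pseudo_inner_commute mult.commute)

lemma static_metric_simps:
  "static_metric c f p (v + v') w = static_metric c f p v w + static_metric c f p v' w"
  "static_metric c f p w (v + v') = static_metric c f p w v + static_metric c f p w v'"
  "static_metric c f p (v - v') w = static_metric c f p v w - static_metric c f p v' w"
  "static_metric c f p w (v - v') = static_metric c f p w v - static_metric c f p w v'"
  "static_metric c f p (r *\<^sub>R v) w = r * static_metric c f p v w"
  "static_metric c f p w (r *\<^sub>R v) = r * static_metric c f p w v"
  "static_metric c f p 0 w = 0"
  "static_metric c f p w 0 = 0"
  "static_metric c f p (- v) w = - static_metric c f p v w"
  by (simp_all add: static_metric_def psi_simps algebra_simps)

lemma metric_deriv_static: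
  assumes "f differentiable (at (snd p))"
  shows "metric_deriv (static_metric c f) p W Y Z
    = 2 * f (snd p) * dif f (snd p) 1 * snd W * pseudo_inner c (fst Y) (fst Z)"
proof -
  have lin: "linear (dif f (snd p))" using assms by (rule linear_frechet_derivative)
  have "(f has_derivative dif f (snd p)) (at (snd p))" using assms by (simp add: frechet_derivative_works)
  from has_derivative_compose[OF has_derivative_snd[OF has_derivative_ident] this]
  have df: "((\<lambda>x. f (snd x)) has_derivative (\<lambda>W. dif f (snd p) (snd W))) (at p)" .
  have "((\<lambda>x. static_metric c f x Y Z) has_derivative
      (\<lambda>W. 2 * f (snd p) * dif f (snd p) (snd W) * pseudo_inner c (fst Y) (fst Z))) (at p)"
    unfolding static_metric_def by (auto intro!: derivative_eq_intros df)
  note d = dif_eqI[OF this]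
  have "dif f (snd p) r = r * dif f (snd p) 1" for r
    using linear_cmul[OF lin, of r 1] by simp
  from this[of "snd W"] show ?thesis unfolding metric_deriv_def d by simp
qed

lemma static_metric_nondegenerate_tangent:
  assumes "c \<in> {-1, 0, 1}" "fst p \<in> space_form c" "f (snd p) \<noteq> 0"
    and "pseudo_inner c (fst v) (nvec c (fst p)) = 0"
    and "\<And>Z. pseudo_inner c (fst Z) (nvec c (fst p)) = 0 \<Longrightarrow> static_metric c f p v Z = 0"
  shows "v = 0"
proof -
  have "pseudo_inner c (fst v) w = 0" for w
    using assms(5)[of "(tproj c (fst p) w, 0)"] tproj_orthogonal[OF assms(1,2), of w] assms(3)
      tproj_pseudo_inner[OF assms(4), of w]
    by (simp add: static_metric_def pseudo_inner_commute)
  then have "fst v = 0" by (rule pseudo_inner_nondegenerate)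
  moreover have "snd v = 0"
    using assms(5)[of "(0, 1)"] by (simp add: static_metric_def psi_simps)
  ultimately show ?thesis by (simp add: prod_eq_iff)
qed

text \<open>
  A vector with the required products is written down explicitly; the metric is nondegenerate on
  the tangent space, so there is only one, and the definite description denotes it.
\<close>
lemma cov_deriv_static:
  fixes X V :: "'b::euclidean_space \<Rightarrow> (real^4) \<times> real"
    and e q :: 'b
  assumes c: "c \<in> {-1, 0, 1}" and "open I" and X: "X q \<in> static_space c I"
    and f: "f differentiable (at (snd (X q)))" "f (snd (X q)) \<noteq> 0"
  defines W_def: "W \<equiv> cov_deriv (static_space c I) (static_metric c f) X V e q"
  shows "pseudo_inner c (fst W) (nvec c (fst (X q))) = 0"
    and "pseudo_inner c (fst Z) (nvec c (fst (X q))) = 0 \<Longrightarrow>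
      static_metric c f (X q) W Z = koszul c f (X q) (dif X q e) (V q) (dif V q e) Z"
proof -
  let ?p = "X q"
  let ?T = "{v. pseudo_inner c (fst v) (nvec c (fst ?p)) = 0}"
  let ?f = "f (snd ?p)" and ?f' = "dif f (snd ?p) 1"
  have sf: "fst ?p \<in> space_form c" using X by (auto simp: static_space_def)
  let ?P = "\<lambda>W. W \<in> ?T \<and> (\<forall>Z\<in>?T. static_metric c f ?p W Z = koszul c f ?p (dif X q e) (V q) (dif V q e) Z)"
  define W0 where "W0 = (tproj c (fst ?p) (fst (dif V q e) + (?f' / ?f) *\<^sub>R
      (snd (dif X q e) *\<^sub>R fst (V q) + snd (V q) *\<^sub>R fst (dif X q e))),
     snd (dif V q e) - ?f * ?f' * pseudo_inner c (fst (dif X q e)) (fst (V q)))"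
  have 0: "?P W0"
  proof (intro conjI ballI)
    show "W0 \<in> ?T" by (simp add: W0_def tproj_orthogonal[OF c sf])
    fix Z :: "(real^4) \<times> real" assume "Z \<in> ?T"
    then have Z: "pseudo_inner c (tproj c (fst ?p) v) (fst Z) = pseudo_inner c v (fst Z)" for v
      by (simp add: tproj_pseudo_inner)
    have ff: "?f\<^sup>2 * (a + ?f' / ?f * b) = ?f\<^sup>2 * a + ?f * ?f' * b" for a b
      using f(2) by (simp add: field_simps power2_eq_square)
    show "static_metric c f ?p W0 Z = koszul c f ?p (dif X q e) (V q) (dif V q e) Z"
      unfolding static_metric_def koszul_def W0_def fst_conv snd_conv Z psi.add_left psi.scaleR_left
        real_scaleR_def ff
      by (simp add: algebra_simps)
  qed
  have uniq: "W' = W0" if "?P W'" for W'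
  proof -
    have "W' - W0 = 0"
      by (rule static_metric_nondegenerate_tangent[where c=c and f=f and p="?p"])
        (use that 0 c sf f in \<open>auto simp: static_metric_simps psi_simps\<close>)
    then show ?thesis by simp
  qed
  have "static_metric c f ?p (dif V q e) Z
      + (metric_deriv (static_metric c f) ?p (dif X q e) (V q) Z
         + metric_deriv (static_metric c f) ?p (V q) (dif X q e) Z
         - metric_deriv (static_metric c f) ?p Z (dif X q e) (V q)) / 2
    = koszul c f ?p (dif X q e) (V q) (dif V q e) Z" for Z
    unfolding metric_deriv_static[OF f(1)] koszul_def
    by (simp add: algebra_simps diff_divide_distrib add_divide_distrib)
  then have "W = (THE W. ?P W)"
    unfolding W_def cov_deriv_def tangent_space_static[OF c \<open>open I\<close> X] by simp
  then have "W = W0" using the_equality[of ?P, OF 0 uniq] by simp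
  then have "?P W" using 0 by simp
  then show "pseudo_inner c (fst W) (nvec c (fst (X q))) = 0" by simp
  show "static_metric c f (X q) W Z = koszul c f (X q) (dif X q e) (V q) (dif V q e) Z"
    if "pseudo_inner c (fst Z) (nvec c (fst (X q))) = 0"
    using \<open>?P W\<close> that by blast
qed

section \<open>The second fundamental form of a surface\<close>

lemma static_metric_has_derivative:
  assumes Y: "(Y has_derivative Y') (at q)" and A: "(A has_derivative A') (at q)"
    and B: "(B has_derivative B') (at q)" and f: "f differentiable (at (snd (Y q)))"
  shows "((\<lambda>r. static_metric c f (Y r) (A r) (B r)) has_derivative
    (\<lambda>e. static_metric c f (Y q) (A' e) (B q) + static_metric c f (Y q) (A q) (B' e)
      + 2 * f (snd (Y q)) * dif f (snd (Y q)) 1 * snd (Y' e) * pseudo_inner c (fst (A q)) (fst (B q)))) (at q)"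
proof -
  have lin: "linear (dif f (snd (Y q)))" using f by (rule linear_frechet_derivative)
  have df: "((\<lambda>r. f (snd (Y r))) has_derivative (\<lambda>e. snd (Y' e) * dif f (snd (Y q)) 1)) (at q)"
  proof -
    have "(f has_derivative dif f (snd (Y q))) (at (snd (Y q)))" using f by (simp add: frechet_derivative_works)
    from has_derivative_compose[OF has_derivative_snd[OF Y] this]
    have "((\<lambda>r. f (snd (Y r))) has_derivative (\<lambda>e. dif f (snd (Y q)) (snd (Y' e)))) (at q)" .
    moreover have "dif f (snd (Y q)) r = r * dif f (snd (Y q)) 1" for r
      using linear_cmul[OF lin, of r 1] by simp
    then have "dif f (snd (Y q)) = (\<lambda>r. r * dif f (snd (Y q)) 1)" by (rule ext)
    ultimately show ?thesis by (rule back_subst[of "\<lambda>D. (_ has_derivative (\<lambda>e. D (snd (Y' e)))) (at q)"])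
  qed
  note psi_d = psi.FDERIV[OF has_derivative_fst[OF A] has_derivative_fst[OF B]]
  note snd_d = has_derivative_mult[OF has_derivative_snd[OF A] has_derivative_snd[OF B]]
  have "((\<lambda>r. f (snd (Y r)) * f (snd (Y r)) * pseudo_inner c (fst (A r)) (fst (B r)) + snd (A r) * snd (B r))
    has_derivative
    (\<lambda>e. f (snd (Y q)) * f (snd (Y q)) *
          (pseudo_inner c (fst (A q)) (fst (B' e)) + pseudo_inner c (fst (A' e)) (fst (B q)))
       + (f (snd (Y q)) * (snd (Y' e) * dif f (snd (Y q)) 1) + snd (Y' e) * dif f (snd (Y q)) 1 * f (snd (Y q)))
          * pseudo_inner c (fst (A q)) (fst (B q))
       + (snd (A q) * snd (B' e) + snd (A' e) * snd (B q)))) (at q)"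
    by (rule has_derivative_add[OF has_derivative_mult[OF has_derivative_mult[OF df df] psi_d] snd_d])
  then show ?thesis
    unfolding static_metric_def power2_eq_square
    by (rule back_subst[of "\<lambda>D. (_ has_derivative D) (at q)"]) (auto simp: fun_eq_iff algebra_simps)
qed

text \<open>
  The Weingarten equation is the derivative of the orthogonality relation. The normal field enters
  only through its values along \<open>Y\<close>, so a field given in another parametrization and pulled back
  along a merely differentiable change of parameters is covered as well.
\<close>
lemma weingarten:
  fixes Y :: "'b::euclidean_space \<Rightarrow> (real^4) \<times> real"
  assumes "open U" "smooth_on U Y" "q \<in> U" and f: "f differentiable (at (snd (Y q)))"
    and \<eta>: "(\<eta> has_derivative \<eta>') (at q)"
    and normal: "\<And>r. r \<in> U \<Longrightarrow> static_metric c f (Y r) (\<eta> r) (dif Y r e') = 0"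
  shows "koszul c f (Y q) (dif Y q e) (\<eta> q) (\<eta>' e) (dif Y q e')
    = - koszul c f (Y q) (dif Y q e) (dif Y q e') (dif (\<lambda>r. dif Y r e') q e) (\<eta> q)"
proof -
  note Y = smooth_on_has_derivative[OF assms(2,3)]
  note B = smooth_on_has_derivative[OF smooth_on_dif[OF assms(2)] assms(3), of e']
  have "((\<lambda>r. 0) has_derivative
    (\<lambda>e. static_metric c f (Y q) (\<eta>' e) (dif Y q e') + static_metric c f (Y q) (\<eta> q) (dif (\<lambda>r. dif Y r e') q e)
      + 2 * f (snd (Y q)) * dif f (snd (Y q)) 1 * snd (dif Y q e) * pseudo_inner c (fst (\<eta> q)) (fst (dif Y q e')))) (at q)"
    by (rule has_derivative_transform_within_open[OF static_metric_has_derivative[OF Y \<eta> B f] assms(1,3)])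
      (rule normal)
  from has_derivative_unique[OF this has_derivative_const]
  have "static_metric c f (Y q) (\<eta>' e) (dif Y q e') + static_metric c f (Y q) (\<eta> q) (dif (\<lambda>r. dif Y r e') q e)
      + 2 * f (snd (Y q)) * dif f (snd (Y q)) 1 * snd (dif Y q e) * pseudo_inner c (fst (\<eta> q)) (fst (dif Y q e')) = 0"
    by meson
  then show ?thesis
    unfolding koszul_def
    by (simp add: static_metric_commute[of c f _ "\<eta> q"] pseudo_inner_commute[of c "fst (\<eta> q)"] algebra_simps)
qed

lemma dif_tangent:
  fixes X :: "'b::euclidean_space \<Rightarrow> 'a::euclidean_space"
  assumes "open U" "smooth_on U X" "q \<in> U" "X ` U \<subseteq> N"
  shows "dif X q e \<in> tangent_space N (X q)"
proof -
  define \<gamma> where "\<gamma> t = X (q + t *\<^sub>R e)" for t :: real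
  have "open ((\<lambda>t. q + t *\<^sub>R e) -` U)"
    by (rule open_vimage[OF assms(1)]) (intro continuous_intros)
  moreover have "0 \<in> (\<lambda>t. q + t *\<^sub>R e) -` U" using assms(3) by simp
  ultimately have "\<forall>\<^sub>F t in nhds 0. \<gamma> t \<in> N"
    unfolding eventually_nhds \<gamma>_def using assms(4)
    by (intro exI[of _ "(\<lambda>t. q + t *\<^sub>R e) -` U"]) auto
  moreover have "(\<gamma> has_vector_derivative dif X q e) (at 0)"
  proof -
    have "((\<lambda>t::real. q + t *\<^sub>R e) has_derivative (\<lambda>t. t *\<^sub>R e)) (at 0)"
      by (auto intro!: derivative_eq_intros)
    moreover have "(X has_derivative dif X q) (at (q + 0 *\<^sub>R e))"
      using smooth_on_has_derivative[OF assms(2,3)] by simp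
    ultimately have "(\<gamma> has_derivative (\<lambda>t. dif X q (t *\<^sub>R e))) (at 0)"
      unfolding \<gamma>_def by (rule has_derivative_compose)
    then show ?thesis
      unfolding has_vector_derivative_def by (simp add: linear_cmul[OF dif_linear[OF assms(2,3)]])
  qed
  moreover have "\<gamma> 0 = X q" by (simp add: \<gamma>_def)
  ultimately show ?thesis unfolding tangent_space_def by blast
qed

lemma tangential_static:
  fixes X :: "real^2 \<Rightarrow> (real^4) \<times> real"
  assumes lin: "linear (dif X q)"
    and nondeg: "\<And>e. (\<And>e'. static_metric c f (X q) (dif X q e) (dif X q e') = 0) \<Longrightarrow> e = 0"
  shows "tangential (static_metric c f) X q w \<in> range (dif X q)"
    and "static_metric c f (X q) (tangential (static_metric c f) X q w) (dif X q e)
      = static_metric c f (X q) w (dif X q e)"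
    and "t \<in> range (dif X q) \<Longrightarrow>
      (\<And>e. static_metric c f (X q) t (dif X q e) = static_metric c f (X q) w (dif X q e)) \<Longrightarrow>
      tangential (static_metric c f) X q w = t"
proof -
  let ?g = "static_metric c f (X q)"
  let ?P = "\<lambda>t. t \<in> range (dif X q) \<and> (\<forall>e. ?g (w - t) (dif X q e) = 0)"
  define G :: "real^2 \<Rightarrow> real^2"
    where "G e = (\<chi> i. ?g (dif X q e) (dif X q (axis i 1)))" for e
  note L = linear_add[OF lin] linear_cmul[OF lin]
  have lG: "linear G"
    by (rule linearI) (simp_all add: G_def vec_eq_iff L static_metric_simps)
  have expand: "e = (e$1) *\<^sub>R axis 1 1 + (e$2) *\<^sub>R axis 2 1" for e :: "real^2"
    by (simp add: vec_eq_iff forall_2 axis_def)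
  have test: "?g v (dif X q e) = 0"
    if "\<And>i. ?g v (dif X q (axis i 1)) = 0" for v e
    by (subst expand[of e]) (simp add: L static_metric_simps that)
  have "inj G"
  proof (rule linear_injective_0[THEN iffD2, OF lG], intro allI impI)
    fix e assume "G e = 0"
    show "e = 0"
      by (rule nondeg, rule test) (use \<open>G e = 0\<close> in \<open>simp add: G_def vec_eq_iff\<close>)
  qed
  then have "surj G" using linear_injective_imp_surjective[OF lG] by simp
  then obtain e0 where "(\<chi> i. ?g w (dif X q (axis i 1))) = G e0" by (metis surjD)
  then have "?g w (dif X q (axis i 1)) = ?g (dif X q e0) (dif X q (axis i 1))" for i
    by (simp add: G_def vec_eq_iff)
  then have "?g (w - dif X q e0) (dif X q e) = 0" for e
    using test[of "w - dif X q e0" e] by (simp add: static_metric_simps)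
  then have ex: "?P (dif X q e0)" by simp
  have uniq: "t = t'" if tt: "?P t" "?P t'" for t t'
  proof -
    obtain a b where ab: "t = dif X q a" "t' = dif X q b" using tt by auto
    have "a - b = 0"
    proof (rule nondeg)
      fix e'
      have "?g (w - t) (dif X q e') = 0" "?g (w - t') (dif X q e') = 0" using tt by auto
      then show "?g (dif X q (a - b)) (dif X q e') = 0"
        by (simp add: linear_diff[OF lin] ab static_metric_simps)
    qed
    then show ?thesis by (simp add: ab)
  qed
  have P: "?P (tangential (static_metric c f) X q w)"
    unfolding tangential_def by (rule theI[of ?P, OF ex]) (rule uniq[OF _ ex])
  then show "tangential (static_metric c f) X q w \<in> range (dif X q)" by simp
  show "?g (tangential (static_metric c f) X q w) (dif X q e) = ?g w (dif X q e)" for e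
    using P by (simp add: static_metric_simps)
  show "tangential (static_metric c f) X q w = t"
    if "t \<in> range (dif X q)" "\<And>e. ?g t (dif X q e) = ?g w (dif X q e)"
    by (rule uniq[OF P]) (use that in \<open>auto simp: static_metric_simps\<close>)
qed

lemma linear_combination_2:
  fixes a b :: "real^2"
  assumes "\<And>x y. x *\<^sub>R a + y *\<^sub>R b = 0 \<Longrightarrow> x = 0 \<and> y = 0"
  obtains x y where "e = x *\<^sub>R a + y *\<^sub>R b"
proof -
  define G :: "real^2 \<Rightarrow> real^2" where "G v = (v$1) *\<^sub>R a + (v$2) *\<^sub>R b" for v
  have lG: "linear G" by (rule linearI) (simp_all add: G_def algebra_simps)
  have "inj G"
  proof (rule linear_injective_0[THEN iffD2, OF lG], intro allI impI)
    fix v assume "G v = 0"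
    then have "v$1 = 0 \<and> v$2 = 0" by (intro assms) (simp add: G_def)
    then show "v = 0" by (simp add: vec_eq_iff forall_2)
  qed
  then have "surj G" using linear_injective_imp_surjective[OF lG] by simp
  then obtain v where "e = G v" by (metis surjD)
  then show ?thesis using that by (simp add: G_def)
qed

lemma local_param_patch:
  assumes "local_param M \<iota> U \<sigma>" "\<iota> ` M \<subseteq> N"
  shows "open U" "smooth_on U (\<iota> \<circ> \<sigma>)" "(\<iota> \<circ> \<sigma>) ` U \<subseteq> N" "q \<in> U \<Longrightarrow> inj (dif (\<iota> \<circ> \<sigma>) q)"
  using assms openin_imp_subset[of euclidean M "\<sigma> ` U"] by (auto simp: local_param_def)

lemma timelike_nondegenerate:
  fixes M :: "'m::topological_space set"
  assumes "timelike_surface N (static_metric c f) M \<iota>" "local_param M \<iota> U \<sigma>" "q \<in> U"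
    and e: "\<And>e'. static_metric c f (\<iota> (\<sigma> q)) (dif (\<iota> \<circ> \<sigma>) q e) (dif (\<iota> \<circ> \<sigma>) q e') = 0"
  shows "e = (0 :: real^2)"
proof -
  let ?X = "\<iota> \<circ> \<sigma>"
  let ?g = "static_metric c f (\<iota> (\<sigma> q))"
  have "\<iota> ` M \<subseteq> N" using assms(1) by (simp add: timelike_surface_def)
  note lp = local_param_patch[OF assms(2) this]
  have lin: "linear (dif ?X q)" by (rule dif_linear[OF lp(2) assms(3)])
  note L = linear_add[OF lin] linear_cmul[OF lin]
  obtain a b where ab: "?g (dif ?X q a) (dif ?X q a) = -1" "?g (dif ?X q b) (dif ?X q b) = 1"
    "?g (dif ?X q a) (dif ?X q b) = 0"
    using assms(1-3) unfolding timelike_surface_def by blast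
  have ba: "?g (dif ?X q b) (dif ?X q a) = 0" using ab(3) by (simp add: static_metric_commute)
  have "x = 0 \<and> y = 0" if "x *\<^sub>R a + y *\<^sub>R b = 0" for x y
  proof -
    have "dif ?X q (x *\<^sub>R a + y *\<^sub>R b) = 0" using that linear_0[OF lin] by simp
    then have "?g (x *\<^sub>R dif ?X q a + y *\<^sub>R dif ?X q b) v = 0" for v
      by (simp add: L static_metric_simps)
    from this[of "dif ?X q a"] this[of "dif ?X q b"] show ?thesis
      by (simp add: static_metric_simps ab ba)
  qed
  then obtain x y where xy: "e = x *\<^sub>R a + y *\<^sub>R b" using linear_combination_2 by blast
  from e[of a] e[of b] show "e = 0"
    unfolding xy by (simp add: L static_metric_simps ab ba)
qed

locale static_space_time =
  fixes c :: real and I :: "real set" and f :: "real \<Rightarrow> real"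
  assumes c: "c \<in> {-1, 0, 1}" and I: "open I"
    and f_smooth: "smooth_on I f" and f_pos: "\<And>z. z \<in> I \<Longrightarrow> f z > 0"
begin

abbreviation "N \<equiv> static_space c I"
abbreviation "g \<equiv> static_metric c f"

lemma in_N_D: "p \<in> N \<Longrightarrow> f (snd p) > 0" "p \<in> N \<Longrightarrow> f differentiable (at (snd p))"
  "p \<in> N \<Longrightarrow> fst p \<in> space_form c" "p \<in> N \<Longrightarrow> snd p \<in> I"
  using f_pos smooth_on_differentiable[OF f_smooth] by (auto simp: static_space_def)

lemma smooth_conformal_coordinate:
  assumes "\<And>t. t \<in> I \<Longrightarrow> (F has_vector_derivative 1 / f t) (at t)"
  shows "smooth_on I F"
proof (rule smooth_on_real_antiderivative[OF I assms])
  show "smooth_on I (\<lambda>t. 1 / f t)"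
    by (intro smooth_on_divide[OF I] smooth_on_const f_smooth f_pos[THEN less_imp_neq, THEN not_sym])
qed

lemma tangent_N: "p \<in> N \<Longrightarrow> v \<in> tangent_space N p \<longleftrightarrow> pseudo_inner c (fst v) (nvec c (fst p)) = 0"
  using tangent_space_static[OF c I] by simp

end

locale timelike_static = static_space_time c I f for c I f +
  fixes M :: "'m::topological_space set" and \<iota> :: "'m \<Rightarrow> (real^4) \<times> real"
  assumes timelike: "timelike_surface (static_space c I) (static_metric c f) M \<iota>"
begin

lemma image_M: "\<iota> ` M \<subseteq> N"
  using timelike by (simp add: timelike_surface_def)

text \<open>
  Both definite descriptions inside the shape operator are eliminated here: it is determined by its
  products with tangent vectors, which are Koszul expressions.
\<close>
lemma shape_operator_tests:
  fixes U :: "(real^2) set"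
  assumes lp: "local_param M \<iota> U \<sigma>" and \<xi>: "normal_field N g U (\<iota> \<circ> \<sigma>) \<xi>" and q: "q \<in> U"
  defines "X \<equiv> \<iota> \<circ> \<sigma>"
  shows "g (X q) (shape_operator N g X \<xi> q e) (dif X q e')
      = - koszul c f (X q) (dif X q e) (\<xi> q) (dif \<xi> q e) (dif X q e')"
    and "(\<And>e'. - koszul c f (X q) (dif X q e) (\<xi> q) (dif \<xi> q e) (dif X q e') = g (X q) (dif X q v) (dif X q e'))
      \<Longrightarrow> shape_operator N g X \<xi> q e = dif X q v"
proof -
  note p = local_param_patch[OF lp image_M, folded X_def]
  note lin = dif_linear[OF p(2) q]
  have XN: "X q \<in> N" using p(3) q by auto
  have nondeg: "v = 0" if "\<And>e'. g (X q) (dif X q v) (dif X q e') = 0" for v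
    using timelike_nondegenerate[OF timelike lp q] that by (simp add: X_def)
  have tan: "pseudo_inner c (fst (dif X q e')) (nvec c (fst (X q))) = 0" for e'
    using dif_tangent[OF p(1,2) q p(3)] tangent_N[OF XN] by blast
  have f0: "f (snd (X q)) \<noteq> 0" using in_N_D(1)[OF XN] by simp
  have cov: "g (X q) (cov_deriv N g X \<xi> e q) (dif X q e')
      = koszul c f (X q) (dif X q e) (\<xi> q) (dif \<xi> q e) (dif X q e')" for e'
    by (rule cov_deriv_static(2)[where X=X and q=q, OF c I XN in_N_D(2)[OF XN] f0 tan])
  show "g (X q) (shape_operator N g X \<xi> q e) (dif X q e')
      = - koszul c f (X q) (dif X q e) (\<xi> q) (dif \<xi> q e) (dif X q e')"
    unfolding shape_operator_def static_metric_simps using tangential_static(2)[OF lin nondeg] cov by simp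
  assume v: "\<And>e'. - koszul c f (X q) (dif X q e) (\<xi> q) (dif \<xi> q e) (dif X q e') = g (X q) (dif X q v) (dif X q e')"
  have "tangential g X q (cov_deriv N g X \<xi> e q) = dif X q (- v)"
  proof (rule tangential_static(3)[OF lin nondeg])
    show "g (X q) (dif X q (- v)) (dif X q e') = g (X q) (cov_deriv N g X \<xi> e q) (dif X q e')" for e'
      using v[of e'] by (simp add: cov linear_neg[OF lin] static_metric_simps)
  qed auto
  then show "shape_operator N g X \<xi> q e = dif X q v"
    by (simp add: shape_operator_def linear_neg[OF lin])
qed

text \<open>
  A multiple of the identity pairs a null vector with itself to zero, so the second fundamental form
  of an umbilical surface vanishes on null vectors.
\<close>
lemma umbilical_null_direction:
  fixes U :: "(real^2) set"
  assumes umb: "totally_umbilical N g M \<iota>" and lp: "local_param M \<iota> U \<sigma>"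
    and \<xi>: "normal_field N g U (\<iota> \<circ> \<sigma>) \<xi>" and q: "q \<in> U"
    and null: "g (\<iota> (\<sigma> q)) (dif (\<iota> \<circ> \<sigma>) q e) (dif (\<iota> \<circ> \<sigma>) q e) = 0"
  shows "koszul c f (\<iota> (\<sigma> q)) (dif (\<iota> \<circ> \<sigma>) q e) (dif (\<iota> \<circ> \<sigma>) q e)
     (dif (\<lambda>r. dif (\<iota> \<circ> \<sigma>) r e) q e) (\<xi> q) = 0"
proof -
  let ?X = "\<iota> \<circ> \<sigma>"
  note p = local_param_patch[OF lp image_M]
  have XN: "?X q \<in> N" using p(3) q by auto
  obtain a where "shape_operator N g ?X \<xi> q e = a *\<^sub>R dif ?X q e"
    using umb lp \<xi> q unfolding totally_umbilical_def by meson
  then have "koszul c f (?X q) (dif ?X q e) (\<xi> q) (dif \<xi> q e) (dif ?X q e) = 0"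
    using shape_operator_tests(1)[OF lp \<xi> q, of e e] null by (simp add: static_metric_simps)
  moreover have "koszul c f (?X q) (dif ?X q e) (\<xi> q) (dif \<xi> q e) (dif ?X q e)
     = - koszul c f (?X q) (dif ?X q e) (dif ?X q e) (dif (\<lambda>r. dif ?X r e) q e) (\<xi> q)"
  proof (rule weingarten[OF p(1,2) q in_N_D(2)[OF XN]])
    show "(\<xi> has_derivative dif \<xi> q) (at q)"
      using \<xi> q by (auto simp: normal_field_def intro: smooth_on_has_derivative)
    show "g (?X r) (\<xi> r) (dif ?X r e) = 0" if "r \<in> U" for r
      using \<xi> that unfolding normal_field_def by blast
  qed
  ultimately show ?thesis by simp
qed

text \<open>
  Conversely, a symmetric bilinear form on a Lorentzian plane that vanishes on two independent null
  vectors is a multiple of the metric; the second fundamental form is symmetric because second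
  derivatives are.
\<close>
lemma umbilical_from_null_pair:
  fixes U :: "(real^2) set"
  assumes lp: "local_param M \<iota> U \<sigma>" and \<xi>: "normal_field N g U (\<iota> \<circ> \<sigma>) \<xi>" and q: "q \<in> U"
  defines "X \<equiv> \<iota> \<circ> \<sigma>"
  assumes null: "g (X q) (dif X q a) (dif X q a) = 0" "g (X q) (dif X q b) (dif X q b) = 0"
    and ab: "g (X q) (dif X q a) (dif X q b) \<noteq> 0"
    and geod: "koszul c f (X q) (dif X q a) (\<xi> q) (dif \<xi> q a) (dif X q a) = 0"
      "koszul c f (X q) (dif X q b) (\<xi> q) (dif \<xi> q b) (dif X q b) = 0"
  shows "\<exists>m. \<forall>e. shape_operator N g X \<xi> q e = m *\<^sub>R dif X q e"
proof -
  note p = local_param_patch[OF lp image_M, folded X_def]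
  note lin = dif_linear[OF p(2) q]
  have XN: "X q \<in> N" using p(3) q by auto
  have \<xi>X: "normal_field N g U X \<xi>" using \<xi> by (simp add: X_def)
  then have \<xi>s: "smooth_on U \<xi>" by (simp add: normal_field_def)
  note lin\<xi> = dif_linear[OF \<xi>s q]
  note L = linear_add[OF lin] linear_cmul[OF lin] linear_add[OF lin\<xi>] linear_cmul[OF lin\<xi>]
  define \<beta> where "\<beta> e e' = koszul c f (X q) (dif X q e) (\<xi> q) (dif \<xi> q e) (dif X q e')" for e e'
  have w: "\<beta> e e' = - koszul c f (X q) (dif X q e) (dif X q e') (dif (\<lambda>r. dif X r e') q e) (\<xi> q)" for e e'
    unfolding \<beta>_def using \<xi>X by (intro weingarten[OF p(1,2) q in_N_D(2)[OF XN]] smooth_on_has_derivative[OF _ q])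
      (auto simp: normal_field_def)
  have sym: "\<beta> e e' = \<beta> e' e" for e e'
    unfolding w koszul_def using Clairaut[OF p(1,2) q, of e e']
    by (simp add: pseudo_inner_commute algebra_simps)
  have comb: "x = 0 \<and> y = 0" if "x *\<^sub>R a + y *\<^sub>R b = 0" for x y
  proof -
    have "dif X q (x *\<^sub>R a + y *\<^sub>R b) = 0" using that linear_0[OF lin] by simp
    then have "g (X q) (x *\<^sub>R dif X q a + y *\<^sub>R dif X q b) v = 0" for v
      by (simp add: L static_metric_simps)
    from this[of "dif X q a"] this[of "dif X q b"] show ?thesis
      using ab by (simp add: static_metric_simps null static_metric_commute[of c f _ "dif X q b" "dif X q a"])
  qed
  define m where "m = - \<beta> a b / g (X q) (dif X q a) (dif X q b)"
  have ba: "\<beta> b a = \<beta> a b" by (rule sym)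
  have bab: "- \<beta> a b = m * g (X q) (dif X q a) (dif X q b)" using ab by (simp add: m_def)
  have "- \<beta> e e' = m * g (X q) (dif X q e) (dif X q e')" for e e'
  proof -
    obtain x y where e: "e = x *\<^sub>R a + y *\<^sub>R b" using linear_combination_2 comb by blast
    obtain x' y' where e': "e' = x' *\<^sub>R a + y' *\<^sub>R b" using linear_combination_2 comb by blast
    have "\<beta> e e' = x * x' * \<beta> a a + x * y' * \<beta> a b + y * x' * \<beta> b a + y * y' * \<beta> b b"
      unfolding \<beta>_def koszul_def e e' L
      by (simp add: static_metric_simps psi_simps algebra_simps)
    also have "\<dots> = (x * y' + y * x') * \<beta> a b"
      using geod by (simp add: \<beta>_def[symmetric] ba algebra_simps)
    finally have 1: "\<beta> e e' = (x * y' + y * x') * \<beta> a b" .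
    have 2: "g (X q) (dif X q e) (dif X q e') = (x * y' + y * x') * g (X q) (dif X q a) (dif X q b)"
      unfolding e e' L
      by (simp add: static_metric_simps null static_metric_commute[of c f _ "dif X q b" "dif X q a"] algebra_simps)
    show ?thesis unfolding 1 2
      using arg_cong[OF bab, of "\<lambda>t. (x * y' + y * x') * t"] by (simp add: algebra_simps)
  qed
  then have "shape_operator N g X \<xi> q e = dif X q (m *\<^sub>R e)" for e
    using shape_operator_tests(2)[OF lp \<xi> q, of e "m *\<^sub>R e"]
    by (simp add: X_def[symmetric] \<beta>_def L static_metric_simps)
  then show ?thesis by (auto simp: L)
qed

end

section \<open>Differentiation along vector fields\<close>

lemma dif_bilinear:
  assumes "bounded_bilinear b" "smooth_on U u" "smooth_on U v" "q \<in> U"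
  shows "dif (\<lambda>r. b (u r) (v r)) q e = b (u q) (dif v q e) + b (dif u q e) (v q)"
  using dif_eqI[OF bounded_bilinear.FDERIV[OF assms(1) smooth_on_has_derivative[OF assms(2,4)]
      smooth_on_has_derivative[OF assms(3,4)]]] by simp

lemma dif_add:
  assumes "smooth_on U u" "smooth_on U v" "q \<in> U"
  shows "dif (\<lambda>r. u r + v r) q e = dif u q e + dif v q e"
  using dif_eqI[OF has_derivative_add[OF smooth_on_has_derivative[OF assms(1,3)]
      smooth_on_has_derivative[OF assms(2,3)]]] by simp

lemma dif_diff:
  assumes "smooth_on U u" "smooth_on U v" "q \<in> U"
  shows "dif (\<lambda>r. u r - v r) q e = dif u q e - dif v q e"
  using dif_eqI[OF has_derivative_diff[OF smooth_on_has_derivative[OF assms(1,3)]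
      smooth_on_has_derivative[OF assms(2,3)]]] by simp

lemmas dif_scaleR = dif_bilinear[OF bounded_bilinear_scaleR]
lemmas dif_psi = dif_bilinear[OF bounded_bilinear_pseudo_inner]
lemmas dif_inner = dif_bilinear[OF bounded_bilinear_inner]

lemma dif_linear_compose:
  assumes "bounded_linear L" "smooth_on U u" "q \<in> U"
  shows "dif (\<lambda>r. L (u r)) q e = L (dif u q e)"
  using dif_eqI[OF bounded_linear.has_derivative[OF assms(1) smooth_on_has_derivative[OF assms(2,3)]]] by simp

lemma dif_compose:
  assumes "smooth_on U u" "q \<in> U" "G differentiable (at (u q))"
  shows "dif (\<lambda>r. G (u r)) q e = dif G (u q) (dif u q e)"
  using dif_eqI[OF has_derivative_compose[OF smooth_on_has_derivative[OF assms(1,2)]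
      assms(3)[unfolded frechet_derivative_works]]] by simp

lemma dif_dif_along:
  fixes h :: "'a::euclidean_space \<Rightarrow> 'b::euclidean_space"
  assumes "open U" "smooth_on U h" "smooth_on U E" "q \<in> U"
  shows "dif (\<lambda>r. dif h r (E r)) q v = dif (\<lambda>r. dif h r (E q)) q v + dif h q (dif E q v)"
proof -
  note hb = smooth_on_has_derivative[OF smooth_on_dif[OF assms(2)] assms(4)]
  have Eb: "((\<lambda>r. E r \<bullet> b) has_derivative (\<lambda>v. dif E q v \<bullet> b)) (at q)" for b
    by (rule has_derivative_inner_left[OF smooth_on_has_derivative[OF assms(3,4)]])
  have "((\<lambda>r. \<Sum>b\<in>Basis. (E r \<bullet> b) *\<^sub>R dif h r b) has_derivative
    (\<lambda>v. \<Sum>b\<in>Basis. (E q \<bullet> b) *\<^sub>R dif (\<lambda>r. dif h r b) q v + (dif E q v \<bullet> b) *\<^sub>R dif h q b)) (at q)"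
    by (intro has_derivative_sum has_derivative_scaleR Eb hb)
  note d1 = dif_eqI[OF this]
  have "((\<lambda>r. \<Sum>b\<in>Basis. (E q \<bullet> b) *\<^sub>R dif h r b) has_derivative
    (\<lambda>v. \<Sum>b\<in>Basis. (E q \<bullet> b) *\<^sub>R dif (\<lambda>r. dif h r b) q v)) (at q)"
    by (intro has_derivative_sum has_derivative_scaleR_right hb)
  note d2 = dif_eqI[OF this]
  have "dif (\<lambda>r. dif h r (E r)) q = dif (\<lambda>r. \<Sum>b\<in>Basis. (E r \<bullet> b) *\<^sub>R dif h r b) q"
    by (rule dif_cong_open[OF assms(1,4)]) (rule dif_along_expand[OF assms(2)])
  moreover have "dif (\<lambda>r. dif h r (E q)) q = dif (\<lambda>r. \<Sum>b\<in>Basis. (E q \<bullet> b) *\<^sub>R dif h r b) q"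
    by (rule dif_cong_open[OF assms(1,4)]) (rule dif_along_expand[OF assms(2)])
  ultimately show ?thesis
    unfolding d1 d2 by (simp add: sum.distrib dif_along_expand[OF assms(2,4), of "dif E q v"])
qed

lemma bracket:
  fixes h :: "'a::euclidean_space \<Rightarrow> 'b::euclidean_space"
  assumes "open U" "smooth_on U h" "smooth_on U E" "smooth_on U F" "q \<in> U"
  shows "dif (\<lambda>r. dif h r (F r)) q (E q) - dif (\<lambda>r. dif h r (E r)) q (F q)
    = dif h q (dif F q (E q) - dif E q (F q))"
  unfolding dif_dif_along[OF assms(1,2,3,5)] dif_dif_along[OF assms(1,2,4,5)]
  using Clairaut[OF assms(1,2,5), of "E q" "F q"]
  by (simp add: linear_diff[OF dif_linear[OF assms(2,5)]])

text \<open>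
  If all derivatives of \<open>V\<close> are multiples of \<open>V\<close>, the direction of \<open>V\<close> does not change: the quotient
  of \<open>V\<close> by its product with \<open>V q0\<close> has derivative zero. Arguing with this quotient avoids solving a
  differential equation for the factor.
\<close>
lemma parallel_direction_constant:
  fixes V :: "'a::euclidean_space \<Rightarrow> 'b::euclidean_space"
  assumes "open U" "smooth_on U V" "q0 \<in> U" "V q0 \<noteq> 0"
    and V: "\<And>q e. q \<in> U \<Longrightarrow> \<exists>l. dif V q e = l *\<^sub>R V q"
  obtains r where "r > 0" "ball q0 r \<subseteq> U" "\<And>q. q \<in> ball q0 r \<Longrightarrow> \<exists>s. V q = s *\<^sub>R V q0 \<and> s > 0"
proof -
  let ?h = "\<lambda>q. V q \<bullet> V q0"
  have "open (U \<inter> ?h -` {0<..})"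
    using smooth_on_continuous[OF assms(2)] assms(1)
    by (intro continuous_open_preimage continuous_intros) auto
  moreover have "q0 \<in> U \<inter> ?h -` {0<..}" using assms(3,4) by simp
  ultimately obtain r where r: "r > 0" "ball q0 r \<subseteq> U \<inter> ?h -` {0<..}" using openE by blast
  have sV: "smooth_on (ball q0 r) V" using smooth_on_subset[OF assms(2)] r by blast
  define Q where "Q q = (1 / ?h q) *\<^sub>R V q" for q
  have dQ: "(Q has_derivative (\<lambda>e. 0)) (at q)" if q: "q \<in> ball q0 r" for q
  proof -
    have h0: "?h q \<noteq> 0" using r q by auto
    have dV: "(V has_derivative dif V q) (at q)" by (rule smooth_on_has_derivative[OF sV q])
    have "(Q has_derivative (\<lambda>e. (1 / ?h q) *\<^sub>R dif V q e
        + (- (dif V q e \<bullet> V q0) / (?h q * ?h q)) *\<^sub>R V q)) (at q)"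
      unfolding Q_def using h0
      by (auto intro!: derivative_eq_intros dV simp: power2_eq_square divide_simps)
    moreover have "(1 / ?h q) *\<^sub>R dif V q e + (- (dif V q e \<bullet> V q0) / (?h q * ?h q)) *\<^sub>R V q = 0" for e
    proof -
      obtain l where "dif V q e = l *\<^sub>R V q" using V r q by blast
      then show ?thesis using h0 by (simp flip: scaleR_left.add)
    qed
    ultimately show ?thesis by simp
  qed
  have "V q = (?h q / ?h q0) *\<^sub>R V q0 \<and> ?h q / ?h q0 > 0" if q: "q \<in> ball q0 r" for q
  proof -
    have "Q q = Q q0"
      by (rule has_derivative_zero_unique[OF convex_ball[of q0 r]])
        (use dQ q r in \<open>auto intro: has_derivative_at_withinI\<close>)
    moreover have h: "?h q > 0" "?h q0 > 0" using r q by auto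
    moreover have "V q = ?h q *\<^sub>R Q q" using h by (simp add: Q_def)
    ultimately have "V q = ?h q *\<^sub>R Q q0" by simp
    then show ?thesis using h by (simp add: Q_def)
  qed
  then show ?thesis using that[of r] r by blast
qed

section \<open>The structure of a frame of null geodesics\<close>

lemma plane_combination_2:
  fixes a b :: "real^2"
  assumes "linear \<phi>" "\<phi> a = 0" "\<phi> b \<noteq> (0::real)" "a \<noteq> 0"
  obtains s t where "e = s *\<^sub>R a + t *\<^sub>R b"
proof (rule linear_combination_2)
  show "x = 0 \<and> y = 0" if xy: "x *\<^sub>R a + y *\<^sub>R b = 0" for x y
  proof -
    have "\<phi> (x *\<^sub>R a + y *\<^sub>R b) = 0" using xy linear_0[OF assms(1)] by simp
    then have "y = 0" using assms(2,3) by (simp add: linear_add[OF assms(1)] linear_cmul[OF assms(1)])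
    then show ?thesis using xy assms(4) by simp
  qed
qed (rule that)

text \<open>
  The orthogonal complement of a time-like vector in a Lorentzian space is positive definite. With
  Lagrange's identity the three relations add up to a vanishing sum of squares.
\<close>
lemma lorentz_orthogonal_null:
  assumes "c \<noteq> -1" "pseudo_inner c y y = -1" "pseudo_inner c y w = 0" "pseudo_inner c w w = 0"
  shows "w = 0"
proof -
  let ?a = "y$2" and ?b = "y$3" and ?d = "y$4" and ?p = "w$2" and ?q = "w$3" and ?r = "w$4"
  have y: "y$1 * y$1 = 1 + ?a * ?a + ?b * ?b + ?d * ?d" and w: "w$1 * w$1 = ?p * ?p + ?q * ?q + ?r * ?r"
    and yw: "y$1 * w$1 = ?a * ?p + ?b * ?q + ?d * ?r"
    using assms by (simp_all add: pseudo_inner_def)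
  have "(y$1 * w$1) * (y$1 * w$1) = (y$1 * y$1) * (w$1 * w$1)" by simp
  then have "w$1 * w$1 + (?a * ?q - ?b * ?p)^2 + (?a * ?r - ?d * ?p)^2 + (?b * ?r - ?d * ?q)^2 = 0"
    unfolding y yw unfolding w by (simp add: algebra_simps power2_eq_square)
  moreover have "w$1 * w$1 \<ge> 0" by simp
  ultimately have "w$1 * w$1 = 0"
    by (smt (verit) zero_le_power2)
  then have "?p * ?p + ?q * ?q + ?r * ?r = 0" using w by simp
  moreover have "?p * ?p \<ge> 0" "?q * ?q \<ge> 0" "?r * ?r \<ge> 0" by simp_all
  ultimately have "?p = 0 \<and> ?q = 0 \<and> ?r = 0"
    by (smt (verit) mult_eq_0_iff)
  then show "w = 0" using \<open>w$1 * w$1 = 0\<close> by (simp add: vec_eq_iff forall_4)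
qed

text \<open>
  The data of an umbilical surface with light-like height gradient. The null field \<open>K\<close> is tangent to
  the curves of constant height, the null field \<open>L\<close> increases the height at the rate \<open>f\<close>, that is,
  at unit speed in the conformal coordinate \<open>F\<close>. By \<open>K_geod\<close> and \<open>L_geod\<close> the integral curves of \<open>K\<close>
  are null lines and those of \<open>L\<close> project to unit-speed time-like geodesics of the space form.
  The scaling of \<open>K\<close> by \<open>K_norm\<close>, with any fixed vector \<open>n\<close>, makes the linear function \<open>x \<bullet> n\<close>
  an affine parameter of the null lines; this replaces the solution of an ordinary differential
  equation.
\<close>
locale null_frame = static_space_time c I f for c I f +
  fixes B :: "(real^2) set" and x :: "real^2 \<Rightarrow> real^4" and z :: "real^2 \<Rightarrow> real"
    and K L :: "real^2 \<Rightarrow> real^2" and n :: "real^4"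
  assumes B: "open B" and smooth: "smooth_on B x" "smooth_on B z" "smooth_on B K" "smooth_on B L"
    and z_in: "q \<in> B \<Longrightarrow> z q \<in> I" and x_in: "q \<in> B \<Longrightarrow> x q \<in> space_form c"
    and Kz: "q \<in> B \<Longrightarrow> dif z q (K q) = 0" and Lz: "q \<in> B \<Longrightarrow> dif z q (L q) = f (z q)"
    and K_null: "q \<in> B \<Longrightarrow> pseudo_inner c (dif x q (K q)) (dif x q (K q)) = 0"
    and L_unit: "q \<in> B \<Longrightarrow> pseudo_inner c (dif x q (L q)) (dif x q (L q)) = -1"
    and KL: "q \<in> B \<Longrightarrow> pseudo_inner c (dif x q (K q)) (dif x q (L q)) \<noteq> 0"
    and K_norm: "q \<in> B \<Longrightarrow> dif x q (K q) \<bullet> n = 1"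
    and K_geod: "q \<in> B \<Longrightarrow> \<exists>l. dif (\<lambda>r. dif x r (K r)) q (K q) = l *\<^sub>R dif x q (K q)"
    and L_geod: "q \<in> B \<Longrightarrow> dif (\<lambda>r. dif x r (L r)) q (L q) = c *\<^sub>R x q"
begin

text \<open>
  Velocity of the time-like geodesics, direction of the null lines, and the derivative of the former
  along the latter. It turns out that \<open>\<kappa>\<close> is the factor in \<open>[K, L] = \<kappa> K\<close>.
\<close>
definition y :: "real^2 \<Rightarrow> real^4" where "y q = dif x q (L q)"
definition d :: "real^2 \<Rightarrow> real^4" where "d q = dif x q (K q)"
definition y' :: "real^2 \<Rightarrow> real^4" where "y' q = dif y q (K q)"
definition \<kappa> :: "real^2 \<Rightarrow> real" where "\<kappa> q = y' q \<bullet> n"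

lemma smooth_frame:
  "smooth_on B y" "smooth_on B d" "smooth_on B y'" "smooth_on B \<kappa>"
proof -
  show y: "smooth_on B y" unfolding y_def by (intro smooth_on_dif_along B smooth)
  show "smooth_on B d" unfolding d_def by (intro smooth_on_dif_along B smooth)
  show y': "smooth_on B y'" unfolding y'_def by (intro smooth_on_dif_along B smooth y)
  show "smooth_on B \<kappa>" unfolding \<kappa>_def by (intro smooth_on_inner B smooth_on_const y')
qed

lemma frame_products:
  assumes "q \<in> B"
  shows "pseudo_inner c (d q) (d q) = 0" "pseudo_inner c (y q) (y q) = -1"
    "pseudo_inner c (d q) (y q) \<noteq> 0" "d q \<bullet> n = 1" "d q \<noteq> 0"
  using K_null[OF assms] L_unit[OF assms] KL[OF assms] K_norm[OF assms] by (auto simp: d_def y_def)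

lemma frame_spans:
  assumes "q \<in> B" obtains s t where "e = s *\<^sub>R K q + t *\<^sub>R L q"
proof (rule plane_combination_2)
  show "linear (dif z q)" by (rule dif_linear[OF smooth(2) assms])
  show "dif z q (K q) = 0" using Kz[OF assms] .
  show "dif z q (L q) \<noteq> 0" using Lz[OF assms] f_pos[OF z_in[OF assms]] by simp
  show "K q \<noteq> 0" using frame_products(5)[OF assms] linear_0[OF dif_linear[OF smooth(1) assms]]
    by (auto simp: d_def)
qed (rule that)

lemma dif_const_on:
  fixes h :: "real^2 \<Rightarrow> 'a::real_normed_vector"
  assumes "\<And>r. r \<in> B \<Longrightarrow> h r = k" "q \<in> B" shows "dif h q e = 0"
  using dif_cong_open[OF B assms(2), of h "\<lambda>_. k"] assms(1) by simp

text \<open>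
  Neither \<open>K\<close> nor \<open>L\<close> lets the other change its effect on the height, so the bracket annihilates the
  height and is a multiple of \<open>K\<close>; the factor is read off from the linear function \<open>x \<bullet> n\<close>, on which
  \<open>K\<close> acts as the constant \<open>1\<close>.
\<close>
lemma frame_bracket:
  assumes q: "q \<in> B"
  shows "dif L q (K q) - dif K q (L q) = \<kappa> q *\<^sub>R K q"
proof -
  let ?E = "dif L q (K q) - dif K q (L q)"
  obtain s t where st: "?E = s *\<^sub>R K q + t *\<^sub>R L q" using frame_spans[OF q] .
  note lz = dif_linear[OF smooth(2) q] and lx = dif_linear[OF smooth(1) q]
  have "dif z q ?E = dif (\<lambda>r. dif z r (L r)) q (K q) - dif (\<lambda>r. dif z r (K r)) q (L q)"
    using bracket[OF B smooth(2,3,4) q] by simp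
  also have "dif (\<lambda>r. dif z r (K r)) q (L q) = 0" by (rule dif_const_on[OF _ q]) (rule Kz)
  also have "dif (\<lambda>r. dif z r (L r)) q (K q) = dif (\<lambda>r. f (z r)) q (K q)"
    using dif_cong_open[OF B q, of "\<lambda>r. dif z r (L r)" "\<lambda>r. f (z r)"] Lz by simp
  also have "\<dots> = dif f (z q) (dif z q (K q))"
    by (rule dif_compose[OF smooth(2) q smooth_on_differentiable[OF f_smooth z_in[OF q]]])
  also have "\<dots> = 0" using Kz[OF q] linear_0[OF dif_linear[OF f_smooth z_in[OF q]]] by simp
  finally have "t = 0"
    using f_pos[OF z_in[OF q]] by (simp add: st linear_add[OF lz] linear_cmul[OF lz] Kz[OF q] Lz[OF q])
  have "dif x q ?E = y' q - dif d q (L q)"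
    using bracket[OF B smooth(1,3,4) q] by (simp add: y'_def y_def[abs_def] d_def[abs_def])
  moreover have "dif d q (L q) \<bullet> n = 0"
  proof -
    have "dif (\<lambda>r. d r \<bullet> n) q (L q) = 0" by (rule dif_const_on[OF _ q]) (rule frame_products)
    then show ?thesis using dif_inner[OF smooth_frame(2) smooth_on_const q, of n] by simp
  qed
  ultimately have "dif x q ?E \<bullet> n = \<kappa> q" by (simp add: \<kappa>_def inner_diff_left)
  then have "s = \<kappa> q" using \<open>t = 0\<close> frame_products(4)[OF q]
    by (simp add: st linear_cmul[OF lx] d_def)
  then show ?thesis using st \<open>t = 0\<close> by simp
qed

lemma frame_commute:
  fixes h :: "real^2 \<Rightarrow> 'a::euclidean_space"
  assumes "smooth_on B h" "q \<in> B"
  shows "dif (\<lambda>r. dif h r (L r)) q (K q) = dif (\<lambda>r. dif h r (K r)) q (L q) + \<kappa> q *\<^sub>R dif h q (K q)"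
  using bracket[OF B assms(1) smooth(3,4) assms(2)] frame_bracket[OF assms(2)]
  by (simp add: linear_cmul[OF dif_linear[OF assms]] algebra_simps)

text \<open>The derivative is parallel to \<open>d\<close>, and orthogonal to \<open>n\<close> because \<open>d \<bullet> n\<close> is constant.\<close>
lemma K_d: assumes "q \<in> B" shows "dif d q (K q) = 0"
proof -
  obtain l where l: "dif d q (K q) = l *\<^sub>R d q" using K_geod[OF assms] by (auto simp: d_def[abs_def])
  have "dif (\<lambda>r. d r \<bullet> n) q (K q) = 0" by (rule dif_const_on[OF _ assms]) (rule frame_products)
  then have "dif d q (K q) \<bullet> n = 0" using dif_inner[OF smooth_frame(2) smooth_on_const assms, of n] by simp
  then show ?thesis using l frame_products(4)[OF assms] by simp
qed

lemma L_d: assumes "q \<in> B" shows "dif d q (L q) = y' q - \<kappa> q *\<^sub>R d q"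
  using frame_commute[OF smooth(1) assms] by (simp add: y'_def y_def[abs_def] d_def[abs_def])

lemma L_y: assumes "q \<in> B" shows "dif y q (L q) = c *\<^sub>R x q"
  using L_geod[OF assms] by (simp add: y_def[abs_def])

lemma L_y': assumes q: "q \<in> B" shows "dif y' q (L q) = c *\<^sub>R d q - \<kappa> q *\<^sub>R y' q"
proof -
  have "dif (\<lambda>r. dif y r (L r)) q (K q) = dif (\<lambda>r. c *\<^sub>R x r) q (K q)"
    using dif_cong_open[OF B q, of "\<lambda>r. dif y r (L r)" "\<lambda>r. c *\<^sub>R x r"] L_y by simp
  also have "\<dots> = c *\<^sub>R d q"
    using dif_scaleR[OF smooth_on_const smooth(1) q, of c "K q"] by (simp add: d_def)
  finally show ?thesis
    using frame_commute[OF smooth_frame(1) q] by (simp add: y'_def[abs_def] algebra_simps)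
qed

lemma K_y'_parallel: assumes q: "q \<in> B" shows "dif y' q (K q) = dif \<kappa> q (K q) *\<^sub>R d q"
proof -
  let ?Ld = "\<lambda>r. dif d r (L r)"
  have sLd: "smooth_on B ?Ld" by (intro smooth_on_dif_along B smooth smooth_frame)
  have "dif y' q (K q) = dif (\<lambda>r. ?Ld r + \<kappa> r *\<^sub>R d r) q (K q)"
    using dif_cong_open[OF B q, of y' "\<lambda>r. ?Ld r + \<kappa> r *\<^sub>R d r"] L_d by simp
  also have "\<dots> = dif ?Ld q (K q) + dif \<kappa> q (K q) *\<^sub>R d q"
    using dif_add[OF sLd smooth_on_scaleR[OF B smooth_frame(4,2)] q]
      dif_scaleR[OF smooth_frame(4,2) q] K_d[OF q] by simp
  also have "dif ?Ld q (K q) = dif (\<lambda>r. dif d r (K r)) q (L q) + \<kappa> q *\<^sub>R dif d q (K q)"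
    by (rule frame_commute[OF smooth_frame(2) q])
  also have "dif (\<lambda>r. dif d r (K r)) q (L q) = 0" by (rule dif_const_on[OF _ q]) (rule K_d)
  finally show ?thesis using K_d[OF q] by simp
qed

lemma y_orthogonal: assumes "q \<in> B" shows "pseudo_inner c (y q) (y' q) = 0"
proof -
  have "dif (\<lambda>r. pseudo_inner c (y r) (y r)) q (K q) = 0"
    by (rule dif_const_on[OF _ assms]) (rule frame_products)
  then show ?thesis
    using dif_psi[OF smooth_frame(1,1) assms] by (simp add: y'_def pseudo_inner_commute[of c _ "y q"])
qed

text \<open>
  The decisive step: the curvature of the second ruling cannot vary along the first one. Commuting
  the two directions on \<open>y'\<close> expresses \<open>2 \<nu> y'\<close> as a multiple of the null vector \<open>d\<close>, whereas
  differentiating \<open>y \<bullet> y = -1\<close> twice gives \<open>\<nu> (d \<bullet> y) = - y' \<bullet> y'\<close>; both can hold only if \<open>\<nu> = 0\<close>.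
\<close>
lemma K_\<kappa>_y'_null:
  assumes q: "q \<in> B" shows "dif \<kappa> q (K q) = 0" "pseudo_inner c (y' q) (y' q) = 0"
proof -
  define \<nu> where "\<nu> r = dif \<kappa> r (K r)" for r
  have s\<nu>: "smooth_on B \<nu>" unfolding \<nu>_def by (intro smooth_on_dif_along B smooth smooth_frame)
  have Ky': "dif y' r (K r) = \<nu> r *\<^sub>R d r" if "r \<in> B" for r
    using K_y'_parallel[OF that] by (simp add: \<nu>_def)
  have "dif (\<lambda>r. pseudo_inner c (y r) (y' r)) q (K q) = 0"
    by (rule dif_const_on[OF _ q]) (rule y_orthogonal)
  then have 1: "\<nu> q * pseudo_inner c (d q) (y q) = - pseudo_inner c (y' q) (y' q)"
    using dif_psi[OF smooth_frame(1,3) q] Ky'[OF q]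
    by (simp add: y'_def[of q, symmetric] psi_simps pseudo_inner_commute[of c "y q"])
  have "dif (\<lambda>r. dif y' r (L r)) q (K q) = dif (\<lambda>r. c *\<^sub>R d r - \<kappa> r *\<^sub>R y' r) q (K q)"
    using dif_cong_open[OF B q, of "\<lambda>r. dif y' r (L r)" "\<lambda>r. c *\<^sub>R d r - \<kappa> r *\<^sub>R y' r"] L_y' by simp
  also have "\<dots> = c *\<^sub>R dif d q (K q) - (\<kappa> q *\<^sub>R dif y' q (K q) + dif \<kappa> q (K q) *\<^sub>R y' q)"
    using dif_diff[OF smooth_on_scaleR[OF B smooth_on_const smooth_frame(2)]
        smooth_on_scaleR[OF B smooth_frame(4,3)] q] dif_scaleR[OF smooth_frame(4,3) q]
        dif_scaleR[OF smooth_on_const smooth_frame(2) q] by simp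
  finally have KL: "dif (\<lambda>r. dif y' r (L r)) q (K q) = - (\<kappa> q * \<nu> q) *\<^sub>R d q - \<nu> q *\<^sub>R y' q"
    by (simp add: K_d[OF q] Ky'[OF q] \<nu>_def)
  have "dif (\<lambda>r. dif y' r (K r)) q (L q) = dif (\<lambda>r. \<nu> r *\<^sub>R d r) q (L q)"
    using dif_cong_open[OF B q, of "\<lambda>r. dif y' r (K r)" "\<lambda>r. \<nu> r *\<^sub>R d r"] Ky' by simp
  also have "\<dots> = \<nu> q *\<^sub>R (y' q - \<kappa> q *\<^sub>R d q) + dif \<nu> q (L q) *\<^sub>R d q"
    using dif_scaleR[OF s\<nu> smooth_frame(2) q] L_d[OF q] by simp
  finally have LK: "dif (\<lambda>r. dif y' r (K r)) q (L q) = \<dots>" .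
  have "(2 * \<nu> q) *\<^sub>R y' q = - (dif \<nu> q (L q) + \<kappa> q * \<nu> q) *\<^sub>R d q"
  proof (rule vec_eq_iff[THEN iffD2], rule allI)
    fix i
    show "((2 * \<nu> q) *\<^sub>R y' q) $ i = (- (dif \<nu> q (L q) + \<kappa> q * \<nu> q) *\<^sub>R d q) $ i"
      using arg_cong[OF frame_commute[OF smooth_frame(3) q], of "\<lambda>v. v $ i"]
      unfolding KL LK Ky'[OF q] by (simp add: algebra_simps)
  qed
  then have "pseudo_inner c ((2 * \<nu> q) *\<^sub>R y' q) ((2 * \<nu> q) *\<^sub>R y' q) = 0"
    using frame_products(1)[OF q] by (simp add: psi_simps)
  then have "\<nu> q = 0 \<or> pseudo_inner c (y' q) (y' q) = 0" by (simp add: psi_simps)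
  then show "dif \<kappa> q (K q) = 0" "pseudo_inner c (y' q) (y' q) = 0"
    using 1 frame_products(3)[OF q] by (auto simp: \<nu>_def)
qed

lemma K_y': "q \<in> B \<Longrightarrow> dif y' q (K q) = 0"
  using K_y'_parallel K_\<kappa>_y'_null(1) by simp

lemma d_y': assumes q: "q \<in> B" shows "pseudo_inner c (d q) (y' q) = 0"
proof -
  have "dif (\<lambda>r. pseudo_inner c (d r) (d r)) q (L q) = 0"
    by (rule dif_const_on[OF _ q]) (rule frame_products)
  then show ?thesis
    using dif_psi[OF smooth_frame(2,2) q] L_d[OF q] frame_products(1)[OF q]
    by (simp add: psi_simps pseudo_inner_commute[of c "y' q" "d q"])
qed

lemma position_products:
  assumes q: "q \<in> B" and "c \<noteq> 0"
  shows "pseudo_inner c (x q) (x q) = c" "pseudo_inner c (x q) (y q) = 0" "pseudo_inner c (x q) (d q) = 0"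
    "pseudo_inner c (x q) (y' q) = - pseudo_inner c (d q) (y q)"
proof -
  have xx: "pseudo_inner c (x r) (x r) = c" if "r \<in> B" for r
    using x_in[OF that] \<open>c \<noteq> 0\<close> by (simp add: space_form_def)
  have "dif (\<lambda>r. pseudo_inner c (x r) (x r)) r e = 0" if "r \<in> B" for r e
    by (rule dif_const_on[OF _ that]) (rule xx)
  then have xe: "pseudo_inner c (x r) (dif x r e) = 0" if "r \<in> B" for r e
    using dif_psi[OF smooth(1,1) that, of c e] that by (simp add: pseudo_inner_commute[of c _ "x r"])
  have xy: "pseudo_inner c (x r) (y r) = 0" if "r \<in> B" for r unfolding y_def by (rule xe[OF that])
  have "dif (\<lambda>r. pseudo_inner c (x r) (y r)) q (K q) = 0" by (rule dif_const_on[OF _ q]) (rule xy)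
  then show "pseudo_inner c (x q) (y' q) = - pseudo_inner c (d q) (y q)"
    using dif_psi[OF smooth(1) smooth_frame(1) q, of c "K q"] by (simp add: y'_def d_def)
  show "pseudo_inner c (x q) (x q) = c" "pseudo_inner c (x q) (y q) = 0" "pseudo_inner c (x q) (d q) = 0"
    using xx[OF q] xy[OF q] xe[OF q] by (auto simp: d_def)
qed

text \<open>
  In a Lorentzian space form the null vector \<open>y'\<close> is orthogonal to the time-like vector \<open>y\<close>, so it
  vanishes, and its derivative along the second ruling shows that \<open>c = 0\<close>.
\<close>
lemma lorentzian_case:
  assumes "c \<noteq> -1" "q \<in> B" shows "y' q = 0" "c = 0"
proof -
  have y'0: "y' r = 0" if "r \<in> B" for r
    using lorentz_orthogonal_null[OF assms(1) frame_products(2)[OF that] y_orthogonal[OF that] K_\<kappa>_y'_null(2)[OF that]] .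
  then show "y' q = 0" using assms(2) by simp
  have "dif y' q (L q) = 0" by (rule dif_const_on[OF _ assms(2)]) (rule y'0)
  then show "c = 0" using L_y'[OF assms(2)] y'0[OF assms(2)] frame_products(5)[OF assms(2)] by simp
qed

end

lemma displacement_in_fixed_direction:
  fixes W :: "'a::euclidean_space \<Rightarrow> 'b::euclidean_space"
  assumes "convex U" "smooth_on U W" "q0 \<in> U" "q \<in> U" "bounded_linear P"
    and "\<And>q e. q \<in> U \<Longrightarrow> P (dif W q e) = 0"
  shows "P (W q - W q0) = 0"
proof -
  interpret P: bounded_linear P by fact
  have "P (W q) = P (W q0)"
  proof (rule has_derivative_zero_unique[OF assms(1) _ assms(4,3)])
    fix r assume "r \<in> U"
    from bounded_linear.has_derivative[OF assms(5) smooth_on_has_derivative[OF assms(2) this]]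
    show "((\<lambda>q. P (W q)) has_derivative (\<lambda>e. 0)) (at r within U)"
      using assms(6)[OF \<open>r \<in> U\<close>] has_derivative_at_withinI by fastforce
  qed
  then show ?thesis by (simp add: P.diff)
qed

context null_frame
begin

text \<open>
  In Minkowski space \<open>y' = 0\<close>, so \<open>y\<close> is constant and \<open>d\<close> has a constant direction; the derivative of
  the position stays in the plane of these two vectors.
\<close>
lemma minkowski_plane:
  assumes "c = 0" "q0 \<in> B"
  obtains r where "r > 0" "ball q0 r \<subseteq> B"
    "\<And>q. q \<in> ball q0 r \<Longrightarrow> \<exists>s t. x q = x q0 + s *\<^sub>R d q0 + t *\<^sub>R y q0"
proof -
  have c1: "c \<noteq> -1" using assms(1) by simp
  have dd: "\<exists>l. dif d q e = l *\<^sub>R d q" if q: "q \<in> B" for q e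
  proof -
    obtain s t where "e = s *\<^sub>R K q + t *\<^sub>R L q" using frame_spans[OF q] .
    then have "dif d q e = (- t * \<kappa> q) *\<^sub>R d q"
      using linear_add[OF dif_linear[OF smooth_frame(2) q]] linear_cmul[OF dif_linear[OF smooth_frame(2) q]]
        K_d[OF q] L_d[OF q] lorentzian_case(1)[OF c1 q] by simp
    then show ?thesis by blast
  qed
  obtain r where r: "r > 0" "ball q0 r \<subseteq> B" "\<And>q. q \<in> ball q0 r \<Longrightarrow> \<exists>s. d q = s *\<^sub>R d q0 \<and> s > 0"
    using parallel_direction_constant[OF B smooth_frame(2) assms(2) frame_products(5)[OF assms(2)] dd] by blast
  have "dif y q e = 0" if q: "q \<in> B" for q e
  proof -
    obtain s t where "e = s *\<^sub>R K q + t *\<^sub>R L q" using frame_spans[OF q] .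
    then show ?thesis
      using linear_add[OF dif_linear[OF smooth_frame(1) q]] linear_cmul[OF dif_linear[OF smooth_frame(1) q]]
        L_y[OF q] lorentzian_case(1)[OF c1 q] assms(1) by (simp add: y'_def)
  qed
  then have "dif y q e = 0" if "q \<in> ball q0 r" for q e using that r(2) by blast
  note disp = displacement_in_fixed_direction[OF convex_ball smooth_on_subset[OF smooth_frame(1) r(2)] _ _
      bounded_linear_ident this]
  have y0: "y q = y q0" if "q \<in> ball q0 r" for q
    by (rule eq_iff_diff_eq_0[THEN iffD2], rule disp) (use that r(1) in auto)
  let ?m = "pseudo_inner c (d q0) (y q0)"
  define \<beta> where "\<beta> v = pseudo_inner c v (d q0) / ?m" for v
  define \<alpha> where "\<alpha> v = (pseudo_inner c v (y q0) + \<beta> v) / ?m" for v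
  define P where "P v = v - \<alpha> v *\<^sub>R d q0 - \<beta> v *\<^sub>R y q0" for v
  note fp = frame_products[OF assms(2)]
  \<comment> \<open>\<open>P\<close> is a linear projection with kernel spanned by \<open>d q0\<close> and \<open>y q0\<close>.\<close>
  have linP: "linear P"
    by (rule linearI) (simp_all add: P_def \<alpha>_def \<beta>_def psi_simps algebra_simps add_divide_distrib)
  have Pd: "P (d q0) = 0" and Py: "P (y q0) = 0"
    using fp by (simp_all add: P_def \<alpha>_def \<beta>_def pseudo_inner_commute[of c "y q0" "d q0"] divide_simps)
  have "P (dif x q e) = 0" if q: "q \<in> ball q0 r" for q e
  proof -
    have qB: "q \<in> B" using q r by auto
    obtain s t where "e = s *\<^sub>R K q + t *\<^sub>R L q" using frame_spans[OF qB] .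
    then have "dif x q e = s *\<^sub>R d q + t *\<^sub>R y q0"
      using linear_add[OF dif_linear[OF smooth(1) qB]] linear_cmul[OF dif_linear[OF smooth(1) qB]] y0[OF q]
      by (simp add: d_def y_def)
    moreover obtain l where "d q = l *\<^sub>R d q0" using r(3)[OF q] by blast
    ultimately show ?thesis
      by (simp add: linear_add[OF linP] linear_cmul[OF linP] Pd Py)
  qed
  from displacement_in_fixed_direction[OF convex_ball smooth_on_subset[OF smooth(1) r(2)] _ _
      linP[unfolded linear_conv_bounded_linear] this]
  have "P (x q - x q0) = 0" if "q \<in> ball q0 r" for q using that r(1) centre_in_ball by blast
  then have "x q = x q0 + \<alpha> (x q - x q0) *\<^sub>R d q0 + \<beta> (x q - x q0) *\<^sub>R y q0" if "q \<in> ball q0 r" for q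
    using that by (simp add: P_def algebra_simps)
  then show ?thesis using that[of r] r by blast
qed

lemma rotated_frame_derivative:
  fixes u v :: "real^2 \<Rightarrow> real^4" and \<Theta> :: "real^2 \<Rightarrow> real"
  assumes "smooth_on B u" "smooth_on B v" "smooth_on B \<Theta>" "q \<in> B"
  shows "dif (\<lambda>r. cos (\<Theta> r) *\<^sub>R u r + sin (\<Theta> r) *\<^sub>R v r) q e
    = cos (\<Theta> q) *\<^sub>R dif u q e + sin (\<Theta> q) *\<^sub>R dif v q e
      + dif \<Theta> q e *\<^sub>R (cos (\<Theta> q) *\<^sub>R v q - sin (\<Theta> q) *\<^sub>R u q)"
proof -
  note d = smooth_on_has_derivative[OF assms(1,4)] smooth_on_has_derivative[OF assms(2,4)]
    smooth_on_has_derivative[OF assms(3,4)]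
  have "((\<lambda>r. cos (\<Theta> r) *\<^sub>R u r + sin (\<Theta> r) *\<^sub>R v r) has_derivative
    (\<lambda>e. (cos (\<Theta> q) *\<^sub>R dif u q e + (dif \<Theta> q e * - sin (\<Theta> q)) *\<^sub>R u q)
       + (sin (\<Theta> q) *\<^sub>R dif v q e + (dif \<Theta> q e * cos (\<Theta> q)) *\<^sub>R v q))) (at q)"
    by (intro has_derivative_add has_derivative_scaleR d has_derivative_cos has_derivative_sin)
  from dif_eqI[OF this] show ?thesis by (simp add: algebra_simps)
qed

text \<open>
  A unit-speed time-like geodesic of anti-de Sitter space is \<open>cos \<Theta> A + sin \<Theta> B\<close> with
  \<open>A = cos \<Theta> x - sin \<Theta> y\<close> and \<open>B = sin \<Theta> x + cos \<Theta> y\<close>, so these initial data \<open>W = (A, B)\<close> are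
  constant along \<open>L\<close>. Their derivative \<open>V\<close> along \<open>K\<close> is constant along \<open>K\<close> and changes along \<open>L\<close> by a
  multiple of itself, so that \<open>W\<close> moves along one fixed line of \<open>real^4 \<times> real^4\<close>; \<open>s\<close> is the position
  on this line.
\<close>
lemma anti_de_sitter_form:
  fixes F :: "real \<Rightarrow> real"
  assumes c: "c = -1" and q0: "q0 \<in> B"
    and F: "\<And>t. t \<in> I \<Longrightarrow> (F has_vector_derivative 1 / f t) (at t)"
  obtains r s a b n0 n1 where "r > 0" "ball q0 r \<subseteq> B" "smooth_on (ball q0 r) s"
    "\<And>q. q \<in> ball q0 r \<Longrightarrow> dif s q (K q) \<noteq> 0"
    "\<And>q. q \<in> ball q0 r \<Longrightarrow>
       x q = cos (F (z q)) *\<^sub>R (a + s q *\<^sub>R n0) + sin (F (z q)) *\<^sub>R (b + s q *\<^sub>R n1)"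
    "pseudo_inner c a a = -1" "pseudo_inner c b b = -1" "pseudo_inner c a b = 0"
    "pseudo_inner c n0 n0 = 0" "pseudo_inner c n1 n1 = 0" "pseudo_inner c n0 n1 = 0"
    "pseudo_inner c a n0 = 0" "pseudo_inner c b n1 = 0"
    "pseudo_inner c a n1 \<noteq> 0" "pseudo_inner c b n0 = - pseudo_inner c a n1"
proof -
  define \<Theta> where "\<Theta> q = F (z q)" for q
  have sF: "smooth_on I F" by (rule smooth_conformal_coordinate[OF F])
  have s\<Theta>: "smooth_on B \<Theta>" unfolding \<Theta>_def
    by (rule smooth_on_compose[OF B I _ sF smooth(2)]) (use z_in in auto)
  have d\<Theta>: "dif \<Theta> q e = dif z q e / f (z q)" if q: "q \<in> B" for q e
  proof -
    have "dif \<Theta> q e = dif F (z q) (dif z q e)" unfolding \<Theta>_def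
      by (rule dif_compose[OF smooth(2) q smooth_on_differentiable[OF sF z_in[OF q]]])
    also have "dif F (z q) = (\<lambda>e. e *\<^sub>R (1 / f (z q)))"
      using F[OF z_in[OF q]] by (intro dif_eqI) (simp add: has_vector_derivative_def)
    finally show ?thesis by simp
  qed
  have \<Theta>K: "dif \<Theta> q (K q) = 0" and \<Theta>L: "dif \<Theta> q (L q) = 1" if "q \<in> B" for q
    using d\<Theta>[OF that] Kz[OF that] Lz[OF that] f_pos[OF z_in[OF that]] by auto
  let ?rot = "\<lambda>u v q. cos (\<Theta> q) *\<^sub>R u q + sin (\<Theta> q) *\<^sub>R v q :: real^4"
  have smy: "smooth_on B (\<lambda>q. - y q)" "smooth_on B (\<lambda>q. - y' q)"
    by (intro smooth_on_minus B smooth_frame)+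
  have dm: "dif (\<lambda>q. - u q) q e = - dif u q e" if "smooth_on B u" "q \<in> B" for u :: "real^2 \<Rightarrow> real^4" and q e
    using dif_linear_compose[OF bounded_linear_minus[OF bounded_linear_ident] that] by simp
  have srot: "smooth_on B (?rot u v)" if "smooth_on B u" "smooth_on B v" for u v
    by (intro smooth_on_add B smooth_on_scaleR smooth_on_cos smooth_on_sin s\<Theta> that)
  define W where "W q = (?rot x (\<lambda>q. - y q) q, ?rot y x q)" for q
  define V where "V q = (?rot d (\<lambda>q. - y' q) q, ?rot y' d q)" for q
  have sW: "smooth_on B W" and sV: "smooth_on B V"
    unfolding W_def V_def by (intro smooth_on_Pair B srot smy smooth_frame smooth(1))+
  have dPair: "dif (\<lambda>r. (u r, v r)) q e = (dif u q e, dif v q e)"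
    if "smooth_on B u" "smooth_on B v" "q \<in> B" for u v :: "real^2 \<Rightarrow> real^4" and q e
    using dif_eqI[OF has_derivative_Pair[OF smooth_on_has_derivative[OF that(1,3)]
          smooth_on_has_derivative[OF that(2,3)]]] by simp
  have frame_rules: "dif x q (K q) = d q" "dif x q (L q) = y q" "dif y q (K q) = y' q"
    "dif y q (L q) = - x q" "dif d q (K q) = 0" "dif d q (L q) = y' q - \<kappa> q *\<^sub>R d q"
    "dif y' q (K q) = 0" "dif y' q (L q) = - d q - \<kappa> q *\<^sub>R y' q" if "q \<in> B" for q
    using L_y[OF that] K_d[OF that] L_d[OF that] K_y'[OF that] L_y'[OF that] c
    by (simp_all add: d_def y_def y'_def)
  note rot = rotated_frame_derivative[OF _ _ s\<Theta>]
  have dW: "dif W q e = (dif (?rot x (\<lambda>q. - y q)) q e, dif (?rot y x) q e)"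
    and dV: "dif V q e = (dif (?rot d (\<lambda>q. - y' q)) q e, dif (?rot y' d) q e)" if q: "q \<in> B" for q e
    unfolding W_def[abs_def] V_def[abs_def]
    by (rule dPair[OF srot srot q]; intro smy smooth_frame smooth(1))+
  have WK: "dif W q (K q) = V q" and WL: "dif W q (L q) = 0"
    and VK: "dif V q (K q) = 0" and VL: "dif V q (L q) = - \<kappa> q *\<^sub>R V q" if q: "q \<in> B" for q
    unfolding dW[OF q] dV[OF q] V_def rot[OF smooth(1) smy(1) q] rot[OF smooth_frame(1) smooth(1) q]
      rot[OF smooth_frame(2) smy(2) q] rot[OF smooth_frame(3,2) q]
      dm[OF smooth_frame(1) q] dm[OF smooth_frame(3) q] frame_rules[OF q] \<Theta>K[OF q] \<Theta>L[OF q]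
    by (simp_all add: zero_prod_def algebra_simps)
  have lc: "dif h q (s *\<^sub>R K q + t *\<^sub>R L q) = s *\<^sub>R dif h q (K q) + t *\<^sub>R dif h q (L q)"
    if "smooth_on B h" "q \<in> B" for h :: "real^2 \<Rightarrow> (real^4) \<times> (real^4)" and q s t
    by (simp add: linear_add[OF dif_linear[OF that]] linear_cmul[OF dif_linear[OF that]])
  have V_par: "\<exists>l. dif V q e = l *\<^sub>R V q" if q: "q \<in> B" for q e
  proof -
    obtain s t where "e = s *\<^sub>R K q + t *\<^sub>R L q" using frame_spans[OF q] .
    then have "dif V q e = (- t * \<kappa> q) *\<^sub>R V q" by (simp add: lc[OF sV q] VK[OF q] VL[OF q])
    then show ?thesis by blast
  qed
  define a where "a = fst (W q0)"
  define b where "b = snd (W q0)"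
  define n0 where "n0 = fst (V q0)"
  define n1 where "n1 = snd (V q0)"
  let ?C = "cos (\<Theta> q0)" and ?S = "sin (\<Theta> q0)"
  have ab: "a = ?C *\<^sub>R x q0 - ?S *\<^sub>R y q0" "b = ?C *\<^sub>R y q0 + ?S *\<^sub>R x q0"
    "n0 = ?C *\<^sub>R d q0 - ?S *\<^sub>R y' q0" "n1 = ?C *\<^sub>R y' q0 + ?S *\<^sub>R d q0"
    by (simp_all add: a_def b_def n0_def n1_def W_def V_def)
  have c0: "c \<noteq> 0" using c by simp
  let ?m = "pseudo_inner c (d q0) (y q0)"
  note fp = frame_products[OF q0] trans[OF position_products(1)[OF q0 c0] c] position_products(2-4)[OF q0 c0]
    y_orthogonal[OF q0] K_\<kappa>_y'_null(2)[OF q0] d_y'[OF q0]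
  have fp': "pseudo_inner c (y q0) (d q0) = ?m" "pseudo_inner c (y q0) (x q0) = 0" "pseudo_inner c (d q0) (x q0) = 0"
    "pseudo_inner c (y' q0) (x q0) = - ?m" "pseudo_inner c (y' q0) (y q0) = 0" "pseudo_inner c (y' q0) (d q0) = 0"
    using fp by (simp_all add: pseudo_inner_commute)
  have cs: "?C * ?C + ?S * ?S = 1" using sin_cos_squared_add[of "\<Theta> q0"] by (simp add: power2_eq_square)
  have gram: "pseudo_inner c a a = -1" "pseudo_inner c b b = -1" "pseudo_inner c a b = 0"
    "pseudo_inner c n0 n0 = 0" "pseudo_inner c n1 n1 = 0" "pseudo_inner c n0 n1 = 0"
    "pseudo_inner c a n0 = 0" "pseudo_inner c b n1 = 0"
    "pseudo_inner c a n1 = - ?m" "pseudo_inner c b n0 = ?m"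
  proof -
    have "pseudo_inner c a a = - (?C * ?C + ?S * ?S)" "pseudo_inner c b b = - (?C * ?C + ?S * ?S)"
      "pseudo_inner c a n1 = - ?m * (?C * ?C + ?S * ?S)" "pseudo_inner c b n0 = ?m * (?C * ?C + ?S * ?S)"
      unfolding ab by (simp_all add: psi_simps fp fp' algebra_simps del: sin_cos_squared_add3)
    then show "pseudo_inner c a a = -1" "pseudo_inner c b b = -1"
      "pseudo_inner c a n1 = - ?m" "pseudo_inner c b n0 = ?m" unfolding cs by simp_all
    show "pseudo_inner c a b = 0"
      "pseudo_inner c n0 n0 = 0" "pseudo_inner c n1 n1 = 0" "pseudo_inner c n0 n1 = 0"
      "pseudo_inner c a n0 = 0" "pseudo_inner c b n1 = 0"
      unfolding ab by (simp_all add: psi_simps fp fp' algebra_simps)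
  qed
  have V0: "V q0 \<noteq> 0"
    using gram(9) fp(3) by (auto simp: n1_def psi_simps)
  obtain r where r: "r > 0" "ball q0 r \<subseteq> B" "\<And>q. q \<in> ball q0 r \<Longrightarrow> \<exists>s. V q = s *\<^sub>R V q0 \<and> s > 0"
    using parallel_direction_constant[OF B sV q0 V0 V_par] by blast
  define s where "s q = (W q - W q0) \<bullet> ((1 / (V q0 \<bullet> V q0)) *\<^sub>R V q0)" for q
  define P where "P w = w - (w \<bullet> ((1 / (V q0 \<bullet> V q0)) *\<^sub>R V q0)) *\<^sub>R V q0" for w
  have linP: "linear P" by (rule linearI) (simp_all add: P_def inner_simps algebra_simps add_divide_distrib)
  have PV: "P (V q0) = 0" using V0 by (simp add: P_def)
  have dW0: "\<exists>l. dif W q e = l *\<^sub>R V q0" if q: "q \<in> ball q0 r" for q e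
  proof -
    have qB: "q \<in> B" using q r by auto
    obtain s t where "e = s *\<^sub>R K q + t *\<^sub>R L q" using frame_spans[OF qB] .
    then have "dif W q e = s *\<^sub>R V q" by (simp add: lc[OF sW qB] WK[OF qB] WL[OF qB])
    moreover obtain l where "V q = l *\<^sub>R V q0" using r(3)[OF q] by blast
    ultimately show ?thesis by auto
  qed
  have "P (dif W q e) = 0" if "q \<in> ball q0 r" for q e
    using dW0[OF that, of e] by (auto simp: linear_cmul[OF linP] PV)
  from displacement_in_fixed_direction[OF convex_ball smooth_on_subset[OF sW r(2)] _ _
      linP[unfolded linear_conv_bounded_linear] this]
  have "P (W q - W q0) = 0" if "q \<in> ball q0 r" for q using that r(1) centre_in_ball by blast
  then have Ws: "W q = W q0 + s q *\<^sub>R V q0" if "q \<in> ball q0 r" for q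
    using that by (simp add: P_def s_def algebra_simps)
  have ss: "smooth_on B s" unfolding s_def
    by (intro smooth_on_inner smooth_on_diff smooth_on_const B sW)
  have dsK: "dif s q (K q) \<noteq> 0" if q: "q \<in> ball q0 r" for q
  proof -
    have qB: "q \<in> B" using q r by auto
    obtain l where l: "V q = l *\<^sub>R V q0" "l > 0" using r(3)[OF q] by blast
    have "dif s q (K q) = dif (\<lambda>r. W r - W q0) q (K q) \<bullet> ((1 / (V q0 \<bullet> V q0)) *\<^sub>R V q0)"
      unfolding s_def
      using dif_inner[OF smooth_on_diff[OF B sW smooth_on_const] smooth_on_const qB, of "W q0"
          "(1 / (V q0 \<bullet> V q0)) *\<^sub>R V q0" "K q"] by simp
    also have "dif (\<lambda>r. W r - W q0) q (K q) = V q"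
      using dif_diff[OF sW smooth_on_const qB] WK[OF qB] by simp
    also have "V q \<bullet> ((1 / (V q0 \<bullet> V q0)) *\<^sub>R V q0) = l" using l V0 by simp
    finally show ?thesis using l by simp
  qed
  have form: "x q = cos (F (z q)) *\<^sub>R (a + s q *\<^sub>R n0) + sin (F (z q)) *\<^sub>R (b + s q *\<^sub>R n1)"
    if q: "q \<in> ball q0 r" for q
  proof -
    have "fst (W q) = a + s q *\<^sub>R n0" "snd (W q) = b + s q *\<^sub>R n1"
      using Ws[OF q] by (simp_all add: a_def b_def n0_def n1_def)
    moreover have "x q = (cos (\<Theta> q) * cos (\<Theta> q) + sin (\<Theta> q) * sin (\<Theta> q)) *\<^sub>R x q" by simp
    then have "x q = cos (\<Theta> q) *\<^sub>R fst (W q) + sin (\<Theta> q) *\<^sub>R snd (W q)"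
      by (simp add: W_def scaleR_left_distrib algebra_simps del: sin_cos_squared_add3)
    ultimately show ?thesis by (simp add: \<Theta>_def)
  qed
  show ?thesis
    by (rule that[of r s a n0 b n1, OF r(1,2) smooth_on_subset[OF ss r(2)] dsK form])
      (use gram fp(3) in auto)
qed

end

section \<open>The null frame of an umbilical surface\<close>

lemma local_param_subset:
  fixes M :: "'m::topological_space set"
  assumes lp: "local_param M \<iota> U \<sigma>" and V: "open V" "V \<subseteq> U"
  shows "local_param M \<iota> V \<sigma>"
proof -
  obtain \<tau> where \<tau>: "homeomorphism U (\<sigma> ` U) \<sigma> \<tau>" and op: "openin (top_of_set M) (\<sigma> ` U)"
    using lp by (auto simp: local_param_def)
  have "openin (top_of_set U) V" using V lp by (simp add: local_param_def openin_open_eq)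
  then have "openin (top_of_set (\<sigma> ` U)) (\<sigma> ` V)"
    by (rule homeomorphism_imp_open_map[OF \<tau>])
  then have "openin (top_of_set M) (\<sigma> ` V)" using op openin_trans by blast
  moreover have "homeomorphism V (\<sigma> ` V) \<sigma> \<tau>"
    using \<tau> V(2) by (rule homeomorphism_of_subsets) auto
  ultimately show ?thesis
    using lp V by (auto simp: local_param_def intro: smooth_on_subset)
qed

text \<open>
  Orthogonal projection onto the complement of the plane spanned by a null vector \<open>d\<close> and a unit
  time-like vector \<open>y\<close>. Projecting constant vectors gives smooth normal fields of a surface.
\<close>
definition plane_proj :: "real \<Rightarrow> real^4 \<Rightarrow> real^4 \<Rightarrow> real^4 \<Rightarrow> real^4"
  where "plane_proj c d y v = (let m = pseudo_inner c d y; \<beta> = pseudo_inner c v d / m in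
    v - ((pseudo_inner c v y + \<beta>) / m) *\<^sub>R d - \<beta> *\<^sub>R y)"

lemma plane_proj_orthogonal:
  assumes "pseudo_inner c d d = 0" "pseudo_inner c y y = -1" "pseudo_inner c d y \<noteq> 0"
  shows "pseudo_inner c (plane_proj c d y v) d = 0" "pseudo_inner c (plane_proj c d y v) y = 0"
  using assms by (simp_all add: plane_proj_def Let_def psi_simps pseudo_inner_commute[of c y d])

lemma plane_proj_self_adjoint:
  "pseudo_inner c (plane_proj c d y v) w = pseudo_inner c v (plane_proj c d y w)"
  by (simp add: plane_proj_def Let_def psi_simps pseudo_inner_commute[of c w d] pseudo_inner_commute[of c w y]
      add_divide_distrib algebra_simps)

lemma tproj_self_adjoint: "pseudo_inner c (tproj c x v) w = pseudo_inner c v (tproj c x w)"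
  by (simp add: tproj_def psi_simps pseudo_inner_commute[of c w] algebra_simps)

context timelike_static
begin

lemma coordinates:
  fixes U :: "(real^2) set"
  assumes lp: "local_param M \<iota> U \<sigma>"
  defines "x \<equiv> \<lambda>q. fst (\<iota> (\<sigma> q))" and "z \<equiv> \<lambda>q. snd (\<iota> (\<sigma> q))"
  shows "smooth_on U x" "smooth_on U z" "q \<in> U \<Longrightarrow> dif (\<iota> \<circ> \<sigma>) q e = (dif x q e, dif z q e)"
    "q \<in> U \<Longrightarrow> x q \<in> space_form c" "q \<in> U \<Longrightarrow> z q \<in> I"
proof -
  note p = local_param_patch[OF lp image_M]
  have s: "smooth_on U (\<lambda>q. \<iota> (\<sigma> q))" using p(2) by (simp add: o_def)
  show "smooth_on U x" "smooth_on U z"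
    unfolding x_def z_def by (intro smooth_on_fst smooth_on_snd p(1) s)+
  show "dif (\<iota> \<circ> \<sigma>) q e = (dif x q e, dif z q e)" if q: "q \<in> U"
  proof -
    have "dif x q e = fst (dif (\<lambda>q. \<iota> (\<sigma> q)) q e)" unfolding x_def
      by (rule dif_linear_compose[OF bounded_linear_fst s q])
    moreover have "dif z q e = snd (dif (\<lambda>q. \<iota> (\<sigma> q)) q e)" unfolding z_def
      by (rule dif_linear_compose[OF bounded_linear_snd s q])
    ultimately show ?thesis by (simp add: o_def)
  qed
  show "x q \<in> space_form c" "z q \<in> I" if "q \<in> U"
    using p(3) that in_N_D(3,4)[of "\<iota> (\<sigma> q)"] by (auto simp: x_def z_def)
qed

lemma tangent_nvec:
  fixes U :: "(real^2) set"
  assumes lp: "local_param M \<iota> U \<sigma>" and q: "q \<in> U"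
  shows "pseudo_inner c (dif (\<lambda>q. fst (\<iota> (\<sigma> q))) q e) (nvec c (fst (\<iota> (\<sigma> q)))) = 0"
proof -
  note p = local_param_patch[OF lp image_M]
  have "\<iota> (\<sigma> q) \<in> N" using p(3) q by auto
  then show ?thesis
    using dif_tangent[OF p(1,2) q p(3), of e] tangent_N coordinates(3)[OF lp q] by simp
qed

text \<open>
  If the height is increased along \<open>L\<close> at the rate \<open>f\<close>, the second derivative of the surface along the
  null field \<open>L\<close> has no normal component; the derivatives of \<open>f\<close> cancel, reflecting the conformal
  invariance of null geodesics.
\<close>
lemma umbilical_along_null_fields:
  fixes B :: "(real^2) set" and K L :: "real^2 \<Rightarrow> real^2"
  assumes umb: "totally_umbilical N g M \<iota>" and lp: "local_param M \<iota> B \<sigma>" and q: "q \<in> B"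
  defines "x \<equiv> \<lambda>q. fst (\<iota> (\<sigma> q))" and "z \<equiv> \<lambda>q. snd (\<iota> (\<sigma> q))"
  assumes KL: "smooth_on B K" "smooth_on B L"
    and Kz: "\<And>q. q \<in> B \<Longrightarrow> dif z q (K q) = 0" and Lz: "\<And>q. q \<in> B \<Longrightarrow> dif z q (L q) = f (z q)"
    and K_null: "pseudo_inner c (dif x q (K q)) (dif x q (K q)) = 0"
    and L_unit: "pseudo_inner c (dif x q (L q)) (dif x q (L q)) = -1"
    and \<xi>: "normal_field N g B (\<iota> \<circ> \<sigma>) \<xi>"
  shows "pseudo_inner c (dif (\<lambda>r. dif x r (K r)) q (K q)) (fst (\<xi> q)) = 0"
    and "pseudo_inner c (dif (\<lambda>r. dif x r (L r)) q (L q)) (fst (\<xi> q)) = 0"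
proof -
  let ?X = "\<iota> \<circ> \<sigma>"
  note p = local_param_patch[OF lp image_M] and co = coordinates(1-3)[OF lp, folded x_def z_def]
  have zq: "snd (\<iota> (\<sigma> q)) = z q" by (simp add: z_def)
  have zI: "z q \<in> I" using coordinates(5)[OF lp q] by (simp add: z_def)
  have fz: "f (z q) > 0" using f_pos[OF zI] .
  have orth: "g (\<iota> (\<sigma> q)) (dif ?X q e) (\<xi> q) = 0" for e
    using \<xi> q by (simp add: normal_field_def static_metric_commute)
  \<comment> \<open>Differentiating along \<open>E\<close> instead of the constant field \<open>E q\<close> adds only a tangent vector.\<close>
  have second: "dif (\<lambda>r. dif ?X r (E q)) q v
      = (dif (\<lambda>r. dif x r (E r)) q v, dif (\<lambda>r. dif z r (E r)) q v) - dif ?X q (dif E q v)"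
    if E: "smooth_on B E" for E v
  proof -
    have "smooth_on B (\<lambda>r. dif x r (E r))" "smooth_on B (\<lambda>r. dif z r (E r))"
      by (intro smooth_on_dif_along p(1) co(1,2) E)+
    note h = smooth_on_has_derivative[OF this(1) q] smooth_on_has_derivative[OF this(2) q]
    have "dif (\<lambda>r. dif ?X r (E r)) q = dif (\<lambda>r. (dif x r (E r), dif z r (E r))) q"
      by (rule dif_cong_open[OF p(1) q]) (rule co(3))
    also have "\<dots> = (\<lambda>v. (dif (\<lambda>r. dif x r (E r)) q v, dif (\<lambda>r. dif z r (E r)) q v))"
      by (rule dif_eqI[OF has_derivative_Pair[OF h]])
    finally show ?thesis
      using dif_dif_along[OF p(1,2) E q, of v] by (simp add: algebra_simps)
  qed
  note null_dir = umbilical_null_direction[OF umb lp \<xi> q]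
  have kosz: "g (\<iota> (\<sigma> q)) (dif (\<lambda>r. dif x r (E r)) q (E q), dif (\<lambda>r. dif z r (E r)) q (E q)) (\<xi> q)
      + f (z q) * dif f (z q) 1 *
        (2 * dif z q (E q) * pseudo_inner c (dif x q (E q)) (fst (\<xi> q))
          - snd (\<xi> q) * pseudo_inner c (dif x q (E q)) (dif x q (E q))) = 0"
    if E: "smooth_on B E" and null: "g (\<iota> (\<sigma> q)) (dif ?X q (E q)) (dif ?X q (E q)) = 0" for E
    using null_dir[OF null] unfolding koszul_def second[OF E] static_metric_simps orth
    by (simp add: co(3)[OF q] zq algebra_simps)
  have zK: "dif (\<lambda>r. dif z r (K r)) q (K q) = 0"
    using dif_cong_open[OF p(1) q, of "\<lambda>r. dif z r (K r)" "\<lambda>_. 0"] Kz by simp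
  have "g (\<iota> (\<sigma> q)) (dif ?X q (K q)) (dif ?X q (K q)) = 0"
    by (simp add: co(3)[OF q] static_metric_def K_null Kz[OF q])
  from kosz[OF KL(1) this] show "pseudo_inner c (dif (\<lambda>r. dif x r (K r)) q (K q)) (fst (\<xi> q)) = 0"
    using fz by (simp add: K_null Kz[OF q] zK static_metric_def zq)
  have "dif (\<lambda>r. dif z r (L r)) q (L q) = dif (\<lambda>r. f (z r)) q (L q)"
    using dif_cong_open[OF p(1) q, of "\<lambda>r. dif z r (L r)" "\<lambda>r. f (z r)"] Lz by simp
  also have "\<dots> = dif f (z q) (f (z q))"
    using dif_compose[OF co(2) q smooth_on_differentiable[OF f_smooth zI]] Lz[OF q] by simp
  also have "\<dots> = f (z q) * dif f (z q) 1"
    using linear_cmul[OF dif_linear[OF f_smooth zI], of "f (z q)" 1] by simp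
  finally have zL: "dif (\<lambda>r. dif z r (L r)) q (L q) = f (z q) * dif f (z q) 1" .
  have Lnull: "g (\<iota> (\<sigma> q)) (dif ?X q (L q)) (dif ?X q (L q)) = 0"
    by (simp add: co(3)[OF q] static_metric_def L_unit Lz[OF q] zq flip: power2_eq_square)
  have "f (z q) * (f (z q) * pseudo_inner c (dif x q (L q)) (fst (\<xi> q)) + snd (\<xi> q)) = 0"
    using orth[of "L q"] by (simp add: co(3)[OF q] static_metric_def Lz[OF q] zq power2_eq_square algebra_simps)
  then have "f (z q) * pseudo_inner c (dif x q (L q)) (fst (\<xi> q)) = - snd (\<xi> q)"
    using fz by simp
  then have "f (z q) * dif f (z q) 1 * (2 * f (z q) * pseudo_inner c (dif x q (L q)) (fst (\<xi> q)))
      = f (z q) * dif f (z q) 1 * (2 * - snd (\<xi> q))" by (simp only: mult.assoc)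
  then have "(f (z q))\<^sup>2 * pseudo_inner c (dif (\<lambda>r. dif x r (L r)) q (L q)) (fst (\<xi> q)) = 0"
    using kosz[OF KL(2) Lnull] unfolding Lz[OF q] L_unit zL
    by (simp add: static_metric_def zq algebra_simps)
  then show "pseudo_inner c (dif (\<lambda>r. dif x r (L r)) q (L q)) (fst (\<xi> q)) = 0" using fz by simp
qed

end

context static_space_time
begin

text \<open>
  The derivative of a tangent field has a normal part given by the second fundamental form of the
  space form; the factor \<open>c * c\<close> is \<open>1\<close> for the quadrics and \<open>0\<close> for the hyperplane.
\<close>
lemma tangent_derivative_nvec:
  fixes x u :: "real^2 \<Rightarrow> real^4"
  assumes "open B" "smooth_on B x" "smooth_on B u" "q \<in> B"
    and "\<And>r. r \<in> B \<Longrightarrow> pseudo_inner c (u r) (nvec c (x r)) = 0"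
  shows "pseudo_inner c (dif u q e) (nvec c (x q)) = - c * c * pseudo_inner c (u q) (dif x q e)"
proof (cases "c = 0")
  case True
  have "dif (\<lambda>r. pseudo_inner c (u r) (axis 4 1)) q e = 0"
    using dif_cong_open[OF assms(1,4), of "\<lambda>r. pseudo_inner c (u r) (axis 4 1)" "\<lambda>_. 0"] assms(5) True
    by (simp add: nvec_def)
  then show ?thesis
    using dif_psi[OF assms(3) smooth_on_const assms(4), of c "axis 4 1" e] True
    by (simp add: nvec_def psi_simps)
next
  case False
  then have "c * c = 1" using c by auto
  have "dif (\<lambda>r. pseudo_inner c (u r) (x r)) q e = 0"
    using dif_cong_open[OF assms(1,4), of "\<lambda>r. pseudo_inner c (u r) (x r)" "\<lambda>_. 0"] assms(5) False
    by (simp add: nvec_def)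
  then show ?thesis
    using dif_psi[OF assms(3,2,4), of c e] False \<open>c * c = 1\<close>
    by (simp add: nvec_def)
qed

lemma smooth_on_nvec: "smooth_on B x \<Longrightarrow> smooth_on B (\<lambda>q. nvec c (x q))"
  by (cases "c = 0") (simp_all add: nvec_def smooth_on_const)

end

context timelike_static
begin

text \<open>
  Two kinds of normal fields are tested: horizontal ones, projections of a constant vector \<open>w\<close>, and
  the normal part of the vertical field. Self-adjointness moves the projection from \<open>w\<close> to the second
  derivative, and since \<open>w\<close> is arbitrary, the second derivatives along \<open>K\<close> and \<open>L\<close> have no component
  outside the span of \<open>nvec\<close>, \<open>d\<close> and \<open>y\<close>. The remaining components follow from the constant products of
  \<open>d\<close> and \<open>y\<close> and from the second normal field.
\<close>
lemma umbilical_frame_geodesic: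
  fixes B :: "(real^2) set" and K L :: "real^2 \<Rightarrow> real^2"
  assumes umb: "totally_umbilical N g M \<iota>" and lp: "local_param M \<iota> B \<sigma>" and q: "q \<in> B"
  defines "x \<equiv> \<lambda>q. fst (\<iota> (\<sigma> q))" and "z \<equiv> \<lambda>q. snd (\<iota> (\<sigma> q))"
  assumes KL: "smooth_on B K" "smooth_on B L"
    and Kz: "\<And>q. q \<in> B \<Longrightarrow> dif z q (K q) = 0" and Lz: "\<And>q. q \<in> B \<Longrightarrow> dif z q (L q) = f (z q)"
    and K_nz: "\<And>q. q \<in> B \<Longrightarrow> K q \<noteq> 0"
    and K_null: "\<And>q. q \<in> B \<Longrightarrow> pseudo_inner c (dif x q (K q)) (dif x q (K q)) = 0"
    and L_unit: "\<And>q. q \<in> B \<Longrightarrow> pseudo_inner c (dif x q (L q)) (dif x q (L q)) = -1"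
    and m: "\<And>q. q \<in> B \<Longrightarrow> pseudo_inner c (dif x q (K q)) (dif x q (L q)) \<noteq> 0"
  shows "\<exists>l. dif (\<lambda>r. dif x r (K r)) q (K q) = l *\<^sub>R dif x q (K q)"
    and "dif (\<lambda>r. dif x r (L r)) q (L q) = c *\<^sub>R x q"
proof -
  let ?X = "\<iota> \<circ> \<sigma>"
  note p = local_param_patch[OF lp image_M] and co = coordinates(1-3)[OF lp, folded x_def z_def]
  have zq: "snd (\<iota> (\<sigma> q)) = z q" and xq: "fst (\<iota> (\<sigma> q)) = x q" for q by (simp_all add: z_def x_def)
  have zI: "z r \<in> I" and xS: "x r \<in> space_form c" if "r \<in> B" for r
    using coordinates(4,5)[OF lp that] by (simp_all add: z_def x_def)
  define d where "d r = dif x r (K r)" for r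
  define y where "y r = dif x r (L r)" for r
  have sd: "smooth_on B d" and sy: "smooth_on B y"
    unfolding d_def y_def by (intro smooth_on_dif_along p(1) co KL)+
  have dd: "pseudo_inner c (d r) (d r) = 0" and yy: "pseudo_inner c (y r) (y r) = -1"
    and dy: "pseudo_inner c (d r) (y r) \<noteq> 0" if "r \<in> B" for r
    using K_null[OF that] L_unit[OF that] m[OF that] by (simp_all add: d_def y_def)
  have tan: "pseudo_inner c (dif x r e) (nvec c (x r)) = 0" if "r \<in> B" for r e
    using tangent_nvec[OF lp that, of e] by (simp add: x_def)
  have spans: "\<exists>s t. e = s *\<^sub>R K r + t *\<^sub>R L r" if "r \<in> B" for r e
  proof -
    have "dif z r (L r) \<noteq> 0" using Lz[OF that] f_pos[OF zI[OF that]] by simp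
    from plane_combination_2[OF dif_linear[OF co(2) that] Kz[OF that] this K_nz[OF that]]
    show ?thesis by blast
  qed
  have XN: "?X r \<in> N" if "r \<in> B" for r using p(3) that by auto
  have normalI: "normal_field N g B ?X \<xi>"
    if s: "smooth_on B \<xi>" and T: "\<And>r. r \<in> B \<Longrightarrow> pseudo_inner c (fst (\<xi> r)) (nvec c (x r)) = 0"
      and K: "\<And>r. r \<in> B \<Longrightarrow> pseudo_inner c (fst (\<xi> r)) (d r) = 0"
      and L: "\<And>r. r \<in> B \<Longrightarrow> f (z r) * pseudo_inner c (fst (\<xi> r)) (y r) + snd (\<xi> r) = 0" for \<xi>
    unfolding normal_field_def
  proof (intro conjI ballI allI s)
    fix r e assume r: "r \<in> B"
    show "\<xi> r \<in> tangent_space N (?X r)"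
      using tangent_N[OF XN[OF r]] T[OF r] by (simp add: xq)
    obtain s t where e: "e = s *\<^sub>R K r + t *\<^sub>R L r" using spans[OF r] by blast
    have 1: "g (?X r) (\<xi> r) (dif ?X r (K r)) = 0"
      using K[OF r] by (simp add: co(3)[OF r] static_metric_def Kz[OF r] d_def)
    have "g (?X r) (\<xi> r) (dif ?X r (L r)) = f (z r) * (f (z r) * pseudo_inner c (fst (\<xi> r)) (y r) + snd (\<xi> r))"
      by (simp add: co(3)[OF r] static_metric_def Lz[OF r] y_def zq power2_eq_square algebra_simps)
    then have 2: "g (?X r) (\<xi> r) (dif ?X r (L r)) = 0" using L[OF r] by simp
    show "g (?X r) (\<xi> r) (dif ?X r e) = 0"
      unfolding e linear_add[OF dif_linear[OF p(2) r]] linear_cmul[OF dif_linear[OF p(2) r]]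
        static_metric_simps 1 2 by simp
  qed
  note geod = umbilical_along_null_fields[OF umb lp q, folded x_def z_def, unfolded zq, OF KL Kz Lz K_null[OF q] L_unit[OF q]]
  define dK where "dK = dif d q (K q)"
  define yL where "yL = dif y q (L q)"
  have geodK: "pseudo_inner c dK (fst (\<xi> q)) = 0" and geodL: "pseudo_inner c yL (fst (\<xi> q)) = 0"
    if "normal_field N g B ?X \<xi>" for \<xi>
    using geod[OF _ _ that] by (simp_all add: dK_def yL_def d_def[abs_def] y_def[abs_def])
  let ?P = "\<lambda>r v. plane_proj c (d r) (y r) (tproj c (x r) v)"
  have normal1: "normal_field N g B ?X (\<lambda>r. (?P r w, 0))" for w
  proof (rule normalI)
    show "smooth_on B (\<lambda>r. (?P r w, 0::real))"
      unfolding plane_proj_def tproj_def Let_def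
      by (intro smooth_on_Pair smooth_on_diff smooth_on_scaleR smooth_on_divide smooth_on_add smooth_on_psi
          smooth_on_mult smooth_on_const smooth_on_nvec p(1) sd sy co dy)
    fix r assume r: "r \<in> B"
    have "pseudo_inner c (tproj c (x r) w) (nvec c (x r)) = 0" by (rule tproj_orthogonal[OF c xS[OF r]])
    then show "pseudo_inner c (fst (?P r w, 0::real)) (nvec c (x r)) = 0"
      using tan[OF r] by (simp add: plane_proj_def Let_def psi_simps d_def y_def)
    show "pseudo_inner c (fst (?P r w, 0::real)) (d r) = 0"
      "f (z r) * pseudo_inner c (fst (?P r w, 0::real)) (y r) + snd (?P r w, 0::real) = 0"
      using plane_proj_orthogonal[OF dd yy dy, OF r r r] by simp_all
  qed
  \<comment> \<open>The normal part of the vertical unit field, written with the null field \<open>K\<close>.\<close>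
  have normal2: "normal_field N g B ?X (\<lambda>r. ((- 1 / (f (z r) * pseudo_inner c (d r) (y r))) *\<^sub>R d r, 1))"
  proof (rule normalI)
    have sfz: "smooth_on B (\<lambda>r. f (z r))"
      by (rule smooth_on_compose[OF p(1) I _ f_smooth co(2)]) (use zI in auto)
    show "smooth_on B (\<lambda>r. ((- 1 / (f (z r) * pseudo_inner c (d r) (y r))) *\<^sub>R d r, 1::real))"
      using f_pos zI dy
      by (intro smooth_on_Pair smooth_on_scaleR smooth_on_divide smooth_on_psi
          smooth_on_mult smooth_on_const p(1) sd sy sfz) (metis less_irrefl mult_eq_0_iff)
    fix r assume r: "r \<in> B"
    show "pseudo_inner c (fst ((- 1 / (f (z r) * pseudo_inner c (d r) (y r))) *\<^sub>R d r, 1::real)) (nvec c (x r)) = 0"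
      using tan[OF r] by (simp add: psi_simps d_def)
    show "pseudo_inner c (fst ((- 1 / (f (z r) * pseudo_inner c (d r) (y r))) *\<^sub>R d r, 1::real)) (d r) = 0"
      using dd[OF r] by (simp add: psi_simps)
    show "f (z r) * pseudo_inner c (fst ((- 1 / (f (z r) * pseudo_inner c (d r) (y r))) *\<^sub>R d r, 1::real)) (y r)
        + snd ((- 1 / (f (z r) * pseudo_inner c (d r) (y r))) *\<^sub>R d r, 1::real) = 0"
      using f_pos[OF zI[OF r]] dy[OF r] by (simp add: psi_simps)
  qed
  have decompose: "v = (nsign c * pseudo_inner c v (nvec c (x q))) *\<^sub>R nvec c (x q)
      + ((pseudo_inner c v (y q) + pseudo_inner c v (d q) / pseudo_inner c (d q) (y q))
          / pseudo_inner c (d q) (y q)) *\<^sub>R d q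
      + (pseudo_inner c v (d q) / pseudo_inner c (d q) (y q)) *\<^sub>R y q"
    if "\<And>w. pseudo_inner c v (?P q w) = 0" for v
  proof -
    have "pseudo_inner c (tproj c (x q) (plane_proj c (d q) (y q) v)) w = 0" for w
      unfolding tproj_self_adjoint plane_proj_self_adjoint by (rule that)
    then have 0: "tproj c (x q) (plane_proj c (d q) (y q) v) = 0" by (rule pseudo_inner_nondegenerate)
    have n: "pseudo_inner c (d q) (nvec c (x q)) = 0" "pseudo_inner c (y q) (nvec c (x q)) = 0"
      using tan[OF q] by (simp_all add: d_def y_def)
    have "pseudo_inner c (plane_proj c (d q) (y q) v) (nvec c (x q)) = pseudo_inner c v (nvec c (x q))"
      by (simp add: plane_proj_def Let_def psi_simps n)
    with 0 show ?thesis by (simp add: tproj_def plane_proj_def Let_def algebra_simps)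
  qed
  have tand: "pseudo_inner c (d r) (nvec c (x r)) = 0" and tany: "pseudo_inner c (y r) (nvec c (x r)) = 0"
    if "r \<in> B" for r using tan[OF that] by (simp_all add: d_def y_def)
  have vanish: "dif h q e = 0" if "\<And>r. r \<in> B \<Longrightarrow> h r = k" for h :: "real^2 \<Rightarrow> real" and k e
    using dif_cong_open[OF p(1) q, of h "\<lambda>_. k"] that by simp
  have "pseudo_inner c dK (nvec c (x q)) = 0"
    using tangent_derivative_nvec[OF p(1) co(1) sd q tand, of "K q"] dd[OF q]
    by (simp add: dK_def d_def[symmetric])
  moreover have "dif (\<lambda>r. pseudo_inner c (d r) (d r)) q (K q) = 0" by (rule vanish) (rule dd)
  then have "pseudo_inner c dK (d q) = 0"
    using dif_psi[OF sd sd q, of c "K q"] by (simp add: dK_def pseudo_inner_commute[of c "d q"])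
  ultimately show "\<exists>l. dif (\<lambda>r. dif x r (K r)) q (K q) = l *\<^sub>R dif x q (K q)"
    using decompose[of dK] geodK[OF normal1] by (auto simp: dK_def d_def[abs_def])
  have "pseudo_inner c yL (nvec c (x q)) = c * c"
    using tangent_derivative_nvec[OF p(1) co(1) sy q tany, of "L q"] yy[OF q]
    by (simp add: yL_def y_def[symmetric])
  moreover have "dif (\<lambda>r. pseudo_inner c (y r) (y r)) q (L q) = 0" by (rule vanish) (rule yy)
  then have "pseudo_inner c yL (y q) = 0"
    using dif_psi[OF sy sy q, of c "L q"] by (simp add: yL_def pseudo_inner_commute[of c "y q"])
  moreover have "pseudo_inner c yL (d q) = 0"
    using geodL[OF normal2] f_pos[OF zI[OF q]] dy[OF q] by (simp add: psi_simps)
  ultimately have "yL = (nsign c * (c * c)) *\<^sub>R nvec c (x q)"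
    using decompose[of yL] geodL[OF normal1] by simp
  also have "\<dots> = c *\<^sub>R x q" using c by (auto simp: nsign_def nvec_def)
  finally show "dif (\<lambda>r. dif x r (L r)) q (L q) = c *\<^sub>R x q" by (simp add: yL_def y_def[abs_def])
qed

end

context timelike_static
begin

text \<open>
  The gradient \<open>T\<close> of the height is null, so it annihilates the height and spans the kernel of the
  differential of the height. Every vector of this kernel is therefore null.
\<close>
lemma lightlike_kernel:
  fixes U :: "(real^2) set"
  assumes T: "lightlike_T c f M \<iota>" and lp: "local_param M \<iota> U \<sigma>" and q: "q \<in> U"
  defines "x \<equiv> \<lambda>q. fst (\<iota> (\<sigma> q))" and "z \<equiv> \<lambda>q. snd (\<iota> (\<sigma> q))"
  assumes k: "k \<noteq> 0" "dif z q k = 0"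
  shows "pseudo_inner c (dif x q k) (dif x q k) = 0" "dif x q k \<noteq> 0"
    and "dif z q e \<noteq> 0 \<Longrightarrow> pseudo_inner c (dif x q k) (dif x q e) \<noteq> 0"
    and "\<exists>e. dif z q e \<noteq> 0"
proof -
  let ?X = "\<iota> \<circ> \<sigma>"
  note p = local_param_patch[OF lp image_M] and co = coordinates(1-3)[OF lp, folded x_def z_def]
  note lin = dif_linear[OF p(2) q]
  have XN: "\<iota> (\<sigma> q) \<in> N" using p(3) q by auto
  have fz: "f (snd (\<iota> (\<sigma> q))) > 0" by (rule in_N_D(1)[OF XN])
  have nondeg: "v = 0" if "\<And>e'. g (?X q) (dif ?X q v) (dif ?X q e') = 0" for v
    using timelike_nondegenerate[OF timelike lp q] that by simp
  let ?T = "T_part c f ?X q"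
  have T0: "?T \<noteq> 0" "g (?X q) ?T ?T = 0" using T lp q by (auto simp: lightlike_T_def)
  have "?T \<in> range (dif ?X q)"
    unfolding T_part_def by (rule tangential_static(1)[OF lin nondeg])
  then obtain \<tau> where \<tau>: "?T = dif ?X q \<tau>" by auto
  have gT: "g (?X q) ?T (dif ?X q e) = dif z q e" for e
    unfolding T_part_def using tangential_static(2)[where w=partial_z and e=e, OF lin nondeg]
    by (simp add: static_metric_def partial_z_def psi_simps co(3)[OF q])
  have z\<tau>: "dif z q \<tau> = 0" using T0(2) gT[of \<tau>] by (simp add: \<tau>)
  have \<tau>0: "\<tau> \<noteq> 0" using T0(1) linear_0[OF lin] by (auto simp: \<tau>)
  obtain b where b: "dif z q b \<noteq> 0"
    using nondeg[of \<tau>] \<tau>0 gT by (auto simp: \<tau>)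
  then show "\<exists>e. dif z q e \<noteq> 0" by blast
  obtain s t where "\<tau> = s *\<^sub>R k + t *\<^sub>R b"
    using plane_combination_2[OF dif_linear[OF co(2) q] k(2) b k(1)] by blast
  then have "\<tau> = s *\<^sub>R k"
    using z\<tau> k(2) b by (simp add: linear_add[OF dif_linear[OF co(2) q]] linear_cmul[OF dif_linear[OF co(2) q]])
  then have Ts: "?T = s *\<^sub>R dif ?X q k" and s: "s \<noteq> 0" using \<tau>0 by (auto simp: \<tau> linear_cmul[OF lin])
  have "(f (snd (\<iota> (\<sigma> q))))\<^sup>2 * pseudo_inner c (dif x q k) (dif x q k) = 0"
    using T0(2) s k(2) unfolding Ts static_metric_simps co(3)[OF q] static_metric_def by (simp add: psi_simps)
  then show "pseudo_inner c (dif x q k) (dif x q k) = 0" using fz by simp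
  show "dif x q k \<noteq> 0"
    using T0(1) k(2) by (auto simp: Ts co(3)[OF q] zero_prod_def)
  show "pseudo_inner c (dif x q k) (dif x q e) \<noteq> 0" if "dif z q e \<noteq> 0"
  proof
    assume "pseudo_inner c (dif x q k) (dif x q e) = 0"
    then have "g (?X q) ?T (dif ?X q e) = 0"
      unfolding Ts static_metric_simps co(3)[OF q] static_metric_def by (simp add: k(2) psi_simps)
    then show False using that gT by simp
  qed
qed

text \<open>
  The curves of constant height are null because \<open>T\<close> is. Their tangent field is the rotated coordinate
  gradient of the height, and the other null field is found in the plane by solving a linear equation.
\<close>
lemma null_frame_exists:
  fixes U :: "(real^2) set"
  assumes T: "lightlike_T c f M \<iota>" and umb: "totally_umbilical N g M \<iota>"
    and lp: "local_param M \<iota> U \<sigma>" and q0: "q0 \<in> U"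
  obtains B K L n where "q0 \<in> B" "B \<subseteq> U"
    "null_frame c I f B (\<lambda>q. fst (\<iota> (\<sigma> q))) (\<lambda>q. snd (\<iota> (\<sigma> q))) K L n"
proof -
  define x where "x = (\<lambda>q. fst (\<iota> (\<sigma> q)))"
  define z where "z = (\<lambda>q. snd (\<iota> (\<sigma> q)))"
  note p = local_param_patch[OF lp image_M] and co = coordinates[OF lp, folded x_def z_def]
  note lk = lightlike_kernel[OF T lp, folded x_def z_def]
  have zI: "z q \<in> I" and xS: "x q \<in> space_form c" if "q \<in> U" for q
    using coordinates(4,5)[OF lp that] by (simp_all add: z_def x_def)
  let ?a = "axis 1 1 :: real^2" and ?b = "axis 2 1 :: real^2"
  define K0 where "K0 q = dif z q ?b *\<^sub>R ?a - dif z q ?a *\<^sub>R ?b" for q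
  define G where "G q = dif z q ?a *\<^sub>R ?a + dif z q ?b *\<^sub>R ?b" for q
  have sK0: "smooth_on U K0" and sG: "smooth_on U G"
    unfolding K0_def G_def
    by (intro smooth_on_diff smooth_on_add smooth_on_scaleR smooth_on_dif smooth_on_const co p(1))+
  have zK0: "dif z q (K0 q) = 0" if "q \<in> U" for q
    using dif_linear[OF co(2) that] by (simp add: K0_def linear_diff linear_cmul)
  have zG: "dif z q (G q) = (dif z q ?a)\<^sup>2 + (dif z q ?b)\<^sup>2" if "q \<in> U" for q
    using dif_linear[OF co(2) that] by (simp add: G_def linear_add linear_cmul power2_eq_square)
  have grad: "dif z q ?a \<noteq> 0 \<or> dif z q ?b \<noteq> 0" if q: "q \<in> U" for q
  proof (rule ccontr)
    assume 0: "\<not> ?thesis"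
    have e: "e = (e$1) *\<^sub>R ?a + (e$2) *\<^sub>R ?b" for e
      by (simp add: vec_eq_iff forall_2 axis_def)
    have "dif z q e = 0" for e
      by (subst e) (use 0 dif_linear[OF co(2) q] in \<open>simp add: linear_add linear_cmul\<close>)
    then show False using lk(4)[OF q, of ?a] by (simp add: axis_eq_0_iff)
  qed
  have K0_nz: "K0 q \<noteq> 0" if "q \<in> U" for q
    using grad[OF that] by (auto simp: K0_def vec_eq_iff forall_2 axis_def)
  have zG_pos: "dif z q (G q) > 0" if "q \<in> U" for q
    using grad[OF that] by (simp add: zG[OF that] sum_power2_gt_zero_iff)
  have kx: "pseudo_inner c (dif x q (K0 q)) (dif x q (K0 q)) = 0" "dif x q (K0 q) \<noteq> 0"
    "pseudo_inner c (dif x q (K0 q)) (dif x q (G q)) \<noteq> 0" if "q \<in> U" for q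
    using lk(1-3)[OF that K0_nz[OF that] zK0[OF that]] zG_pos[OF that] by auto
  \<comment> \<open>With this \<open>n\<close> the product \<open>\<nu>\<close> is positive at \<open>q0\<close>, hence nearby, and \<open>K0\<close> can be divided by it.\<close>
  define n where "n = dif x q0 (K0 q0)"
  define \<nu> where "\<nu> q = dif x q (K0 q) \<bullet> n" for q
  have s\<nu>: "smooth_on U \<nu>" unfolding \<nu>_def
    by (intro smooth_on_inner smooth_on_dif_along smooth_on_const co sK0 p(1))
  define B where "B = U \<inter> \<nu> -` {0<..}"
  have oB: "open B" unfolding B_def
    by (intro continuous_open_preimage smooth_on_continuous s\<nu> p(1)) auto
  have BU: "B \<subseteq> U" by (auto simp: B_def)
  have q0B: "q0 \<in> B" using q0 kx(2)[OF q0] by (simp add: B_def \<nu>_def n_def)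
  have \<nu>_pos: "\<nu> q > 0" if "q \<in> B" for q using that by (simp add: B_def)
  note sub = smooth_on_subset[OF _ BU]
  define K where "K q = (1 / \<nu> q) *\<^sub>R K0 q" for q
  define R where "R q = (f (z q) / dif z q (G q)) *\<^sub>R G q" for q
  \<comment> \<open>\<open>R\<close> has the right effect on the height; \<open>\<mu>\<close> solves the equation that \<open>R + \<mu> K\<close> be null, which
    is linear because \<open>K\<close> is null.\<close>
  define \<mu> where "\<mu> q = - (1 + pseudo_inner c (dif x q (R q)) (dif x q (R q)))
      / (2 * pseudo_inner c (dif x q (K q)) (dif x q (R q)))" for q
  define L where "L q = R q + \<mu> q *\<^sub>R K q" for q
  have xK: "dif x q (K q) = (1 / \<nu> q) *\<^sub>R dif x q (K0 q)" if "q \<in> B" for q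
    using dif_linear[OF co(1)] that BU by (simp add: K_def linear_cmul subset_iff)
  have xR: "dif x q (R q) = (f (z q) / dif z q (G q)) *\<^sub>R dif x q (G q)" if "q \<in> B" for q
    using dif_linear[OF co(1)] that BU by (simp add: R_def linear_cmul subset_iff)
  have m: "pseudo_inner c (dif x q (K q)) (dif x q (R q)) \<noteq> 0" if "q \<in> B" for q
  proof -
    have "q \<in> U" using that BU by auto
    then show ?thesis
      using kx(3) zG_pos[of q] f_pos[OF zI[of q]] \<nu>_pos[OF that] by (simp add: xK xR that psi_simps)
  qed
  have xL: "dif x q (L q) = dif x q (R q) + \<mu> q *\<^sub>R dif x q (K q)" if "q \<in> B" for q
    using dif_linear[OF co(1)] that BU by (simp add: L_def linear_add linear_cmul subset_iff)
  have sfz: "smooth_on U (\<lambda>q. f (z q))"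
    by (rule smooth_on_compose[OF p(1) I _ f_smooth co(2)]) (use zI in auto)
  have sK: "smooth_on B K" unfolding K_def
    by (intro smooth_on_scaleR smooth_on_divide smooth_on_const oB sub[OF s\<nu>] sub[OF sK0])
      (use \<nu>_pos in force)
  have sR: "smooth_on B R" unfolding R_def
    by (intro smooth_on_scaleR smooth_on_divide oB sub[OF sfz] sub[OF sG] sub[OF smooth_on_dif_along] p(1) co sG)
      (use zG_pos BU in force)
  have sxK: "smooth_on B (\<lambda>q. dif x q (K q))" and sxR: "smooth_on B (\<lambda>q. dif x q (R q))"
    by (intro smooth_on_dif_along oB sub[OF co(1)] sK sR)+
  have s\<mu>: "smooth_on B \<mu>" unfolding \<mu>_def
    by (intro smooth_on_divide smooth_on_minus smooth_on_add smooth_on_mult smooth_on_const smooth_on_psi oB sxK sxR)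
      (use m in simp)
  have sL: "smooth_on B L" unfolding L_def
    by (intro smooth_on_add smooth_on_scaleR oB sR s\<mu> sK)
  have K_null: "pseudo_inner c (dif x q (K q)) (dif x q (K q)) = 0" if "q \<in> B" for q
    using kx(1) that BU by (simp add: xK that psi_simps subset_iff)
  have L_unit: "pseudo_inner c (dif x q (L q)) (dif x q (L q)) = -1" if "q \<in> B" for q
  proof -
    have "pseudo_inner c (dif x q (L q)) (dif x q (L q)) = pseudo_inner c (dif x q (R q)) (dif x q (R q))
        + 2 * pseudo_inner c (dif x q (K q)) (dif x q (R q)) * \<mu> q"
      by (simp add: xL[OF that] psi_simps K_null[OF that]
          pseudo_inner_commute[of c "dif x q (R q)" "dif x q (K q)"])
    also have "\<dots> = -1" using m[OF that] by (simp add: \<mu>_def)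
    finally show ?thesis .
  qed
  have KL: "pseudo_inner c (dif x q (K q)) (dif x q (L q)) \<noteq> 0" if "q \<in> B" for q
    using m[OF that] by (simp add: xL[OF that] psi_simps K_null[OF that])
  have Kz: "dif z q (K q) = 0" if "q \<in> B" for q
    using dif_linear[OF co(2)] zK0 that BU by (simp add: K_def linear_cmul subset_iff)
  have Lz: "dif z q (L q) = f (z q)" if "q \<in> B" for q
  proof -
    have "q \<in> U" using that BU by auto
    then show ?thesis
      using dif_linear[OF co(2)] zG_pos[of q] Kz[OF that]
      by (simp add: L_def R_def linear_add linear_cmul)
  qed
  have K_nz: "K q \<noteq> 0" if "q \<in> B" for q
    using K0_nz[of q] \<nu>_pos[OF that] that BU by (auto simp: K_def)
  have K_norm: "dif x q (K q) \<bullet> n = 1" if "q \<in> B" for q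
    using \<nu>_pos[OF that] by (simp add: xK[OF that] \<nu>_def)
  have lpB: "local_param M \<iota> B \<sigma>" by (rule local_param_subset[OF lp oB BU])
  have zq: "snd (\<iota> (\<sigma> q)) = z q" "fst (\<iota> (\<sigma> q)) = x q" for q by (simp_all add: z_def x_def)
  note geod = umbilical_frame_geodesic[OF umb lpB, folded x_def z_def, unfolded zq,
      OF _ sK sL Kz Lz K_nz K_null L_unit KL]
  have "null_frame c I f B x z K L n"
  proof (unfold_locales; (fact oB sub[OF co(1)] sub[OF co(2)] sK sL)?)
    fix q assume q: "q \<in> B"
    then have "q \<in> U" using BU by auto
    then show "z q \<in> I" "x q \<in> space_form c" using zI xS by auto
    show "dif z q (K q) = 0" "dif z q (L q) = f (z q)"
      "pseudo_inner c (dif x q (K q)) (dif x q (K q)) = 0"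
      "pseudo_inner c (dif x q (L q)) (dif x q (L q)) = -1"
      "pseudo_inner c (dif x q (K q)) (dif x q (L q)) \<noteq> 0" "dif x q (K q) \<bullet> n = 1"
      using Kz Lz K_null L_unit KL K_norm q by auto
    show "\<exists>l. dif (\<lambda>r. dif x r (K r)) q (K q) = l *\<^sub>R dif x q (K q)"
      "dif (\<lambda>r. dif x r (L r)) q (L q) = c *\<^sub>R x q"
      using geod[OF q] by auto
  qed
  then show ?thesis using that[of B K L n] q0B BU by (simp add: x_def z_def)
qed

end

section \<open>Lorentzian space forms\<close>

lemma linear_plane_proj: "linear (plane_proj c d y)"
  by (rule linearI) (simp_all add: plane_proj_def Let_def psi_simps add_divide_distrib algebra_simps)

lemma plane_proj_span:
  assumes "pseudo_inner c d d = 0" "pseudo_inner c y y = -1" "pseudo_inner c d y \<noteq> 0"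
  shows "plane_proj c d y (a *\<^sub>R d + b *\<^sub>R y) = 0"
proof -
  have "plane_proj c d y d = 0" "plane_proj c d y y = 0"
    using assms by (simp_all add: plane_proj_def Let_def pseudo_inner_commute[of c y d] divide_simps)
  then show ?thesis by (simp add: linear_add[OF linear_plane_proj] linear_cmul[OF linear_plane_proj])
qed

lemma plane_proj_0D:
  assumes "plane_proj c d y v = 0" shows "\<exists>a b. v = a *\<^sub>R d + b *\<^sub>R y"
proof -
  have "v = ((pseudo_inner c v y + pseudo_inner c v d / pseudo_inner c d y) / pseudo_inner c d y) *\<^sub>R d
      + (pseudo_inner c v d / pseudo_inner c d y) *\<^sub>R y"
    using assms by (simp add: plane_proj_def Let_def algebra_simps)
  then show ?thesis by blast
qed

context static_space_time
begin

definition plane_cylinder :: "real^4 \<Rightarrow> real^4 \<Rightarrow> real^4 \<Rightarrow> ((real^4) \<times> real) set"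
  where "plane_cylinder x0 d y = {p. (\<exists>a b. fst p = x0 + a *\<^sub>R d + b *\<^sub>R y) \<and> snd p \<in> I}"

text \<open>
  The plane and hence its product with \<open>I\<close> is flat in the surrounding vector space: all derivatives of
  a parametrization stay in the directions of the plane, and so does the covariant derivative,
  because the Koszul expression vanishes on every vector orthogonal to the plane.
\<close>
lemma plane_cylinder_totally_geodesic:
  assumes c0: "c = 0" and x0: "x0 \<in> space_form c" "d $ 4 = 0" "y $ 4 = 0"
    and prod: "pseudo_inner c d d = 0" "pseudo_inner c y y = -1" "pseudo_inner c d y \<noteq> 0"
  shows "totally_geodesic_hypersurface N g (plane_cylinder x0 d y)"
proof -
  let ?H = "plane_cylinder x0 d y"
  let ?m = "pseudo_inner c d y" and ?P = "plane_proj c d y"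
  have x04: "x0 $ 4 = 0" using x0(1) c0 by (simp add: space_form_def)
  have HN: "?H \<subseteq> N"
    using x04 x0(2,3) c0 by (auto simp: plane_cylinder_def static_space_def space_form_def)
  define S where "S = {p :: (real^4) \<times> real. \<exists>a b. fst p = a *\<^sub>R d + b *\<^sub>R y}"
  define B where "B v = pseudo_inner c v d / ?m" for v
  define A where "A v = (pseudo_inner c v y + B v) / ?m" for v
  have AB: "A (a *\<^sub>R d + b *\<^sub>R y) = a" "B (a *\<^sub>R d + b *\<^sub>R y) = b" for a b
    using prod by (simp_all add: A_def B_def psi_simps pseudo_inner_commute[of c y d])
  have contAB: "continuous_on T (\<lambda>p. A (fst p - x0))" "continuous_on T (\<lambda>p. B (fst p - x0))"
    for T :: "((real^4) \<times> real) set"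
    unfolding A_def B_def using prod(3)
    by (auto intro!: continuous_intros bounded_bilinear.continuous_on[OF bounded_bilinear_pseudo_inner])
  define \<rho> :: "real^3 \<Rightarrow> (real^4) \<times> real"
    where "\<rho> r = (x0, 0) + (r$1 *\<^sub>R d + r$2 *\<^sub>R y, r$3)" for r
  define \<rho>' :: "real^3 \<Rightarrow> (real^4) \<times> real" where "\<rho>' r = (r$1 *\<^sub>R d + r$2 *\<^sub>R y, r$3)" for r
  define U3 where "U3 = {r :: real^3. r$3 \<in> I}"
  have lin\<rho>': "linear \<rho>'" by (rule linearI) (simp_all add: \<rho>'_def algebra_simps)
  then have bl\<rho>': "bounded_linear \<rho>'" by (simp add: linear_conv_bounded_linear)
  have oU3: "open U3"
    unfolding U3_def using open_vimage[OF I, of "\<lambda>r :: real^3. r$3"]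
    by (simp add: vimage_def continuous_intros)
  have \<rho>eq: "\<rho> = (\<lambda>r. (x0, 0) + \<rho>' r)" by (simp add: \<rho>_def \<rho>'_def fun_eq_iff)
  have d\<rho>: "dif \<rho> q = \<rho>'" for q
    unfolding \<rho>eq by (rule dif_eqI) (auto intro!: derivative_eq_intros bounded_linear_imp_has_derivative bl\<rho>')
  have inj\<rho>': "inj \<rho>'"
  proof (rule linear_injective_0[OF lin\<rho>', THEN iffD2], intro allI impI)
    fix r assume "\<rho>' r = 0"
    then have r: "r$1 *\<^sub>R d + r$2 *\<^sub>R y = 0" "r$3 = 0" by (simp_all add: \<rho>'_def zero_prod_def)
    have "r$1 = 0" "r$2 = 0"
      using AB[of "r$1" "r$2"] AB[of 0 0] unfolding r(1) by simp_all
    then show "r = 0" using r(2) by (simp add: vec_eq_iff forall_3)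
  qed
  have H\<rho>: "\<rho> ` U3 = ?H"
  proof (intro equalityI subsetI)
    fix p assume "p \<in> ?H"
    then obtain a b where ab: "fst p = x0 + a *\<^sub>R d + b *\<^sub>R y" "snd p \<in> I" by (auto simp: plane_cylinder_def)
    have "p = \<rho> (vector [a, b, snd p])" using ab by (simp add: \<rho>_def prod_eq_iff)
    moreover have "vector [a, b, snd p] \<in> U3" using ab by (simp add: U3_def)
    ultimately show "p \<in> \<rho> ` U3" by blast
  next
    fix p assume "p \<in> \<rho> ` U3"
    then obtain r where "p = \<rho> r" "r$3 \<in> I" by (auto simp: U3_def)
    then have "fst p = x0 + r$1 *\<^sub>R d + r$2 *\<^sub>R y" "snd p \<in> I" by (simp_all add: \<rho>_def)
    then show "p \<in> ?H" unfolding plane_cylinder_def by blast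
  qed
  define \<tau> :: "(real^4) \<times> real \<Rightarrow> real^3"
    where "\<tau> p = A (fst p - x0) *\<^sub>R axis 1 1 + B (fst p - x0) *\<^sub>R axis 2 1 + snd p *\<^sub>R axis 3 1" for p
  have "homeomorphism U3 (\<rho> ` U3) \<rho> \<tau>"
  proof (rule homeomorphismI)
    show "continuous_on U3 \<rho>" unfolding \<rho>_def by (intro continuous_intros)
    show "continuous_on (\<rho> ` U3) \<tau>"
      unfolding \<tau>_def by (intro continuous_intros contAB)
    show inv: "\<tau> (\<rho> r) = r" for r
      by (simp add: \<tau>_def \<rho>_def AB vec_eq_iff forall_3 axis_def)
    show "\<tau> ` \<rho> ` U3 \<subseteq> U3" using inv by auto
    show "\<rho> (\<tau> p) = p" if "p \<in> \<rho> ` U3" for p using that inv by auto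
  qed simp
  moreover have "smooth_on U3 \<rho>" unfolding \<rho>eq
    by (rule smooth_on_add[OF oU3 smooth_on_const smooth_on_linear[OF bl\<rho>']])
  moreover have "(\<lambda>x. x) \<circ> \<rho> = \<rho>" by (simp add: o_def)
  ultimately have lp\<rho>: "local_param ?H (\<lambda>x. x) U3 \<rho>"
    unfolding local_param_def using oU3 H\<rho> d\<rho> inj\<rho>' by auto
  show ?thesis
    unfolding totally_geodesic_hypersurface_def
  proof (intro conjI HN allI impI ballI)
    fix p assume "p \<in> ?H"
    then show "\<exists>(U::(real^3) set) \<sigma>. local_param ?H (\<lambda>x. x) U \<sigma> \<and> p \<in> \<sigma> ` U"
      using lp\<rho> H\<rho> by blast
  next
    fix U :: "(real^3) set" and \<sigma> :: "real^3 \<Rightarrow> (real^4) \<times> real" and q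
    assume lp: "local_param ?H (\<lambda>x. x) U \<sigma>" and q: "q \<in> U"
    have p: "open U" "smooth_on U \<sigma>" "\<sigma> ` U \<subseteq> ?H" "inj (dif \<sigma> q)"
      using local_param_patch[OF lp, of ?H] q by (simp_all add: o_def)
    note lin = dif_linear[OF p(2)]
    have Pbl: "bounded_linear (\<lambda>p :: (real^4) \<times> real. ?P (fst p))"
      using bounded_linear_compose[OF linear_plane_proj[of c d y, unfolded linear_conv_bounded_linear] bounded_linear_fst]
      by simp
    have vanish: "?P (fst (dif h r e)) = 0"
      if "smooth_on U h" "r \<in> U" "\<And>r. r \<in> U \<Longrightarrow> ?P (fst (h r)) = k" for h :: "real^3 \<Rightarrow> (real^4) \<times> real" and r e k
      using dif_linear_compose[OF Pbl that(1,2), of e]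
        dif_cong_open[OF p(1) that(2), of "\<lambda>r. ?P (fst (h r))" "\<lambda>_. k"] that(3) by simp
    have P\<sigma>: "?P (fst (\<sigma> r)) = ?P x0" if r: "r \<in> U" for r
    proof -
      have "\<sigma> r \<in> ?H" using p(3) r by auto
      then obtain a b where "fst (\<sigma> r) = x0 + (a *\<^sub>R d + b *\<^sub>R y)"
        by (auto simp: plane_cylinder_def add.assoc)
      then show ?thesis using plane_proj_span[OF prod] by (simp add: linear_add[OF linear_plane_proj])
    qed
    have P1: "?P (fst (dif \<sigma> r e)) = 0" if "r \<in> U" for r e
      by (rule vanish[OF p(2) that P\<sigma>])
    have P2: "?P (fst (dif (\<lambda>r. dif \<sigma> r e') q e)) = 0" for e e'
      by (rule vanish[OF smooth_on_dif[OF p(2)] q P1])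
    \<comment> \<open>An injective linear map into a three-dimensional space is onto; \<open>\<tau>\<close> gives the coordinates.\<close>
    have range: "s \<in> range (dif \<sigma> q)" if s: "?P (fst s) = 0" for s
    proof -
      have lin\<tau>: "linear (\<lambda>s. \<tau> (s + (x0, 0)))"
        unfolding \<tau>_def A_def B_def
        by (rule linearI) (simp_all add: psi_simps algebra_simps add_divide_distrib)
      have \<tau>\<rho>': "\<rho>' (\<tau> (s + (x0, 0))) = s" if "?P (fst s) = 0" for s
        using plane_proj_0D[OF that]
        by (auto simp: \<tau>_def \<rho>'_def AB axis_def prod_eq_iff)
      define G where "G e = \<tau> (dif \<sigma> q e + (x0, 0))" for e
      have linG: "linear G"
        unfolding G_def using linear_compose[OF lin[OF q] lin\<tau>] by (simp add: o_def)
      have \<rho>G: "\<rho>' (G e) = dif \<sigma> q e" for e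
        unfolding G_def by (rule \<tau>\<rho>'[OF P1[OF q]])
      have "inj G"
        by (rule injI) (metis \<rho>G p(4) injD)
      then have "surj G" using linear_injective_imp_surjective[OF linG] by simp
      then obtain e where "\<tau> (s + (x0, 0)) = G e" by (metis surjD)
      then have "s = dif \<sigma> q e" using \<tau>\<rho>'[OF s] \<rho>G by metis
      then show ?thesis by simp
    qed
    have XN: "\<sigma> q \<in> N" using p(3) HN q by auto
    have fz: "f (snd (\<sigma> q)) > 0" by (rule in_N_D(1)[OF XN])
    show "e = 0" if e: "\<forall>e'. g (\<sigma> q) (dif \<sigma> q e) (dif \<sigma> q e') = 0" for e
    proof -
      have e0: "g (\<sigma> q) (dif \<sigma> q e) s = 0" if "?P (fst s) = 0" for s
        using range[OF that] e by auto
      obtain a b where ab: "fst (dif \<sigma> q e) = a *\<^sub>R d + b *\<^sub>R y" using plane_proj_0D[OF P1[OF q]] by blast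
      have "pseudo_inner c (fst (dif \<sigma> q e)) d = 0" "pseudo_inner c (fst (dif \<sigma> q e)) y = 0"
        using e0[of "(d, 0)"] e0[of "(y, 0)"] plane_proj_span[OF prod, of 1 0] plane_proj_span[OF prod, of 0 1] fz
        by (simp_all add: static_metric_def)
      then have "a = 0" "b = 0" using AB[of a b] by (simp_all add: ab A_def B_def)
      moreover have "snd (dif \<sigma> q e) = 0"
        using e0[of "(0, 1)"] plane_proj_span[OF prod, of 0 0] by (simp add: static_metric_def psi_simps)
      ultimately have "dif \<sigma> q e = 0" by (simp add: prod_eq_iff ab)
      then show ?thesis using p(4) linear_injective_0[OF lin[OF q]] by blast
    qed
    show "cov_deriv N g \<sigma> (\<lambda>r. dif \<sigma> r e') e q \<in> range (dif \<sigma> q)" for e e'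
    proof (rule range)
      let ?W = "cov_deriv N g \<sigma> (\<lambda>r. dif \<sigma> r e') e q"
      note cov = cov_deriv_static[where X=\<sigma> and q=q and V="\<lambda>r. dif \<sigma> r e'" and e=e,
          OF c I XN in_N_D(2)[OF XN] less_imp_neq[OF fz, THEN not_sym]]
      have sf: "fst (\<sigma> q) \<in> space_form c" by (rule in_N_D(3)[OF XN])
      have orth: "pseudo_inner c u (tproj c (fst (\<sigma> q)) (?P w)) = 0" if "?P u = 0" for u w
      proof -
        have "pseudo_inner c u (nvec c (fst (\<sigma> q))) = 0"
          using plane_proj_0D[OF that] x0 c0 by (auto simp: nvec_def pseudo_inner_def axis_def)
        then have "tproj c (fst (\<sigma> q)) u = u" by (rule tproj_tangent)
        then have "pseudo_inner c u (tproj c (fst (\<sigma> q)) (?P w)) = pseudo_inner c (?P u) w"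
          by (metis tproj_self_adjoint plane_proj_self_adjoint)
        then show ?thesis by (simp add: that psi_simps)
      qed
      have "pseudo_inner c (?P (fst ?W)) w = 0" for w
      proof -
        let ?Z = "(tproj c (fst (\<sigma> q)) (?P w), 0 :: real)"
        have Z: "pseudo_inner c (fst ?Z) (nvec c (fst (\<sigma> q))) = 0" using tproj_orthogonal[OF c sf] by simp
        have "koszul c f (\<sigma> q) (dif \<sigma> q e) (dif \<sigma> q e') (dif (\<lambda>r. dif \<sigma> r e') q e) ?Z = 0"
          unfolding koszul_def static_metric_def using orth[OF P2] orth[OF P1[OF q]] by simp
        then have "g (\<sigma> q) ?W ?Z = 0" unfolding cov(2)[OF Z] .
        then have "pseudo_inner c (fst ?W) (tproj c (fst (\<sigma> q)) (?P w)) = 0"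
          using fz static_metric_def[of c f "\<sigma> q" ?W ?Z] by simp
        moreover have "tproj c (fst (\<sigma> q)) (fst ?W) = fst ?W" by (rule tproj_tangent[OF cov(1)])
        ultimately show ?thesis by (metis tproj_self_adjoint plane_proj_self_adjoint)
      qed
      then show "?P (fst ?W) = 0" by (rule pseudo_inner_nondegenerate)
    qed
  qed
qed

end

context timelike_static
begin

theorem lorentzian_umbilical_in_totally_geodesic:
  assumes c1: "c \<noteq> -1" and T: "lightlike_T c f M \<iota>" and umb: "totally_umbilical N g M \<iota>"
  shows "locally_in_totally_geodesic N g M \<iota>"
proof -
  obtain p0 where "p0 \<in> M" using timelike by (auto simp: timelike_surface_def)
  moreover have "\<forall>p\<in>M. \<exists>(U::(real^2) set) \<sigma>. local_param M \<iota> U \<sigma> \<and> p \<in> \<sigma> ` U"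
    using timelike by (simp add: timelike_surface_def)
  ultimately obtain U :: "(real^2) set" and \<sigma> where "local_param M \<iota> U \<sigma>" "p0 \<in> \<sigma> ` U"
    by blast
  then obtain q0 where lp: "local_param M \<iota> U \<sigma>" and q0: "q0 \<in> U" by blast
  obtain B K L n where B: "q0 \<in> B" "B \<subseteq> U"
    and nf: "null_frame c I f B (\<lambda>q. fst (\<iota> (\<sigma> q))) (\<lambda>q. snd (\<iota> (\<sigma> q))) K L n"
    using null_frame_exists[OF T umb lp q0] by metis
  interpret nf: null_frame c I f B "\<lambda>q. fst (\<iota> (\<sigma> q))" "\<lambda>q. snd (\<iota> (\<sigma> q))" K L n by (rule nf)
  have c0: "c = 0" by (rule nf.lorentzian_case(2)[OF c1 B(1)])
  obtain r where r: "r > 0" "ball q0 r \<subseteq> B"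
    "\<And>q. q \<in> ball q0 r \<Longrightarrow> \<exists>s t. fst (\<iota> (\<sigma> q)) = fst (\<iota> (\<sigma> q0)) + s *\<^sub>R nf.d q0 + t *\<^sub>R nf.y q0"
    using nf.minkowski_plane[OF c0 B(1)] by metis
  let ?H = "plane_cylinder (fst (\<iota> (\<sigma> q0))) (nf.d q0) (nf.y q0)"
  have "(dif (\<lambda>q. fst (\<iota> (\<sigma> q))) q0 e) $ 4 = 0" for e
    using tangent_nvec[OF lp q0, of e] c0 by (simp add: nvec_def pseudo_inner_def axis_def)
  then have "totally_geodesic_hypersurface N g ?H"
    using nf.frame_products[OF B(1)]
    by (intro plane_cylinder_totally_geodesic[OF c0 nf.x_in[OF B(1)]]) (simp_all add: nf.d_def nf.y_def)
  moreover have "local_param M \<iota> (ball q0 r) \<sigma>"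
    using local_param_subset[OF lp] r B by auto
  then have "openin (top_of_set M) (\<sigma> ` ball q0 r)" by (simp add: local_param_def)
  moreover have "\<iota> ` \<sigma> ` ball q0 r \<subseteq> ?H"
    using r nf.z_in by (fastforce simp: plane_cylinder_def)
  ultimately show ?thesis
    unfolding locally_in_totally_geodesic_def using r(1)
    by (intro exI[of _ "\<sigma> ` ball q0 r"] exI[of _ ?H]) auto
qed

end

section \<open>The ruled surface in anti-de Sitter space\<close>

lemma F_int_has_derivative:
  assumes "open I" "is_interval I" "z0 \<in> I" "t \<in> I" and f: "continuous_on I f" "\<And>z. z \<in> I \<Longrightarrow> f z \<noteq> 0"
  shows "(F_int f z0 has_vector_derivative 1 / f t) (at t)"
proof -
  obtain \<epsilon> where \<epsilon>: "\<epsilon> > 0" "cball t \<epsilon> \<subseteq> I" using assms(1,4) open_contains_cball by blast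
  define l where "l = min z0 (t - \<epsilon>)"
  define r where "r = max z0 (t + \<epsilon>)"
  have "t - \<epsilon> \<in> I" "t + \<epsilon> \<in> I" using \<epsilon> by (auto simp: subset_iff dist_real_def)
  then have "l \<in> I" "r \<in> I" using assms(3) by (auto simp: l_def r_def min_def max_def)
  then have sub: "{l..r} \<subseteq> I" using assms(2) by (meson atLeastAtMost_iff mem_is_interval_1_I subsetI)
  have "continuous_on {l..r} (\<lambda>x. 1 / f x)"
    using sub f by (intro continuous_intros continuous_on_subset[OF f(1)]) auto
  then have "((\<lambda>u. LBINT y=z0..u. 1 / f y) has_vector_derivative 1 / f t) (at t within {l..r})"
    by (intro interval_integral_FTC2) (use \<epsilon> in \<open>auto simp: l_def r_def\<close>)
  then have "((\<lambda>u. LBINT y=z0..u. 1 / f y) has_vector_derivative 1 / f t) (at t within {l<..<r})"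
    by (rule has_vector_derivative_within_subset) auto
  moreover have "at t within {l<..<r} = at t"
    by (rule at_within_open) (use \<epsilon> in \<open>auto simp: l_def r_def\<close>)
  ultimately have "((\<lambda>u. LBINT y=z0..u. 1 / f y) has_vector_derivative 1 / f t) (at t)"
    by (simp only:)
  then show ?thesis unfolding F_int_def[abs_def] .
qed

text \<open>
  Initial data of a surface ruled by null geodesics: time-like geodesics start at \<open>a + s n0\<close> with the
  velocity \<open>b + s n1\<close>.
\<close>
locale ads_frame =
  fixes a b n0 n1 :: "real^4"
  assumes aa: "pseudo_inner (-1) a a = -1" and bb: "pseudo_inner (-1) b b = -1"
    and ab: "pseudo_inner (-1) a b = 0"
    and n0n0: "pseudo_inner (-1) n0 n0 = 0" and n1n1: "pseudo_inner (-1) n1 n1 = 0"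
    and n0n1: "pseudo_inner (-1) n0 n1 = 0"
    and an0: "pseudo_inner (-1) a n0 = 0" and bn1: "pseudo_inner (-1) b n1 = 0"
    and an1: "pseudo_inner (-1) a n1 = -1" and bn0: "pseudo_inner (-1) b n0 = 1"
begin

lemmas gram = aa bb ab n0n0 n1n1 n0n1 an0 bn1 an1 bn0
  ab[unfolded pseudo_inner_commute[of _ a b]] n0n1[unfolded pseudo_inner_commute[of _ n0 n1]]
  an0[unfolded pseudo_inner_commute[of _ a n0]] bn1[unfolded pseudo_inner_commute[of _ b n1]]
  an1[unfolded pseudo_inner_commute[of _ a n1]] bn0[unfolded pseudo_inner_commute[of _ b n0]]

text \<open>
  Position and velocity at time \<open>t\<close> of the geodesic with label \<open>s\<close>, and the direction of the null line
  formed by all geodesics at time \<open>t\<close>.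
\<close>
definition px :: "real \<Rightarrow> real \<Rightarrow> real^4"
  where "px t s = cos t *\<^sub>R (a + s *\<^sub>R n0) + sin t *\<^sub>R (b + s *\<^sub>R n1)"

definition py :: "real \<Rightarrow> real \<Rightarrow> real^4"
  where "py t s = cos t *\<^sub>R (b + s *\<^sub>R n1) - sin t *\<^sub>R (a + s *\<^sub>R n0)"

definition pd :: "real \<Rightarrow> real^4"
  where "pd t = cos t *\<^sub>R n0 + sin t *\<^sub>R n1"

lemma ruled_products:
  "pseudo_inner (-1) (px t s) (px t s) = -1" "pseudo_inner (-1) (py t s) (py t s) = -1"
  "pseudo_inner (-1) (px t s) (py t s) = 0" "pseudo_inner (-1) (pd t) (pd t) = 0"
  "pseudo_inner (-1) (px t s) (pd t) = 0" "pseudo_inner (-1) (py t s) (pd t) = 1"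
  "pseudo_inner (-1) (pd t) (py t s) = 1"
proof -
  have cs: "cos t * cos t = 1 - sin t * sin t" using sin_cos_squared_add[of t] by (simp add: power2_eq_square algebra_simps)
  show "pseudo_inner (-1) (px t s) (px t s) = -1" "pseudo_inner (-1) (py t s) (py t s) = -1"
  "pseudo_inner (-1) (px t s) (py t s) = 0" "pseudo_inner (-1) (pd t) (pd t) = 0"
  "pseudo_inner (-1) (px t s) (pd t) = 0" "pseudo_inner (-1) (py t s) (pd t) = 1"
  "pseudo_inner (-1) (pd t) (py t s) = 1"
    unfolding px_def py_def pd_def by (simp_all add: psi_simps gram cs algebra_simps)
qed

lemma px_has_derivative:
  assumes "(t has_derivative t') (at q)" "(s has_derivative s') (at q)"
  shows "((\<lambda>q. px (t q) (s q)) has_derivative (\<lambda>e. t' e *\<^sub>R py (t q) (s q) + s' e *\<^sub>R pd (t q))) (at q)"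
    and "((\<lambda>q. py (t q) (s q)) has_derivative
      (\<lambda>e. - t' e *\<^sub>R px (t q) (s q) + s' e *\<^sub>R (cos (t q) *\<^sub>R n1 - sin (t q) *\<^sub>R n0))) (at q)"
  unfolding px_def py_def pd_def
  by (auto intro!: derivative_eq_intros assms simp: fun_eq_iff algebra_simps)

lemma pd_has_derivative:
  assumes "(t has_derivative t') (at q)"
  shows "((\<lambda>q. pd (t q)) has_derivative (\<lambda>e. t' e *\<^sub>R (cos (t q) *\<^sub>R n1 - sin (t q) *\<^sub>R n0))) (at q)"
  unfolding pd_def
  by (auto intro!: derivative_eq_intros assms simp: fun_eq_iff algebra_simps)

end

text \<open>
  The surface \<open>phi_surface\<close> is swept out in the same way from explicit frames. The constants \<open>k\<close> and \<open>k2\<close>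
  change only the frame, the phase of \<open>\<Theta>\<close> and the origin of the parameter \<open>v\<close>, so all these surfaces
  are congruent.
\<close>
definition phi_a :: "real \<Rightarrow> real^4"
  where "phi_a k = vector [0, - (2 * k\<^sup>2 + 1) / (2 * sqrt 2 * k), (2 * k\<^sup>2 - 1) / (2 * sqrt 2 * k), 0]"

definition phi_n1 :: "real \<Rightarrow> real^4"
  where "phi_n1 k = vector [0, - 1 / (sqrt 2 * k), - 1 / (sqrt 2 * k), 0]"

definition phi_b :: "real^4" where "phi_b = vector [-1, 0, 0, 0]"
definition phi_n0 :: "real^4" where "phi_n0 = vector [1, 0, 0, 1]"

lemma vector_4:
  "(vector [x, y, z, w] :: ('a::zero)^4) $ 1 = x" "(vector [x, y, z, w] :: ('a::zero)^4) $ 2 = y"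
  "(vector [x, y, z, w] :: ('a::zero)^4) $ 3 = z" "(vector [x, y, z, w] :: ('a::zero)^4) $ 4 = w"
  unfolding vector_def by simp_all

lemma phi_frame:
  assumes "k \<noteq> 0" shows "ads_frame (phi_a k) phi_b phi_n0 (phi_n1 k)"
  using assms
  by unfold_locales
    (simp_all add: vector_4 phi_a_def phi_b_def phi_n0_def phi_n1_def pseudo_inner_def field_simps power2_eq_square)

lemma phi_surface_ruled:
  assumes "k \<noteq> 0"
  shows "phi_surface f z0 k k2 q =
    (ads_frame.px (phi_a k) phi_b phi_n0 (phi_n1 k) (F_int f z0 (q$1) + k2 / k) (q$2 + k2 / (2 * k)), q$1)"
proof -
  interpret ads_frame "phi_a k" phi_b phi_n0 "phi_n1 k" by (rule phi_frame[OF assms])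
  have ss: "sqrt 2 * (sqrt 2 * x) = 2 * x" for x by (simp flip: mult.assoc)
  show ?thesis
    using assms unfolding phi_surface_def Let_def px_def
    by (simp add: vector_4 phi_a_def phi_b_def phi_n0_def phi_n1_def vec_eq_iff forall_4)
      (simp add: field_simps power2_eq_square ss)
qed

locale phi_model = static_space_time "-1" I f + ads_frame a b n0 n1 for I f a b n0 n1 +
  fixes F :: "real \<Rightarrow> real" and t0 s0 :: real
  assumes F: "t \<in> I \<Longrightarrow> (F has_vector_derivative 1 / f t) (at t)"
begin

definition \<Theta> :: "real^2 \<Rightarrow> real" where "\<Theta> q = F (q$1) + t0"
definition S :: "real^2 \<Rightarrow> real" where "S q = q$2 + s0"
definition Y :: "real^2 \<Rightarrow> (real^4) \<times> real" where "Y q = (px (\<Theta> q) (S q), q$1)"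
abbreviation "D \<equiv> phi_domain I"

lemma open_D: "open D"
  unfolding phi_domain_def using open_vimage[OF I, of "\<lambda>r :: real^2. r$1"]
  by (simp add: vimage_def continuous_intros)

lemma \<Theta>_derivative: "q \<in> D \<Longrightarrow> (\<Theta> has_derivative (\<lambda>e. e$1 / f (q$1))) (at q)"
proof -
  assume q: "q \<in> D"
  then have "q$1 \<in> I" by (simp add: phi_domain_def)
  from has_derivative_compose[OF bounded_linear_imp_has_derivative[OF bounded_linear_vec_nth[of 1]]
      F[OF this, unfolded has_vector_derivative_def]]
  show ?thesis unfolding \<Theta>_def by (auto intro!: derivative_eq_intros)
qed

lemma S_derivative: "(S has_derivative (\<lambda>e. e$2)) (at q)"
  unfolding S_def by (auto intro!: derivative_eq_intros bounded_linear_imp_has_derivative)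

lemma Y_smooth: "smooth_on D Y"
proof -
  have sF: "smooth_on I F" by (rule smooth_conformal_coordinate[OF F])
  have s: "smooth_on D (\<lambda>q. q $ i)" for i :: 2
    by (rule smooth_on_linear) (rule bounded_linear_vec_nth)
  have "smooth_on D (\<lambda>q. F (q $ 1))"
    by (rule smooth_on_compose[OF open_D I _ sF s]) (auto simp: phi_domain_def)
  then show ?thesis
    unfolding Y_def[abs_def] \<Theta>_def S_def px_def
    by (intro smooth_on_Pair smooth_on_add smooth_on_scaleR smooth_on_cos smooth_on_sin smooth_on_const s open_D)
qed

lemma dif_Y:
  assumes "q \<in> D"
  shows "dif Y q e = ((e$1 / f (q$1)) *\<^sub>R py (\<Theta> q) (S q) + e$2 *\<^sub>R pd (\<Theta> q), e$1)"
proof -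
  have "(Y has_derivative (\<lambda>e. ((e$1 / f (q$1)) *\<^sub>R py (\<Theta> q) (S q) + e$2 *\<^sub>R pd (\<Theta> q), e$1))) (at q)"
    unfolding Y_def[abs_def]
    by (intro has_derivative_Pair px_has_derivative \<Theta>_derivative assms S_derivative
        bounded_linear_imp_has_derivative bounded_linear_vec_nth)
  from dif_eqI[OF this] show ?thesis by simp
qed

lemma Y_in_N: "q \<in> D \<Longrightarrow> Y q \<in> N"
  by (simp add: Y_def phi_domain_def static_space_def space_form_def ruled_products)

text \<open>The coordinate lines are null; in the coordinates the metric is \<open>2 f(u) du dv\<close>.\<close>
lemma Y_induced:
  assumes "q \<in> D"
  shows "g (Y q) (dif Y q e) (dif Y q e') = f (q$1) * (e$1 * e'$2 + e$2 * e'$1)"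
proof -
  have "f (q$1) > 0" using f_pos assms by (auto simp: phi_domain_def)
  then show ?thesis
    unfolding dif_Y[OF assms] static_metric_def
    by (simp add: Y_def psi_simps ruled_products field_simps power2_eq_square)
qed

lemma Y_nondegenerate:
  assumes "q \<in> D" "\<And>e'. g (Y q) (dif Y q e) (dif Y q e') = 0" shows "e = 0"
proof -
  have "f (q$1) > 0" using f_pos assms(1) by (auto simp: phi_domain_def)
  then have "e$1 = 0" "e$2 = 0"
    using assms(2)[of "axis 2 1"] assms(2)[of "axis 1 1"] by (simp_all add: Y_induced[OF assms(1)] axis_def)
  then show ?thesis by (simp add: vec_eq_iff forall_2)
qed

lemma inj_dif_Y: assumes "q \<in> D" shows "inj (dif Y q)"
proof (rule linear_injective_0[OF dif_linear[OF Y_smooth assms], THEN iffD2], intro allI impI)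
  fix e assume "dif Y q e = 0"
  then show "e = 0" by (intro Y_nondegenerate[OF assms]) (simp add: static_metric_simps)
qed

text \<open>Both families of coordinate lines are null geodesics up to parametrization.\<close>
lemma Y_null_lines:
  assumes q: "q \<in> D" and Z: "pseudo_inner (-1) (fst Z) (fst (Y q)) = 0"
    and ortho: "g (Y q) (dif Y q (axis i 1)) Z = 0"
  shows "koszul (-1) f (Y q) (dif Y q (axis i 1)) (dif Y q (axis i 1))
    (dif (\<lambda>r. dif Y r (axis i 1)) q (axis i 1)) Z = 0"
proof -
  have fz: "f (q$1) > 0" "q$1 \<in> I" using f_pos q by (auto simp: phi_domain_def)
  note f' = smooth_on_has_derivative[OF f_smooth fz(2)]
  have fq: "((\<lambda>r. f (r$1)) has_derivative (\<lambda>e. dif f (q$1) (e$1))) (at q)"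
    by (rule has_derivative_compose[OF bounded_linear_imp_has_derivative[OF bounded_linear_vec_nth] f'])
  consider "i = 1" | "i = 2" using exhaust_2 by blast
  then show ?thesis
  proof cases
    case 1
    have e1: "dif Y r (axis 1 1) = ((1 / f (r$1)) *\<^sub>R py (\<Theta> r) (S r), 1)" if "r \<in> D" for r
      by (simp add: dif_Y[OF that] axis_def)
    have "((\<lambda>r. ((1 / f (r$1)) *\<^sub>R py (\<Theta> r) (S r), 1::real)) has_derivative
      (\<lambda>e. ((1 / f (q$1)) *\<^sub>R (- (e$1 / f (q$1)) *\<^sub>R px (\<Theta> q) (S q)
          + e$2 *\<^sub>R (cos (\<Theta> q) *\<^sub>R n1 - sin (\<Theta> q) *\<^sub>R n0))
        + (- dif f (q$1) (e$1) / (f (q$1) * f (q$1))) *\<^sub>R py (\<Theta> q) (S q), 0))) (at q)"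
      using fz
      by (intro has_derivative_Pair has_derivative_scaleR px_has_derivative \<Theta>_derivative q S_derivative
          has_derivative_const)
        (auto intro!: derivative_eq_intros fq simp: power2_eq_square divide_simps)
    from dif_eqI[OF this] have "dif (\<lambda>r. dif Y r (axis 1 1)) q (axis 1 1)
        = ((- 1 / (f (q$1) * f (q$1))) *\<^sub>R px (\<Theta> q) (S q)
           + (- dif f (q$1) 1 / (f (q$1) * f (q$1))) *\<^sub>R py (\<Theta> q) (S q), 0)"
      using dif_cong_open[OF open_D q, of "\<lambda>r. dif Y r (axis 1 1)" "\<lambda>r. ((1 / f (r$1)) *\<^sub>R py (\<Theta> r) (S r), 1)"] e1
      by (simp add: axis_def)
    moreover have "pseudo_inner (-1) (px (\<Theta> q) (S q)) (fst Z) = 0"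
      using Z by (simp add: Y_def pseudo_inner_commute)
    moreover have "f (q$1) * pseudo_inner (-1) (py (\<Theta> q) (S q)) (fst Z) = - snd Z"
      using ortho fz by (simp add: 1 e1[OF q] static_metric_def Y_def psi_simps power2_eq_square)
    then have "pseudo_inner (-1) (py (\<Theta> q) (S q)) (fst Z) = - snd Z / f (q$1)"
      using fz by (simp add: field_simps)
    ultimately show ?thesis
      using fz unfolding 1 koszul_def static_metric_def e1[OF q]
      by (simp add: Y_def psi_simps ruled_products field_simps power2_eq_square)
  next
    case 2
    have e2: "dif Y r (axis 2 1) = (pd (\<Theta> r), 0)" if "r \<in> D" for r
      by (simp add: dif_Y[OF that] axis_def)
    have "((\<lambda>r. (pd (\<Theta> r), 0::real)) has_derivative
      (\<lambda>e. ((e$1 / f (q$1)) *\<^sub>R (cos (\<Theta> q) *\<^sub>R n1 - sin (\<Theta> q) *\<^sub>R n0), 0))) (at q)"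
      by (intro has_derivative_Pair pd_has_derivative \<Theta>_derivative q has_derivative_const)
    from dif_eqI[OF this] have "dif (\<lambda>r. dif Y r (axis 2 1)) q (axis 2 1) = 0"
      using dif_cong_open[OF open_D q, of "\<lambda>r. dif Y r (axis 2 1)" "\<lambda>r. (pd (\<Theta> r), 0)"] e2
      by (simp add: axis_def zero_prod_def)
    then show ?thesis
      unfolding 2 koszul_def e2[OF q] by (simp add: static_metric_simps ruled_products)
  qed
qed

end

section \<open>Isometries between frames\<close>

text \<open>
  The linear map between two frames. The coefficients are those of the dual basis with respect to
  the Gram matrix of an \<open>ads_frame\<close>.
\<close>
definition frame_map :: "real^4 \<Rightarrow> real^4 \<Rightarrow> real^4 \<Rightarrow> real^4 \<Rightarrow> real^4 \<Rightarrow> real^4 \<Rightarrow> real^4 \<Rightarrow> real^4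
    \<Rightarrow> real^4 \<Rightarrow> real^4"
  where "frame_map a b n0 n1 a' b' n0' n1' v =
    - pseudo_inner (-1) v n1 *\<^sub>R a' + pseudo_inner (-1) v n0 *\<^sub>R b'
    + (pseudo_inner (-1) v b + pseudo_inner (-1) v n0) *\<^sub>R n0'
    + (pseudo_inner (-1) v n1 - pseudo_inner (-1) v a) *\<^sub>R n1'"

lemma linear_frame_map: "linear (frame_map a b n0 n1 a' b' n0' n1')"
  by (rule linearI) (simp_all add: frame_map_def psi_simps algebra_simps)

context ads_frame
begin

text \<open>The Gram matrix is invertible, so the frame is a basis and its dual expansion is exact.\<close>
lemma frame_map_self: "frame_map a b n0 n1 a b n0 n1 v = v"
proof -
  define \<Phi> :: "real^4 \<Rightarrow> real^4" where "\<Phi> v = vector [pseudo_inner (-1) v a, pseudo_inner (-1) v b,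
      pseudo_inner (-1) v n0, pseudo_inner (-1) v n1]" for v
  have lin: "linear \<Phi>"
    by (rule linearI) (simp_all add: \<Phi>_def psi_simps vec_eq_iff forall_4 vector_4)
  have "surj \<Phi>"
  proof (rule surjI)
    fix w :: "real^4"
    show "\<Phi> (- (w$4) *\<^sub>R a + (w$3) *\<^sub>R b + (w$2 + w$3) *\<^sub>R n0 + (w$4 - w$1) *\<^sub>R n1) = w"
      by (simp add: \<Phi>_def psi_simps gram vec_eq_iff forall_4 vector_4)
  qed
  then have "inj \<Phi>" by (rule linear_surjective_imp_injective[OF lin]) simp
  moreover have "\<Phi> (frame_map a b n0 n1 a b n0 n1 v) = \<Phi> v"
    by (simp add: \<Phi>_def frame_map_def psi_simps gram)
  ultimately show ?thesis by (rule injD)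
qed

end

lemma frame_map_isometric:
  assumes "ads_frame a b n0 n1" "ads_frame a' b' n0' n1'"
  defines "L \<equiv> frame_map a b n0 n1 a' b' n0' n1'"
  shows "pseudo_inner (-1) (L v) (L w) = pseudo_inner (-1) v w"
    and "frame_map a' b' n0' n1' a b n0 n1 (L v) = v"
    and "L a = a'" "L b = b'" "L n0 = n0'" "L n1 = n1'"
proof -
  interpret A: ads_frame a b n0 n1 by fact
  interpret A': ads_frame a' b' n0' n1' by fact
  let ?E = "frame_map a b n0 n1 a b n0 n1"
  have "pseudo_inner (-1) (L v) (L w) = pseudo_inner (-1) (?E v) (?E w)"
    unfolding L_def frame_map_def by (simp add: psi_simps A.gram A'.gram)
  then show "pseudo_inner (-1) (L v) (L w) = pseudo_inner (-1) v w" by (simp add: A.frame_map_self)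
  have "frame_map a' b' n0' n1' a b n0 n1 (L v) = ?E v"
    unfolding L_def frame_map_def by (simp add: psi_simps A'.gram)
  then show "frame_map a' b' n0' n1' a b n0 n1 (L v) = v" by (simp add: A.frame_map_self)
  show "L a = a'" "L b = b'" "L n0 = n0'" "L n1 = n1'"
    unfolding L_def frame_map_def by (simp_all add: A.gram)
qed

context static_space_time
begin

lemma isometry_of_linear:
  assumes L: "linear L" "linear L'" "\<And>v. L' (L v) = v" "\<And>v. L (L' v) = v"
    and iso: "\<And>v w. pseudo_inner c (L v) (L w) = pseudo_inner c v w" and c0: "c \<noteq> 0"
  shows "isometry_of N g (\<lambda>p. (L (fst p), snd p))"
proof -
  let ?\<Psi> = "\<lambda>p :: (real^4) \<times> real. (L (fst p), snd p)" and ?\<Psi>' = "\<lambda>p :: (real^4) \<times> real. (L' (fst p), snd p)"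
  have iso': "pseudo_inner c (L' v) (L' w) = pseudo_inner c v w" for v w
    using iso[of "L' v" "L' w"] L by simp
  have N: "?\<Psi> p \<in> N" "?\<Psi>' p \<in> N" if "p \<in> N" for p
    using that c0 iso iso' by (auto simp: static_space_def space_form_def)
  have inv: "?\<Psi>' (?\<Psi> p) = p" "?\<Psi> (?\<Psi>' p) = p" for p using L by simp_all
  have bl: "bounded_linear ?\<Psi>" "bounded_linear ?\<Psi>'"
    using L(1,2) unfolding linear_conv_bounded_linear
    by (auto intro!: bounded_linear_Pair bounded_linear_snd bounded_linear_compose[OF _ bounded_linear_fst])
  have bij: "bij_betw ?\<Psi> N N"
    by (rule bij_betw_byWitness[of _ ?\<Psi>']) (use inv N in \<open>auto simp del: prod.collapse\<close>)
  have inveq: "inv_into N ?\<Psi> p = ?\<Psi>' p" if "p \<in> N" for p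
    by (rule inv_into_f_eq) (use bij inv N that in \<open>auto simp: bij_betw_def\<close>)
  have "smooth_map_on N ?\<Psi>"
    unfolding smooth_map_on_def using smooth_on_linear[OF bl(1), of UNIV] by blast
  moreover have "smooth_map_on N (inv_into N ?\<Psi>)"
    unfolding smooth_map_on_def
  proof
    fix p
    show "\<exists>W G. open W \<and> p \<in> W \<and> smooth_on W G \<and> (\<forall>x\<in>N \<inter> W. G x = inv_into N ?\<Psi> x)"
      using smooth_on_linear[OF bl(2), of UNIV] inveq by (intro exI[of _ UNIV] exI[of _ ?\<Psi>']) auto
  qed
  moreover have "(?\<Psi> has_derivative ?\<Psi>) (at p within N)" for p
    by (rule bounded_linear_imp_has_derivative[OF bl(1)])
  moreover have "g (?\<Psi> p) (?\<Psi> v) (?\<Psi> w) = g p v w" for p v w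
    by (simp add: static_metric_def iso)
  ultimately show ?thesis unfolding isometry_of_def using bij by blast
qed

end

lemma smooth_locally_injective:
  fixes h :: "'a::euclidean_space \<Rightarrow> 'b::euclidean_space"
  assumes "open U" "smooth_on U h" "a \<in> U" "inj (dif h a)"
  obtains r where "r > 0" "ball a r \<subseteq> U" "inj_on h (ball a r)"
proof -
  note lin = dif_linear[OF assms(2)]
  obtain G where G: "linear G" "G \<circ> dif h a = id"
    using linear_injective_left_inverse[OF lin[OF assms(3)] assms(4)] by blast
  have onorm: "\<exists>d>0. \<forall>x. dist a x < d \<longrightarrow> onorm (\<lambda>v. dif h x v - dif h a v) < e" if e: "e > 0" for e
  proof -
    define E where "E x = (\<Sum>b\<in>Basis. norm (dif h x b - dif h a b))" for x
    have "continuous_on U E" unfolding E_def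
      by (intro continuous_intros smooth_on_continuous smooth_on_dif assms)
    then have "isCont E a" using assms(1,3) by (simp add: continuous_on_eq_continuous_at)
    moreover have "E a = 0" by (simp add: E_def)
    ultimately obtain d where d: "d > 0" "\<And>x. dist x a < d \<Longrightarrow> dist (E x) 0 < e"
      using e unfolding continuous_at_eps_delta by metis
    obtain d' where d': "d' > 0" "ball a d' \<subseteq> U" using assms(1,3) openE by blast
    have "onorm (\<lambda>v. dif h x v - dif h a v) < e" if "dist a x < min d d'" for x
    proof -
      have xU: "x \<in> U" using that d' by (auto simp: subset_iff)
      have "onorm (\<lambda>v. dif h x v - dif h a v) \<le> E x"
      proof (rule onorm_bound)
        show "0 \<le> E x" by (simp add: E_def sum_nonneg)
        fix v
        have "dif h x v - dif h a v = (\<Sum>b\<in>Basis. (v \<bullet> b) *\<^sub>R (dif h x b - dif h a b))"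
          using dif_along_expand[OF assms(2) xU, of v] dif_along_expand[OF assms(2,3), of v]
          by (simp add: scaleR_diff_right sum_subtractf)
        also have "norm \<dots> \<le> (\<Sum>b\<in>Basis. norm v * norm (dif h x b - dif h a b))"
          by (intro sum_norm_le) (simp add: Basis_le_norm mult_right_mono)
        finally show "norm (dif h x v - dif h a v) \<le> E x * norm v"
          by (simp add: E_def sum_distrib_left mult.commute)
      qed
      also have "E x < e" using d(2)[of x] that by (simp add: dist_commute)
      finally show ?thesis .
    qed
    then show ?thesis using d(1) d'(1) by (intro exI[of _ "min d d'"]) auto
  qed
  show ?thesis
    using has_derivative_locally_injective[of a U G "dif h" h, OF assms(3,1) _ G(2) _ onorm]
      G(1) smooth_on_has_derivative[OF assms(2)] that
    by (metis linear_conv_bounded_linear)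
qed

context timelike_static
begin

text \<open>
  The local form of an umbilical surface differs from the model only by the frame, and frames with the
  same Gram matrix are related by a linear isometry. The height and the position on the null
  lines are coordinates of the surface near \<open>q0\<close>, in which it coincides with the model.
\<close>
theorem umbilical_imp_locally_congruent:
  assumes cm: "c = -1" and interval: "is_interval I" "z0 \<in> I"
    and T: "lightlike_T c f M \<iota>" and umb: "totally_umbilical N g M \<iota>" and k: "k \<noteq> 0"
  shows "locally_congruent N g M \<iota> (phi_domain I) (phi_surface f z0 k 0)"
  unfolding locally_congruent_def
proof
  fix p0 assume "p0 \<in> M"
  moreover have "\<forall>p\<in>M. \<exists>(U::(real^2) set) \<sigma>. local_param M \<iota> U \<sigma> \<and> p \<in> \<sigma> ` U"
    using timelike by (simp add: timelike_surface_def)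
  ultimately obtain U :: "(real^2) set" and \<sigma> where "local_param M \<iota> U \<sigma>" "p0 \<in> \<sigma> ` U"
    by blast
  then obtain q0 where lp: "local_param M \<iota> U \<sigma>" and q0: "q0 \<in> U" and p0: "p0 = \<sigma> q0" by blast
  obtain B K L n where B: "q0 \<in> B" "B \<subseteq> U"
    and nf: "null_frame c I f B (\<lambda>q. fst (\<iota> (\<sigma> q))) (\<lambda>q. snd (\<iota> (\<sigma> q))) K L n"
    using null_frame_exists[OF T umb lp q0] by metis
  let ?z = "\<lambda>q. snd (\<iota> (\<sigma> q))"
  let ?F = "F_int f z0"
  interpret nf: null_frame c I f B "\<lambda>q. fst (\<iota> (\<sigma> q))" ?z K L n by (rule nf)
  have F: "(?F has_vector_derivative 1 / f t) (at t)" if "t \<in> I" for t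
    by (rule F_int_has_derivative[OF I interval that smooth_on_continuous[OF f_smooth]])
      (use f_pos in force)
  obtain r s a b n0 n1 where r: "r > 0" "ball q0 r \<subseteq> B" and s: "smooth_on (ball q0 r) s"
    and sK: "\<And>q. q \<in> ball q0 r \<Longrightarrow> dif s q (K q) \<noteq> 0"
    and form: "\<And>q. q \<in> ball q0 r \<Longrightarrow> fst (\<iota> (\<sigma> q))
        = cos (?F (?z q)) *\<^sub>R (a + s q *\<^sub>R n0) + sin (?F (?z q)) *\<^sub>R (b + s q *\<^sub>R n1)"
    and gram: "pseudo_inner c a a = -1" "pseudo_inner c b b = -1" "pseudo_inner c a b = 0"
    "pseudo_inner c n0 n0 = 0" "pseudo_inner c n1 n1 = 0" "pseudo_inner c n0 n1 = 0"
    "pseudo_inner c a n0 = 0" "pseudo_inner c b n1 = 0"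
    "pseudo_inner c a n1 \<noteq> 0" "pseudo_inner c b n0 = - pseudo_inner c a n1"
    using nf.anti_de_sitter_form[OF cm B(1) F] by metis
  \<comment> \<open>Rescaling the null directions normalizes the only free entry of the Gram matrix.\<close>
  define \<tau> where "\<tau> = - pseudo_inner c a n1"
  have \<tau>0: "\<tau> \<noteq> 0" using gram(9) by (simp add: \<tau>_def)
  let ?m0 = "(1 / \<tau>) *\<^sub>R n0" and ?m1 = "(1 / \<tau>) *\<^sub>R n1"
  have frame: "ads_frame a b ?m0 ?m1"
    using gram \<tau>0 unfolding cm by unfold_locales (simp_all add: psi_simps \<tau>_def cm)
  let ?fa = "phi_a k" and ?fn1 = "phi_n1 k"
  note pframe = phi_frame[OF k]
  interpret P: ads_frame ?fa phi_b phi_n0 ?fn1 by (rule pframe)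
  define A where "A = frame_map a b ?m0 ?m1 ?fa phi_b phi_n0 ?fn1"
  define A' where "A' = frame_map ?fa phi_b phi_n0 ?fn1 a b ?m0 ?m1"
  note fm = frame_map_isometric[OF frame pframe, folded A_def A'_def]
  note fm' = frame_map_isometric[OF pframe frame, folded A_def A'_def]
  have lA: "linear A" "linear A'" unfolding A_def A'_def by (rule linear_frame_map)+
  define \<Psi> where "\<Psi> = (\<lambda>p :: (real^4) \<times> real. (A (fst p), snd p))"
  define \<Psi>' where "\<Psi>' = (\<lambda>p :: (real^4) \<times> real. (A' (fst p), snd p))"
  have iso: "isometry_of N g \<Psi>"
    unfolding \<Psi>_def by (rule isometry_of_linear[OF lA fm(2) fm'(2)]) (simp_all add: cm fm(1))
  have \<Psi>\<Psi>': "\<Psi>' (\<Psi> p) = p" for p by (simp add: \<Psi>_def \<Psi>'_def fm(2))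
  define \<omega> :: "real^2 \<Rightarrow> real^2" where "\<omega> q = ?z q *\<^sub>R axis 1 1 + (\<tau> * s q) *\<^sub>R axis 2 1" for q
  have \<omega>: "\<omega> q $ 1 = ?z q" "\<omega> q $ 2 = \<tau> * s q" for q by (simp_all add: \<omega>_def axis_def)
  have \<Psi>form: "\<Psi> (\<iota> (\<sigma> q)) = phi_surface f z0 k 0 (\<omega> q)" if "q \<in> ball q0 r" for q
  proof -
    have "n0 = \<tau> *\<^sub>R ?m0" "n1 = \<tau> *\<^sub>R ?m1" using \<tau>0 by simp_all
    then have An: "A n0 = \<tau> *\<^sub>R phi_n0" "A n1 = \<tau> *\<^sub>R ?fn1"
      using fm(5,6) linear_cmul[OF lA(1)] by metis+
    have "A (fst (\<iota> (\<sigma> q))) = P.px (?F (?z q)) (\<tau> * s q)"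
      unfolding form[OF that] P.px_def
      by (simp add: linear_add[OF lA(1)] linear_cmul[OF lA(1)] fm(3,4) An mult.commute)
    then show ?thesis
      by (simp add: \<Psi>_def phi_surface_ruled[OF k] \<omega>)
  qed
  have s\<omega>: "smooth_on (ball q0 r) \<omega>"
    unfolding \<omega>_def
    by (intro smooth_on_add smooth_on_scaleR smooth_on_mult smooth_on_const s open_ball
        smooth_on_subset[OF nf.smooth(2) r(2)])
  have q0r: "q0 \<in> ball q0 r" using r by simp
  have "inj (dif \<omega> q0)"
  proof (rule linear_injective_0[OF dif_linear[OF s\<omega> q0r], THEN iffD2], intro allI impI)
    fix e assume e: "dif \<omega> q0 e = 0"
    have "dif ?z q0 e = (dif \<omega> q0 e) $ 1" "\<tau> * dif s q0 e = (dif \<omega> q0 e) $ 2"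
      using dif_linear_compose[OF bounded_linear_vec_nth s\<omega> q0r, of 1 e]
        dif_linear_compose[OF bounded_linear_vec_nth s\<omega> q0r, of 2 e]
        dif_bilinear[OF bounded_bilinear_mult smooth_on_const s q0r, of \<tau> e]
      by (simp_all add: \<omega>)
    then have ze: "dif ?z q0 e = 0" and se: "dif s q0 e = 0" using e \<tau>0 by simp_all
    obtain x y where xy: "e = x *\<^sub>R K q0 + y *\<^sub>R L q0" using nf.frame_spans[OF B(1)] .
    have "y = 0"
      using ze nf.Kz[OF B(1)] nf.Lz[OF B(1)] f_pos[OF nf.z_in[OF B(1)]]
        dif_linear[OF nf.smooth(2) B(1)] by (simp add: xy linear_add linear_cmul)
    moreover from this have "x = 0"
      using se sK[OF q0r] dif_linear[OF s q0r] by (simp add: xy linear_cmul)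
    ultimately show "e = 0" by (simp add: xy)
  qed
  then obtain r' where r': "r' > 0" "ball q0 r' \<subseteq> ball q0 r" "inj_on \<omega> (ball q0 r')"
    using smooth_locally_injective[OF open_ball s\<omega> q0r] by metis
  let ?B = "ball q0 r'" and ?V = "\<omega> ` ball q0 r'"
  have cont: "continuous_on ?B \<omega>"
    using smooth_on_continuous[OF s\<omega>] r'(2) continuous_on_subset by blast
  have oV: "open ?V" by (rule invariance_of_domain[OF cont open_ball r'(3)])
  obtain \<theta> where \<theta>: "homeomorphism ?B ?V \<omega> \<theta>"
    using invariance_of_domain_homeomorphism[OF open_ball cont order_refl r'(3)] by blast
  have lpB: "local_param M \<iota> ?B \<sigma>"
    using local_param_subset[OF lp open_ball, of q0 r'] r'(2) r(2) B(2) by blast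
  then obtain \<sigma>' where \<sigma>': "homeomorphism ?B (\<sigma> ` ?B) \<sigma> \<sigma>'" and op: "openin (top_of_set M) (\<sigma> ` ?B)"
    by (auto simp: local_param_def)
  have \<theta>V: "\<theta> ` ?V = ?B" using \<theta> by (simp add: homeomorphism_def)
  have \<omega>\<theta>: "\<theta> v \<in> ?B" "\<omega> (\<theta> v) = v" if "v \<in> ?V" for v
    using \<theta> that by (auto simp: homeomorphism_def)
  have V_sub: "?V \<subseteq> phi_domain I"
    using nf.z_in r'(2) r(2) by (auto simp: phi_domain_def \<omega> subset_iff)
  interpret ph: phi_model I f ?fa phi_b phi_n0 ?fn1 ?F 0 0
  proof (intro phi_model.intro phi_model_axioms.intro pframe F)
    show "static_space_time (-1) I f" using static_space_time_axioms by (simp add: cm)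
  qed
  have phY: "phi_surface f z0 k 0 = ph.Y"
    by (rule ext) (simp add: phi_surface_ruled[OF k] ph.Y_def ph.\<Theta>_def ph.S_def)
  have form': "\<iota> (\<sigma> (\<theta> v)) = \<Psi>' (ph.Y v)" if "v \<in> ?V" for v
    using \<Psi>form[of "\<theta> v"] \<omega>\<theta>[OF that] r'(2) \<Psi>\<Psi>' unfolding phY by (metis subsetD)
  have bl\<Psi>': "bounded_linear \<Psi>'"
    unfolding \<Psi>'_def using lA(2)[unfolded linear_conv_bounded_linear]
    by (intro bounded_linear_Pair bounded_linear_snd bounded_linear_compose[OF _ bounded_linear_fst])
  have sY: "smooth_on ?V ph.Y" by (rule smooth_on_subset[OF ph.Y_smooth V_sub])
  have "local_param M \<iota> ?V (\<sigma> \<circ> \<theta>)"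
    unfolding local_param_def
  proof (intro conjI oV ballI)
    have im: "(\<sigma> \<circ> \<theta>) ` ?V = \<sigma> ` ?B" 
      unfolding image_comp[symmetric] \<theta>V ..
    show "openin (top_of_set M) ((\<sigma> \<circ> \<theta>) ` ?V)" using op im by simp
    have "homeomorphism ?V (\<sigma> ` ?B) (\<sigma> \<circ> \<theta>) (\<omega> \<circ> \<sigma>')"
      by (rule homeomorphism_compose[OF homeomorphism_symD[OF \<theta>] \<sigma>'])
    then show "\<exists>\<tau>. homeomorphism ?V ((\<sigma> \<circ> \<theta>) ` ?V) (\<sigma> \<circ> \<theta>) \<tau>" unfolding im by blast
    show "smooth_on ?V (\<iota> \<circ> (\<sigma> \<circ> \<theta>))"
      by (subst smooth_on_cong[OF oV, of _ "\<lambda>v. \<Psi>' (ph.Y v)"])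
        (use form' in \<open>auto intro: smooth_on_linear_compose[OF bl\<Psi>' oV sY]\<close>)
    fix v assume v: "v \<in> ?V"
    have "dif (\<iota> \<circ> (\<sigma> \<circ> \<theta>)) v = dif (\<lambda>v. \<Psi>' (ph.Y v)) v"
      by (rule dif_cong_open[OF oV v]) (simp add: form')
    moreover have "\<dots> = (\<lambda>e. \<Psi>' (dif ph.Y v e))"
      using dif_linear_compose[OF bl\<Psi>' sY v] by (auto simp: fun_eq_iff)
    moreover have "inj (\<lambda>e. \<Psi>' (dif ph.Y v e))"
    proof -
      have "inj \<Psi>'"
        by (rule inj_on_inverseI[of _ \<Psi>]) (simp add: \<Psi>_def \<Psi>'_def fm'(2))
      moreover have "inj (dif ph.Y v)" using ph.inj_dif_Y v V_sub by blast
      ultimately have "inj (\<Psi>' \<circ> dif ph.Y v)" by (rule inj_compose)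
      then show ?thesis by (simp add: o_def)
    qed
    ultimately show "inj (dif (\<iota> \<circ> (\<sigma> \<circ> \<theta>)) v)" by simp
  qed
  moreover have "p0 \<in> (\<sigma> \<circ> \<theta>) ` ?V"
  proof -
    have "q0 \<in> ?B" using r' by simp
    then have "q0 \<in> \<theta> ` ?V" using \<theta>V by simp
    then show ?thesis unfolding p0 image_comp[symmetric] by (rule imageI)
  qed
  moreover have "\<forall>v\<in>?V. \<Psi> (\<iota> ((\<sigma> \<circ> \<theta>) v)) = phi_surface f z0 k 0 v"
    using \<Psi>form \<omega>\<theta> r'(2) by (metis comp_apply subsetD)
  ultimately show "\<exists>\<Psi> U \<sigma>. isometry_of N g \<Psi> \<and> local_param M \<iota> U \<sigma> \<and> p0 \<in> \<sigma> ` U \<and>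
       U \<subseteq> phi_domain I \<and> (\<forall>q\<in>U. \<Psi> (\<iota> (\<sigma> q)) = phi_surface f z0 k 0 q)"
    using iso V_sub by blast
qed

end

section \<open>Flatness of the ruled surface\<close>

lemma tangent_space_open:
  fixes q :: "'a::real_normed_vector"
  assumes "open U" "q \<in> U" shows "tangent_space U q = UNIV"
proof (intro equalityI subset_UNIV subsetI)
  fix v :: 'a
  have "open ((\<lambda>t. q + t *\<^sub>R v) -` U)"
    by (rule open_vimage[OF assms(1)]) (intro continuous_intros)
  moreover have "0 \<in> (\<lambda>t. q + t *\<^sub>R v) -` U" using assms(2) by simp
  ultimately have "\<forall>\<^sub>F t in nhds 0. q + t *\<^sub>R v \<in> U"
    unfolding eventually_nhds by (intro exI[of _ "(\<lambda>t. q + t *\<^sub>R v) -` U"]) auto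
  moreover have "((\<lambda>t. q + t *\<^sub>R v) has_vector_derivative v) (at 0)"
    unfolding has_vector_derivative_def by (auto intro!: derivative_eq_intros)
  ultimately show "v \<in> tangent_space U q"
    unfolding tangent_space_def by (intro CollectI exI[of _ "\<lambda>t. q + t *\<^sub>R v"]) simp
qed

context phi_model
begin

text \<open>The only nonzero Christoffel symbol of the metric \<open>2 f(u) du dv\<close>.\<close>
definition \<gamma> :: "real \<Rightarrow> real" where "\<gamma> t = dif f t 1 / f t"

lemma Y_christoffel:
  assumes q: "q \<in> D"
  shows "cov_deriv D (induced_metric g Y) (\<lambda>q. q) V e q
    = dif V q e + (\<gamma> (q$1) * e$1 * V q $ 1) *\<^sub>R axis 1 1"
proof -
  let ?h = "induced_metric g Y"
  have fz: "f (q$1) > 0" "q$1 \<in> I" using f_pos q by (auto simp: phi_domain_def)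
  have h: "?h r u v = f (r$1) * (u$1 * v$2 + u$2 * v$1)" if "r \<in> D" for r u v
    by (simp add: induced_metric_def Y_induced[OF that])
  have md: "metric_deriv ?h q W u v = dif f (q$1) 1 * W$1 * (u$1 * v$2 + u$2 * v$1)" for W u v
  proof -
    have "((\<lambda>r. f (r$1)) has_derivative (\<lambda>e. dif f (q$1) (e$1))) (at q)"
      by (rule has_derivative_compose[OF bounded_linear_imp_has_derivative[OF bounded_linear_vec_nth]
            smooth_on_has_derivative[OF f_smooth fz(2)]])
    then have "((\<lambda>r. f (r$1) * (u$1 * v$2 + u$2 * v$1)) has_derivative
        (\<lambda>e. dif f (q$1) (e$1) * (u$1 * v$2 + u$2 * v$1))) (at q)"
      by (rule has_derivative_mult_left)
    from dif_eqI[OF this]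
    have "dif (\<lambda>r. ?h r u v) q W = dif f (q$1) (W$1) * (u$1 * v$2 + u$2 * v$1)"
      using dif_cong_open[OF open_D q, of "\<lambda>r. ?h r u v" "\<lambda>r. f (r$1) * (u$1 * v$2 + u$2 * v$1)"] h by simp
    moreover have "dif f (q$1) (W$1) = W$1 * dif f (q$1) 1"
      using linear_cmul[OF dif_linear[OF f_smooth fz(2)], of "W$1" 1] by simp
    ultimately show ?thesis by (simp add: metric_deriv_def)
  qed
  let ?W = "dif V q e + (\<gamma> (q$1) * e$1 * V q $ 1) *\<^sub>R axis 1 1"
  let ?P = "\<lambda>W. W \<in> UNIV \<and> (\<forall>Z\<in>UNIV. ?h q W Z = ?h q (dif V q e) Z
      + (metric_deriv ?h q e (V q) Z + metric_deriv ?h q (V q) e Z - metric_deriv ?h q Z e (V q)) / 2)"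
  have P: "?P ?W"
    using fz by (simp add: h[OF q] md \<gamma>_def axis_def field_simps)
  have "W = ?W" if "?P W" for W
  proof -
    have "?h q W Z = ?h q ?W Z" for Z using that P by simp
    from this[of "axis 2 1"] this[of "axis 1 1"] have "W$1 = ?W$1" "W$2 = ?W$2"
      using fz by (simp_all add: h[OF q] axis_def)
    then show ?thesis by (simp add: vec_eq_iff forall_2)
  qed
  then have "(THE W. ?P W) = ?W" using the_equality[of ?P, OF P] by blast
  then show ?thesis
    unfolding cov_deriv_def tangent_space_open[OF open_D q] by simp
qed

text \<open>
  Both orders of differentiation give the same expression: the second derivatives of \<open>V\<close> commute, and
  the terms with the Christoffel symbol are symmetric in the two directions.
\<close>
theorem Y_flat: "flat_surface N g D Y"
  unfolding flat_surface_def Let_def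
proof (intro conjI ballI allI impI)
  show "smooth_on D Y" by (rule Y_smooth)
  show "Y ` D \<subseteq> N" using Y_in_N by auto
  show "inj (dif Y q)" if "q \<in> D" for q by (rule inj_dif_Y[OF that])
  show "a = 0" if "q \<in> D" "\<forall>b. induced_metric g Y q a b = 0" for q a
    using Y_nondegenerate[OF that(1)] that(2) by (simp add: induced_metric_def)
next
  fix V :: "real^2 \<Rightarrow> real^2" and q u v
  assume V: "smooth_on D V" and q: "q \<in> D"
  let ?cov = "\<lambda>V e. cov_deriv D (induced_metric g Y) (\<lambda>q. q) V e"
  have qI: "q$1 \<in> I" using q by (simp add: phi_domain_def)
  have s\<gamma>: "smooth_on I \<gamma>" unfolding \<gamma>_def
    by (intro smooth_on_divide[OF I] smooth_on_dif f_smooth f_pos[THEN less_imp_neq, THEN not_sym])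
  have s1: "smooth_on D (\<lambda>r. r$1)" by (rule smooth_on_linear) (rule bounded_linear_vec_nth)
  have s\<Gamma>: "smooth_on D (\<lambda>r. \<gamma> (r$1))"
    by (rule smooth_on_compose[OF open_D I _ s\<gamma> s1]) (auto simp: phi_domain_def)
  have sV1: "smooth_on D (\<lambda>r. V r $ 1)" by (rule smooth_on_vec_nth[OF open_D V])
  have d\<Gamma>: "dif (\<lambda>r. \<gamma> (r$1)) q w = w$1 * dif \<gamma> (q$1) 1" for w
  proof -
    have "dif (\<lambda>r. \<gamma> (r$1)) q w = dif \<gamma> (q$1) (dif (\<lambda>r. r$1) q w)"
      by (rule dif_compose[OF s1 q smooth_on_differentiable[OF s\<gamma> qI]])
    also have "dif (\<lambda>r. r$1) q = (\<lambda>w. w$1)"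
      by (intro dif_eqI bounded_linear_imp_has_derivative bounded_linear_vec_nth)
    also have "dif \<gamma> (q$1) (w$1) = w$1 * dif \<gamma> (q$1) 1"
      using linear_cmul[OF dif_linear[OF s\<gamma> qI], of "w$1" 1] by simp
    finally show ?thesis .
  qed
  have dV1: "dif (\<lambda>r. V r $ 1) q w = dif V q w $ 1" for w
    by (rule dif_linear_compose[OF bounded_linear_vec_nth V q])
  have second: "?cov (?cov V b) a q = dif (\<lambda>r. dif V r b) q a
      + (a$1 * b$1 * dif \<gamma> (q$1) 1 * V q $ 1 + \<gamma> (q$1) * (b$1 * dif V q a $ 1 + a$1 * dif V q b $ 1)
         + \<gamma> (q$1) * \<gamma> (q$1) * a$1 * b$1 * V q $ 1) *\<^sub>R axis 1 1" for a b
  proof -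
    have sp: "smooth_on D (\<lambda>r. \<gamma> (r$1) * V r $ 1)" by (intro smooth_on_mult open_D s\<Gamma> sV1)
    have sq: "smooth_on D (\<lambda>r. (\<gamma> (r$1) * V r $ 1) *\<^sub>R (b$1 *\<^sub>R axis 1 1 :: real^2))"
      by (intro smooth_on_scaleR open_D sp smooth_on_const)
    have "dif (?cov V b) q a = dif (\<lambda>r. dif V r b + (\<gamma> (r$1) * V r $ 1) *\<^sub>R (b$1 *\<^sub>R axis 1 1)) q a"
      using dif_cong_open[OF open_D q, of "?cov V b" "\<lambda>r. dif V r b + (\<gamma> (r$1) * V r $ 1) *\<^sub>R (b$1 *\<^sub>R axis 1 1)"]
      by (simp add: Y_christoffel mult_ac)
    also have "\<dots> = dif (\<lambda>r. dif V r b) q a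
        + (\<gamma> (q$1) * dif V q a $ 1 + a$1 * dif \<gamma> (q$1) 1 * V q $ 1) *\<^sub>R (b$1 *\<^sub>R axis 1 1)"
      unfolding dif_add[OF smooth_on_dif[OF V] sq q] dif_scaleR[OF sp smooth_on_const q]
        dif_bilinear[OF bounded_bilinear_mult s\<Gamma> sV1 q] d\<Gamma> dV1 by simp
    finally show ?thesis
      unfolding Y_christoffel[OF q]
      by (simp add: Y_christoffel[OF q] vec_eq_iff axis_def algebra_simps)
  qed
  show "?cov (?cov V v) u q = ?cov (?cov V u) v q"
    unfolding second using Clairaut[OF open_D V q, of u v] by (simp add: algebra_simps)
qed

end

section \<open>Isometries preserve null geodesics\<close>

text \<open>
  A linear left inverse of the derivative of \<open>X\<close> turns the increment of \<open>X\<close> into the increment of \<open>h\<close> up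
  to a small multiple of the latter, which is absorbed. Changes of parameters between two immersed
  parametrizations are differentiable for this reason.
\<close>
lemma immersion_lift_differentiable:
  fixes X :: "'a::euclidean_space \<Rightarrow> 'c::euclidean_space" and h :: "'b::euclidean_space \<Rightarrow> 'a"
  assumes X: "(X has_derivative X') (at (h q))" and inj: "inj X'"
    and Y: "((\<lambda>r. X (h r)) has_derivative Y') (at q)" and cont: "isCont h q"
  obtains h' where "(h has_derivative h') (at q)" "\<And>e. X' (h' e) = Y' e"
proof -
  have lX: "linear X'" and bY: "bounded_linear Y'"
    using X Y has_derivative_linear has_derivative_bounded_linear by blast+
  obtain G where G: "linear G" "G \<circ> X' = id"
    using linear_injective_left_inverse[OF lX inj] by blast
  then have GX: "G (X' v) = v" for v by (metis comp_apply id_apply)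
  have bG: "bounded_linear G" using G(1) by (simp add: linear_conv_bounded_linear)
  obtain b where b: "b > 0" "\<And>v. norm (G v) \<le> norm v * b" using bounded_linear.pos_bounded[OF bG] by blast
  have bGY: "bounded_linear (\<lambda>e. G (Y' e))" by (rule bounded_linear_compose[OF bG bY])
  obtain k where k: "k > 0" "\<And>v. norm (G (Y' v)) \<le> norm v * k" using bounded_linear.pos_bounded[OF bGY] by blast
  have "(h has_derivative (\<lambda>e. G (Y' e))) (at q)"
    unfolding has_derivative_at_alt
  proof (intro conjI allI impI bGY)
    fix \<epsilon> :: real assume \<epsilon>: "\<epsilon> > 0"
    define m where "m = 2 * k + 2"
    have m: "m > 0" using k(1) by (simp add: m_def)
    \<comment> \<open>The first bound absorbs the increment of \<open>h\<close> on the left, the second gives the final estimate.\<close>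
    define \<delta> where "\<delta> = min (1 / (2 * b)) (\<epsilon> / (b * m))"
    have \<delta>: "\<delta> > 0" using b m \<epsilon> by (simp add: \<delta>_def)
    have \<delta>1: "b * \<delta> \<le> 1 / 2"
    proof -
      have "b * \<delta> \<le> b * (1 / (2 * b))" using b(1) by (intro mult_left_mono) (auto simp: \<delta>_def)
      then show ?thesis using b(1) by simp
    qed
    have \<delta>2: "b * \<delta> * m \<le> \<epsilon>"
    proof -
      have "b * \<delta> * m \<le> b * (\<epsilon> / (b * m)) * m"
        using b(1) m by (intro mult_right_mono mult_left_mono) (auto simp: \<delta>_def)
      also have "\<dots> = \<epsilon>" using b(1) m by simp
      finally show ?thesis .
    qed
    obtain d1 where d1: "d1 > 0" "\<And>p. norm (p - h q) < d1 \<Longrightarrow> norm (X p - X (h q) - X' (p - h q)) \<le> \<delta> * norm (p - h q)"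
      using X \<delta> unfolding has_derivative_at_alt by metis
    obtain d2 where d2: "d2 > 0" "\<And>r. norm (r - q) < d2 \<Longrightarrow> norm (X (h r) - X (h q) - Y' (r - q)) \<le> \<delta> * norm (r - q)"
      using Y \<delta> unfolding has_derivative_at_alt by metis
    obtain d3 where d3: "d3 > 0" "\<And>r. norm (r - q) < d3 \<Longrightarrow> norm (h r - h q) < d1"
      using cont d1(1) unfolding continuous_at_eps_delta dist_norm by metis
    have "norm (h r - h q - G (Y' (r - q))) \<le> \<epsilon> * norm (r - q)" if r: "norm (r - q) < min d2 d3" for r
    proof -
      let ?R1 = "X (h r) - X (h q) - X' (h r - h q)" and ?R2 = "X (h r) - X (h q) - Y' (r - q)"
      let ?H = "norm (h r - h q)" and ?n = "norm (r - q)"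
      have R1: "norm ?R1 \<le> \<delta> * ?H" using d1(2) d3(2) r by simp
      have R2: "norm ?R2 \<le> \<delta> * ?n" using d2(2) r by simp
      have "?R2 - ?R1 = X' (h r - h q) - Y' (r - q)" by simp
      then have "G (?R2 - ?R1) = h r - h q - G (Y' (r - q))"
        using linear_diff[OF G(1), of "X' (h r - h q)" "Y' (r - q)"] GX by simp
      then have "norm (h r - h q - G (Y' (r - q))) \<le> norm (?R2 - ?R1) * b" using b(2) by metis
      also have "\<dots> \<le> (\<delta> * ?n + \<delta> * ?H) * b"
        using b(1) R1 R2 norm_triangle_ineq4[of ?R2 ?R1] by (intro mult_right_mono) auto
      finally have 1: "norm (h r - h q - G (Y' (r - q))) \<le> (b * \<delta>) * ?n + (b * \<delta>) * ?H"
        by (simp add: algebra_simps)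
      have "?H \<le> norm (h r - h q - G (Y' (r - q))) + norm (G (Y' (r - q)))"
        using norm_triangle_sub[of "h r - h q" "G (Y' (r - q))"] by linarith
      also have "\<dots> \<le> (b * \<delta>) * ?n + (b * \<delta>) * ?H + ?n * k" using 1 k(2)[of "r - q"] by linarith
      also have "\<dots> \<le> 1 / 2 * ?n + 1 / 2 * ?H + ?n * k"
        using mult_right_mono[OF \<delta>1, of ?n] mult_right_mono[OF \<delta>1, of ?H] by simp
      finally have "?H \<le> (2 * k + 1) * ?n" by (simp add: algebra_simps)
      then have "(b * \<delta>) * ?H \<le> (b * \<delta>) * ((2 * k + 1) * ?n)" using b(1) \<delta> by (intro mult_left_mono) auto
      with 1 have "norm (h r - h q - G (Y' (r - q))) \<le> (b * \<delta> * m) * ?n"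
        by (simp add: m_def algebra_simps)
      also have "\<dots> \<le> \<epsilon> * ?n" using \<delta>2 by (intro mult_right_mono) auto
      finally show ?thesis .
    qed
    then show "\<exists>d>0. \<forall>r. norm (r - q) < d \<longrightarrow> norm (h r - h q - G (Y' (r - q))) \<le> \<epsilon> * norm (r - q)"
      using d2(1) d3(1) by (intro exI[of _ "min d2 d3"]) auto
  qed
  note hd = this
  moreover have "(\<lambda>e. X' (G (Y' e))) = Y'"
    by (rule has_derivative_unique[OF has_derivative_compose[OF hd X] Y])
  then have "X' (G (Y' e)) = Y' e" for e by metis
  ultimately show ?thesis using that by blast
qed

text \<open>
  In a two-parameter family the Koszul expression of a curve depends on the induced metric only; this
  makes its invariance under isometries evident.
\<close>
lemma koszul_variation:
  fixes h :: "'b::euclidean_space \<Rightarrow> (real^4) \<times> real"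
  assumes "open W" "smooth_on W h" "w \<in> W" and f: "f differentiable (at (snd (h w)))"
  shows "koszul c f (h w) (dif h w e) (dif h w e) (dif (\<lambda>r. dif h r e) w e) (dif h w u)
    = dif (\<lambda>r. static_metric c f (h r) (dif h r e) (dif h r u)) w e
      - dif (\<lambda>r. static_metric c f (h r) (dif h r e) (dif h r e)) w u / 2"
proof -
  note h = smooth_on_has_derivative[OF assms(2,3)]
  note he = smooth_on_has_derivative[OF smooth_on_dif[OF assms(2)] assms(3)]
  note d = static_metric_has_derivative[OF h he he f, THEN dif_eqI]
  show ?thesis
    unfolding d koszul_def Clairaut[OF assms(1-3), of u e]
    by (simp add: static_metric_commute[of c f _ "dif (\<lambda>r. dif h r e) w u" "dif h w e"] field_simps)
qed

lemma line_derivative: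
  fixes h :: "'b::euclidean_space \<Rightarrow> 'a::real_normed_vector"
  assumes "smooth_on U h" "p \<in> U"
  shows "((\<lambda>t. h (p + t *\<^sub>R v)) has_vector_derivative dif h p v) (at 0)"
proof -
  have "((\<lambda>t::real. p + t *\<^sub>R v) has_derivative (\<lambda>t. t *\<^sub>R v)) (at 0)"
    by (auto intro!: derivative_eq_intros)
  moreover have "(h has_derivative dif h p) (at (p + 0 *\<^sub>R v))"
    using smooth_on_has_derivative[OF assms] by simp
  ultimately have "((\<lambda>t. h (p + t *\<^sub>R v)) has_derivative (\<lambda>t. dif h p (t *\<^sub>R v))) (at 0)"
    by (rule has_derivative_compose)
  then show ?thesis
    unfolding has_vector_derivative_def by (simp add: linear_cmul[OF dif_linear[OF assms]])
qed

lemma line_derivative_eq: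
  fixes h :: "'b::euclidean_space \<Rightarrow> 'a::real_normed_vector" and k :: "'c::euclidean_space \<Rightarrow> 'a"
  assumes "smooth_on U h" "p \<in> U" "smooth_on V k" "q \<in> V"
    and "open S" "0 \<in> S" "\<And>t. t \<in> S \<Longrightarrow> h (p + t *\<^sub>R v) = k (q + t *\<^sub>R w)"
  shows "dif h p v = dif k q w"
proof -
  have "((\<lambda>t. k (q + t *\<^sub>R w)) has_vector_derivative dif h p v) (at 0)"
    by (rule has_vector_derivative_transform_within_open[OF line_derivative[OF assms(1,2)] assms(5,6)])
      (rule assms(7))
  then show ?thesis
    using line_derivative[OF assms(3,4)] by (rule vector_derivative_unique_at)
qed

lemma line_second_derivative_eq:
  fixes h :: "'b::euclidean_space \<Rightarrow> 'a::real_normed_vector" and k :: "'c::euclidean_space \<Rightarrow> 'a"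
  assumes h: "open U" "smooth_on U h" "p \<in> U" and k: "open V" "smooth_on V k" "q \<in> V"
    and S: "open S" "0 \<in> S" "\<And>t. t \<in> S \<Longrightarrow> h (p + t *\<^sub>R v) = k (q + t *\<^sub>R w)"
  shows "dif h p v = dif k q w" "dif (\<lambda>r. dif h r v) p v = dif (\<lambda>r. dif k r w) q w"
proof -
  let ?S = "S \<inter> ((\<lambda>t. p + t *\<^sub>R v) -` U \<inter> (\<lambda>t. q + t *\<^sub>R w) -` V)"
  have oS: "open ?S"
    by (intro open_Int S(1) open_vimage[OF h(1)] open_vimage[OF k(1)]) (intro continuous_intros)+
  have 0: "0 \<in> ?S" using S(2) h(3) k(3) by simp
  have eq: "dif h (p + t *\<^sub>R v) v = dif k (q + t *\<^sub>R w) w" if t: "t \<in> ?S" for t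
  proof (rule line_derivative_eq[OF h(2) _ k(2)])
    show "p + t *\<^sub>R v \<in> U" "q + t *\<^sub>R w \<in> V" using t by auto
    show "open ((\<lambda>r. t + r) -` S)" by (rule open_vimage[OF S(1)]) (intro continuous_intros)
    show "0 \<in> (\<lambda>r. t + r) -` S" using t by simp
    show "h (p + t *\<^sub>R v + r *\<^sub>R v) = k (q + t *\<^sub>R w + r *\<^sub>R w)" if "r \<in> (\<lambda>r. t + r) -` S" for r
      using S(3)[of "t + r"] that by (simp add: scaleR_left_distrib add.assoc)
  qed
  show "dif h p v = dif k q w" using eq[OF 0] by simp
  show "dif (\<lambda>r. dif h r v) p v = dif (\<lambda>r. dif k r w) q w"
    by (rule line_derivative_eq[OF smooth_on_dif[OF h(2)] h(3) smooth_on_dif[OF k(2)] k(3) oS 0 eq])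
qed

context static_space_time
begin

text \<open>
  Smooth extendability makes \<open>\<Psi> \<circ> h\<close> smooth, and the derivative of \<open>\<Psi>\<close> within \<open>N\<close> can be applied to
  \<open>h\<close> because \<open>h\<close> stays in \<open>N\<close>.
\<close>
lemma isometry_composition:
  fixes h :: "real^2 \<Rightarrow> (real^4) \<times> real"
  assumes iso: "isometry_of N g \<Psi>" and h: "open W" "smooth_on W h" "h ` W \<subseteq> N" "w \<in> W"
  obtains W' where "open W'" "w \<in> W'" "W' \<subseteq> W" "smooth_on W' (\<lambda>r. \<Psi> (h r))" "(\<lambda>r. \<Psi> (h r)) ` W' \<subseteq> N"
    "\<And>r e e'. r \<in> W' \<Longrightarrow> g (\<Psi> (h r)) (dif (\<lambda>r. \<Psi> (h r)) r e) (dif (\<lambda>r. \<Psi> (h r)) r e')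
      = g (h r) (dif h r e) (dif h r e')"
proof -
  have "h w \<in> N" using h by auto
  moreover have "smooth_map_on N \<Psi>" using iso by (simp add: isometry_of_def)
  ultimately have "\<exists>W G. open W \<and> h w \<in> W \<and> smooth_on W G \<and> (\<forall>x\<in>N \<inter> W. G x = \<Psi> x)"
    unfolding smooth_map_on_def by blast
  then obtain W0 G where G: "open W0" "h w \<in> W0" "smooth_on W0 G" "\<And>x. x \<in> N \<inter> W0 \<Longrightarrow> G x = \<Psi> x"
    by blast
  define W' where "W' = W \<inter> h -` W0"
  have oW': "open W'" unfolding W'_def
    by (rule continuous_open_preimage[OF smooth_on_continuous[OF h(2)] h(1) G(1)])
  have sub: "W' \<subseteq> W" by (auto simp: W'_def)
  have "smooth_on W' (\<lambda>r. G (h r))"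
    by (rule smooth_on_compose[OF oW' G(1) _ G(3) smooth_on_subset[OF h(2) sub]]) (auto simp: W'_def)
  moreover have "G (h r) = \<Psi> (h r)" if "r \<in> W'" for r
    by (rule G(4)) (use h(3) that in \<open>auto simp: W'_def\<close>)
  ultimately have "smooth_on W' (\<lambda>r. \<Psi> (h r))"
    using smooth_on_cong[OF oW', of "\<lambda>r. G (h r)" "\<lambda>r. \<Psi> (h r)"] by simp
  moreover have "\<Psi> ` N = N" using iso by (simp add: isometry_of_def bij_betw_def)
  then have "(\<lambda>r. \<Psi> (h r)) ` W' \<subseteq> N" using h(3) sub by blast
  moreover have "g (\<Psi> (h r)) (dif (\<lambda>r. \<Psi> (h r)) r e) (dif (\<lambda>r. \<Psi> (h r)) r e')
      = g (h r) (dif h r e) (dif h r e')" if r: "r \<in> W'" for r e e'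
  proof -
    have rW: "r \<in> W" and hN: "h r \<in> N" using r sub h(3) by auto
    have "\<forall>p\<in>N. \<exists>\<Psi>'. (\<Psi> has_derivative \<Psi>') (at p within N) \<and>
       (\<forall>v\<in>tangent_space N p. \<forall>w\<in>tangent_space N p. g (\<Psi> p) (\<Psi>' v) (\<Psi>' w) = g p v w)"
      using iso by (simp add: isometry_of_def)
    from bspec[OF this hN] obtain \<Psi>' where \<Psi>': "(\<Psi> has_derivative \<Psi>') (at (h r) within N)"
      "\<And>v w. v \<in> tangent_space N (h r) \<Longrightarrow> w \<in> tangent_space N (h r) \<Longrightarrow> g (\<Psi> (h r)) (\<Psi>' v) (\<Psi>' w) = g (h r) v w"
      by blast
    have "(h has_derivative dif h r) (at r within W)"
      by (rule has_derivative_at_withinI[OF smooth_on_has_derivative[OF h(2) rW]])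
    moreover have "(\<Psi> has_derivative \<Psi>') (at (h r) within h ` W)"
      by (rule has_derivative_subset[OF \<Psi>'(1) h(3)])
    ultimately have "((\<Psi> \<circ> h) has_derivative (\<Psi>' \<circ> dif h r)) (at r within W)"
      by (rule diff_chain_within)
    then have "((\<lambda>r. \<Psi> (h r)) has_derivative (\<lambda>e. \<Psi>' (dif h r e))) (at r)"
      using at_within_open[OF rW h(1)] by (simp add: o_def)
    from dif_eqI[OF this] show ?thesis
      using \<Psi>'(2)[OF dif_tangent[OF h(1,2) rW h(3)] dif_tangent[OF h(1,2) rW h(3)]] by simp
  qed
  moreover have "w \<in> W'" using h(4) G(2) by (simp add: W'_def)
  ultimately show ?thesis using that[OF oW' _ sub] by blast
qed

text \<open>
  The first parameter runs through a line of \<open>Y\<close>, the second moves in the space form and the interval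
  in the direction of a tangent field that extends \<open>Z\<close> along this line by projection.
\<close>
lemma variation_exists:
  fixes Y :: "real^2 \<Rightarrow> (real^4) \<times> real"
  assumes Y: "open U" "smooth_on U Y" "Y ` U \<subseteq> N" "q \<in> U"
    and Z: "pseudo_inner c (fst Z) (nvec c (fst (Y q))) = 0"
  obtains W and h :: "real^2 \<Rightarrow> (real^4) \<times> real" where "open W" "0 \<in> W" "smooth_on W h" "h ` W \<subseteq> N"
    "\<And>t. h (t *\<^sub>R axis 1 1) = Y (q + t *\<^sub>R e)" "dif h 0 (axis 2 1) = Z"
proof -
  define \<beta> where "\<beta> r = q + r$1 *\<^sub>R e" for r :: "real^2"
  define x where "x r = fst (Y (\<beta> r))" for r
  define \<zeta> where "\<zeta> r = tproj c (x r) (fst Z)" for r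
  define h where "h r = (sf_move c (x r) (\<zeta> r) (r$2), snd (Y (\<beta> r)) + r$2 * snd Z)" for r :: "real^2"
  let ?den = "\<lambda>r. 1 + c * (r$2)\<^sup>2 * pseudo_inner c (\<zeta> r) (\<zeta> r) / 4"
  define W0 where "W0 = \<beta> -` U"
  have s: "smooth_on V (\<lambda>r :: real^2. r $ i)" for V i by (rule smooth_on_linear) (rule bounded_linear_vec_nth)
  have s\<beta>: "smooth_on V \<beta>" if "open V" for V
    unfolding \<beta>_def[abs_def] by (intro smooth_on_add smooth_on_scaleR smooth_on_const s that)
  have oW0: "open W0" unfolding W0_def \<beta>_def
    by (rule open_vimage[OF Y(1)]) (intro continuous_intros)
  have sY: "smooth_on W0 (\<lambda>r. Y (\<beta> r))"
    by (rule smooth_on_compose[OF oW0 Y(1) _ Y(2) s\<beta>[OF oW0]]) (auto simp: W0_def)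
  have sx: "smooth_on W0 x" unfolding x_def by (rule smooth_on_fst[OF oW0 sY])
  have s\<zeta>: "smooth_on W0 \<zeta>" unfolding \<zeta>_def tproj_def
    by (intro smooth_on_diff smooth_on_scaleR smooth_on_mult smooth_on_psi smooth_on_const smooth_on_nvec oW0 sx)
  have sden: "smooth_on W0 ?den"
    by (intro smooth_on_add smooth_on_divide smooth_on_mult smooth_on_power smooth_on_psi smooth_on_const s oW0 s\<zeta>) simp
  define W1 where "W1 = W0 \<inter> ?den -` (- {0})"
  have oW1: "open W1" unfolding W1_def
    by (intro continuous_open_preimage smooth_on_continuous sden oW0) auto
  have sh: "smooth_on W1 h"
  proof -
    have sub: "W1 \<subseteq> W0" by (auto simp: W1_def)
    note S = smooth_on_subset[OF _ sub]
    show ?thesis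
      unfolding h_def sf_move_def
      by (intro smooth_on_Pair smooth_on_scaleR smooth_on_divide smooth_on_diff smooth_on_add smooth_on_mult
          smooth_on_power smooth_on_psi smooth_on_const s oW1 S[OF s\<zeta>] S[OF sx] smooth_on_snd S[OF sY])
        (auto simp: W1_def)
  qed
  define W where "W = W1 \<inter> (\<lambda>r. snd (h r)) -` I"
  have oW: "open W" unfolding W_def
    by (intro continuous_open_preimage smooth_on_continuous smooth_on_snd oW1 sh I)
  have Y_in: "Y (\<beta> r) \<in> N" if "r \<in> W0" for r using that Y(3) by (auto simp: W0_def)
  have hN: "h r \<in> N" if "r \<in> W" for r
  proof -
    have r: "r \<in> W0" "?den r \<noteq> 0" "snd (h r) \<in> I" using that by (auto simp: W_def W1_def)
    have x: "x r \<in> space_form c" using in_N_D(3)[OF Y_in[OF r(1)]] by (simp add: x_def)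
    have "sf_move c (x r) (\<zeta> r) (r$2) \<in> space_form c"
      by (rule sf_move_in_space_form[OF c x _ r(2)]) (simp add: \<zeta>_def tproj_orthogonal[OF c x])
    then show ?thesis using r(3) by (simp add: h_def static_space_def)
  qed
  have \<beta>0: "\<beta> 0 = q" by (simp add: \<beta>_def)
  have "0 \<in> W0" using Y(4) by (simp add: W0_def \<beta>0)
  then have "0 \<in> W1" by (simp add: W1_def)
  moreover have "snd (h 0) \<in> I"
    using in_N_D(4)[OF Y_in[OF \<open>0 \<in> W0\<close>]] by (simp add: h_def)
  ultimately have 0: "0 \<in> W" by (simp add: W_def)
  have hY: "h (t *\<^sub>R axis 1 1) = Y (q + t *\<^sub>R e)" for t
    by (simp add: h_def sf_move_def x_def \<beta>_def axis_def)
  have "dif h 0 (axis 2 1) = Z"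
  proof -
    have h2: "h (0 + s *\<^sub>R axis 2 1) = (sf_move c (fst (Y q)) (fst Z) s, snd (Y q) + s * snd Z)" for s
      by (simp add: h_def \<zeta>_def x_def \<beta>_def axis_def tproj_tangent[OF Z])
    have "((\<lambda>s. (sf_move c (fst (Y q)) (fst Z) s, snd (Y q) + s * snd Z)) has_vector_derivative (fst Z, snd Z)) (at 0)"
      by (intro has_vector_derivative_Pair sf_move_has_derivative)
        (auto intro!: derivative_eq_intros simp: has_vector_derivative_def)
    moreover have "((\<lambda>s. h (0 + s *\<^sub>R axis 2 1)) has_vector_derivative dif h 0 (axis 2 1)) (at 0)"
      by (rule line_derivative[OF sh \<open>0 \<in> W1\<close>])
    ultimately show ?thesis unfolding h2 using vector_derivative_unique_at by fastforce
  qed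
  moreover have "smooth_on W h" by (rule smooth_on_subset[OF sh]) (auto simp: W_def)
  ultimately show ?thesis using that[of W h] oW 0 hN hY by auto
qed

lemma isometry_koszul:
  fixes Y \<Phi> :: "real^2 \<Rightarrow> (real^4) \<times> real"
  assumes iso: "isometry_of N g \<Psi>"
    and Y: "open U" "smooth_on U Y" "Y ` U \<subseteq> N" "q \<in> U"
    and \<Phi>: "smooth_on U \<Phi>" "\<And>r. r \<in> U \<Longrightarrow> \<Psi> (Y r) = \<Phi> r"
    and Z: "Z \<in> tangent_space N (Y q)"
  obtains Z' where "Z' \<in> tangent_space N (\<Phi> q)"
    "g (\<Phi> q) (dif \<Phi> q e) Z' = g (Y q) (dif Y q e) Z"
    "koszul c f (\<Phi> q) (dif \<Phi> q e) (dif \<Phi> q e) (dif (\<lambda>r. dif \<Phi> r e) q e) Z'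
      = koszul c f (Y q) (dif Y q e) (dif Y q e) (dif (\<lambda>r. dif Y r e) q e) Z"
proof -
  have YN: "Y q \<in> N" using Y by auto
  have Zt: "pseudo_inner c (fst Z) (nvec c (fst (Y q))) = 0" using Z tangent_N[OF YN] by simp
  obtain W and h :: "real^2 \<Rightarrow> (real^4) \<times> real" where W: "open W" "0 \<in> W" "smooth_on W h" "h ` W \<subseteq> N"
    and hY: "\<And>t. h (t *\<^sub>R axis 1 1) = Y (q + t *\<^sub>R e)" and hZ: "dif h 0 (axis 2 1) = Z"
    using variation_exists[OF Y Zt, of e] by metis
  obtain W' where W': "open W'" "0 \<in> W'" "W' \<subseteq> W" "smooth_on W' (\<lambda>r. \<Psi> (h r))" "(\<lambda>r. \<Psi> (h r)) ` W' \<subseteq> N"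
    and iso_eq: "\<And>r u v. r \<in> W' \<Longrightarrow> g (\<Psi> (h r)) (dif (\<lambda>r. \<Psi> (h r)) r u) (dif (\<lambda>r. \<Psi> (h r)) r v)
      = g (h r) (dif h r u) (dif h r v)"
    using isometry_composition[OF iso W(1,3,4,2)] by metis
  let ?k = "\<lambda>r. \<Psi> (h r)"
  have h0: "h 0 = Y q" using hY[of 0] by simp
  have k0: "?k 0 = \<Phi> q" using h0 \<Phi>(2)[OF Y(4)] by simp
  have sh: "smooth_on W' h" by (rule smooth_on_subset[OF W(3) W'(3)])
  let ?a = "axis 1 1 :: real^2" and ?b = "axis 2 1 :: real^2"
  have h1: "dif h 0 ?a = dif Y q e" "dif (\<lambda>r. dif h r ?a) 0 ?a = dif (\<lambda>r. dif Y r e) q e"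
    by (rule line_second_derivative_eq[OF W(1,3,2) Y(1,2,4) open_UNIV UNIV_I]; simp add: hY)+
  let ?S = "(\<lambda>t. q + t *\<^sub>R e) -` U"
  have oS: "open ?S" by (rule open_vimage[OF Y(1)]) (intro continuous_intros)
  have S0: "0 \<in> ?S" using Y(4) by simp
  have k1: "dif ?k 0 ?a = dif \<Phi> q e" "dif (\<lambda>r. dif ?k r ?a) 0 ?a = dif (\<lambda>r. dif \<Phi> r e) q e"
    by (rule line_second_derivative_eq[OF W'(1,4,2) Y(1) \<Phi>(1) Y(4) oS S0]; simp add: hY \<Phi>(2))+
  define Z' where "Z' = dif ?k 0 ?b"
  have "Z' \<in> tangent_space N (\<Phi> q)"
    using dif_tangent[OF W'(1,4,2,5), of ?b] by (simp add: Z'_def k0)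
  moreover have "g (\<Phi> q) (dif \<Phi> q e) Z' = g (Y q) (dif Y q e) Z"
    using iso_eq[OF W'(2), of ?a ?b] unfolding k1 h1 hZ h0 \<Phi>(2)[OF Y(4)] Z'_def .
  moreover have "koszul c f (?k 0) (dif ?k 0 ?a) (dif ?k 0 ?a) (dif (\<lambda>r. dif ?k r ?a) 0 ?a) (dif ?k 0 ?b)
      = koszul c f (h 0) (dif h 0 ?a) (dif h 0 ?a) (dif (\<lambda>r. dif h r ?a) 0 ?a) (dif h 0 ?b)"
  proof -
    have N0: "h 0 \<in> N" "?k 0 \<in> N" using W(2,4) W'(2,5) by auto
    have eq: "dif (\<lambda>r. g (?k r) (dif ?k r u) (dif ?k r v)) 0 w = dif (\<lambda>r. g (h r) (dif h r u) (dif h r v)) 0 w" for u v w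
      using dif_cong_open[OF W'(1,2), of "\<lambda>r. g (?k r) (dif ?k r u) (dif ?k r v)"
        "\<lambda>r. g (h r) (dif h r u) (dif h r v)"] iso_eq by simp
    show ?thesis
      unfolding koszul_variation[OF W'(1,4,2) in_N_D(2)[OF N0(2)]]
        koszul_variation[OF W'(1) sh W'(2) in_N_D(2)[OF N0(1)]] eq ..
  qed
  then have "koszul c f (\<Phi> q) (dif \<Phi> q e) (dif \<Phi> q e) (dif (\<lambda>r. dif \<Phi> r e) q e) Z'
      = koszul c f (Y q) (dif Y q e) (dif Y q e) (dif (\<lambda>r. dif Y r e) q e) Z"
    unfolding k1 h1 h0 \<Phi>(2)[OF Y(4)] hZ Z'_def .
  ultimately show ?thesis using that by blast
qed

end

context timelike_static
begin

text \<open>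
  At a point of the surface the two coordinate lines of the congruent model are null geodesics up to
  parametrization, and so are their preimages under the isometry. Lifted to an arbitrary local
  parametrization they provide two null directions on which the second fundamental form vanishes.
\<close>
theorem locally_congruent_imp_umbilical:
  assumes cm: "c = -1" and interval: "is_interval I" "z0 \<in> I" and k: "k \<noteq> 0"
    and cong: "locally_congruent N g M \<iota> (phi_domain I) (phi_surface f z0 k k2)"
  shows "totally_umbilical N g M \<iota>"
proof -
  have F: "(F_int f z0 has_vector_derivative 1 / f t) (at t)" if "t \<in> I" for t
    by (rule F_int_has_derivative[OF I interval that smooth_on_continuous[OF f_smooth]])
      (use f_pos in force)
  interpret ph: phi_model I f "phi_a k" phi_b phi_n0 "phi_n1 k" "F_int f z0" "k2 / k" "k2 / (2 * k)"
  proof (intro phi_model.intro phi_model_axioms.intro phi_frame[OF k] F)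
    show "static_space_time (-1) I f" using static_space_time_axioms by (simp add: cm)
  qed
  have phY: "phi_surface f z0 k k2 = ph.Y"
    by (rule ext) (simp add: phi_surface_ruled[OF k] ph.Y_def ph.\<Theta>_def ph.S_def)
  have pointwise: "\<exists>m. \<forall>e. shape_operator N g (\<iota> \<circ> \<sigma>') \<xi> q' e = m *\<^sub>R dif (\<iota> \<circ> \<sigma>') q' e"
    if lp': "local_param M \<iota> U' \<sigma>'" and \<xi>: "normal_field N g U' (\<iota> \<circ> \<sigma>') \<xi>" and q': "q' \<in> U'"
    for U' :: "(real^2) set" and \<sigma>' \<xi> q'
  proof -
    let ?X = "\<iota> \<circ> \<sigma>'"
    note p' = local_param_patch[OF lp' image_M]
    have opU': "openin (top_of_set M) (\<sigma>' ` U')" and "\<exists>\<tau>. homeomorphism U' (\<sigma>' ` U') \<sigma>' \<tau>"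
      using lp' by (auto simp: local_param_def)
    then obtain \<tau> where \<tau>: "homeomorphism U' (\<sigma>' ` U') \<sigma>' \<tau>" by blast
    have "\<sigma>' q' \<in> M" using openin_imp_subset[OF opU'] q' by auto
    then obtain \<Psi> U \<sigma> where iso: "isometry_of N g \<Psi>" and lp: "local_param M \<iota> U \<sigma>" and pU: "\<sigma>' q' \<in> \<sigma> ` U"
      and UD: "U \<subseteq> phi_domain I" and \<Psi>: "\<forall>q\<in>U. \<Psi> (\<iota> (\<sigma> q)) = ph.Y q"
      using cong unfolding locally_congruent_def phY by blast
    then obtain q where q: "q \<in> U" "\<sigma>' q' = \<sigma> q" by blast
    note p = local_param_patch[OF lp image_M]
    have contU: "continuous_on U \<sigma>" using lp by (auto simp: local_param_def homeomorphism_def)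
    have "openin (top_of_set M) (\<sigma> ` U)" using lp by (simp add: local_param_def)
    then have \<sigma>U: "\<sigma> ` U \<subseteq> M" by (rule openin_imp_subset)
    define O' where "O' = U \<inter> \<sigma> -` (\<sigma>' ` U')"
    have oO: "open O'"
    proof -
      have "openin (top_of_set U) O'" unfolding O'_def
        by (rule continuous_openin_preimage[OF contU _ opU']) (use \<sigma>U in auto)
      then show ?thesis using p(1) openin_open_eq by blast
    qed
    define h where "h r = \<tau> (\<sigma> r)" for r
    have h: "h r \<in> U'" "\<sigma>' (h r) = \<sigma> r" if "r \<in> O'" for r
      using that \<tau> by (auto simp: h_def O'_def homeomorphism_def)
    have conth: "continuous_on O' h" unfolding h_def
    proof (rule continuous_on_compose2[of "\<sigma>' ` U'" \<tau>])
      show "continuous_on (\<sigma>' ` U') \<tau>" using \<tau> by (simp add: homeomorphism_def)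
      show "continuous_on O' \<sigma>" by (rule continuous_on_subset[OF contU]) (auto simp: O'_def)
    qed (auto simp: O'_def)
    have "\<sigma> q \<in> \<sigma>' ` U'" using imageI[OF q', of \<sigma>'] unfolding q(2) .
    then have qO: "q \<in> O'" using q(1) by (simp add: O'_def)
    have hq: "h q = q'" using homeomorphism_apply1[OF \<tau> q'] by (simp add: h_def q(2))
    let ?Y = "\<iota> \<circ> \<sigma>"
    have subO: "O' \<subseteq> U" by (auto simp: O'_def)
    have sY: "smooth_on O' ?Y" by (rule smooth_on_subset[OF p(2) subO])
    have YO: "?Y ` O' \<subseteq> N" using p(3) subO by blast
    have XY: "?X (h r) = ?Y r" if "r \<in> O'" for r using h(2)[OF that] by simp
    have lift: "\<exists>h'. (h has_derivative h') (at r) \<and> (\<forall>e. dif ?X (h r) (h' e) = dif ?Y r e)"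
      if r: "r \<in> O'" for r
    proof -
      have "((\<lambda>r. ?X (h r)) has_derivative dif ?Y r) (at r)"
        by (rule has_derivative_transform_within_open[OF smooth_on_has_derivative[OF sY r] oO r])
          (simp only: XY)
      moreover have "isCont h r" using conth oO r by (simp add: continuous_on_eq_continuous_at)
      ultimately show ?thesis
        using immersion_lift_differentiable[where h=h and q=r, OF smooth_on_has_derivative[OF p'(2) h(1)[OF r]] p'(4)[OF h(1)[OF r]]]
        by metis
    qed
    have "\<exists>h'. (h has_derivative h') (at q) \<and> (\<forall>e. dif ?X (h q) (h' e) = dif ?Y q e)" by (rule lift[OF qO])
    then obtain h' where h': "(h has_derivative h') (at q)" "\<And>e. dif ?X q' (h' e) = dif ?Y q e"
      unfolding hq by blast
    have \<xi>s: "smooth_on U' \<xi>" and \<xi>t: "\<xi> q' \<in> tangent_space N (?X q')"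
      and \<xi>n: "\<And>r e. r \<in> U' \<Longrightarrow> g (?X r) (\<xi> r) (dif ?X r e) = 0"
      using \<xi> q' unfolding normal_field_def by blast+
    have "(\<xi> has_derivative dif \<xi> q') (at (h q))"
      unfolding hq by (rule smooth_on_has_derivative[OF \<xi>s q'])
    then have \<xi>h: "((\<lambda>r. \<xi> (h r)) has_derivative (\<lambda>e. dif \<xi> q' (h' e))) (at q)"
      by (rule has_derivative_compose[OF h'(1)])
    have normal: "g (?Y r) (\<xi> (h r)) (dif ?Y r e) = 0" if r: "r \<in> O'" for r e
    proof -
      obtain l where "\<And>e. dif ?X (h r) (l e) = dif ?Y r e" using lift[OF r] by blast
      from this[of e, symmetric] show ?thesis
        using \<xi>n[OF h(1)[OF r], of "l e"] h(2)[OF r] by simp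
    qed
    have Xq: "?X q' = ?Y q" using q(2) by simp
    have YN: "?Y q \<in> N" using YO qO by auto
    have \<Phi>: "smooth_on O' ph.Y" "\<And>r. r \<in> O' \<Longrightarrow> \<Psi> (?Y r) = ph.Y r"
      using smooth_on_subset[OF ph.Y_smooth] subO UD \<Psi> by auto
    have qD: "q \<in> phi_domain I" using UD q(1) by blast
    have null_lines: "koszul c f (?X q') (dif ?X q' (h' (axis i 1))) (\<xi> q') (dif \<xi> q' (h' (axis i 1)))
        (dif ?X q' (h' (axis i 1))) = 0" for i
    proof -
      let ?e = "axis i 1 :: real^2"
      have \<xi>tY: "\<xi> q' \<in> tangent_space N (?Y q)" using \<xi>t unfolding Xq .
      obtain Z' where Z': "Z' \<in> tangent_space N (ph.Y q)"
        "g (ph.Y q) (dif ph.Y q ?e) Z' = g (?Y q) (dif ?Y q ?e) (\<xi> q')"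
        "koszul c f (ph.Y q) (dif ph.Y q ?e) (dif ph.Y q ?e) (dif (\<lambda>r. dif ph.Y r ?e) q ?e) Z'
          = koszul c f (?Y q) (dif ?Y q ?e) (dif ?Y q ?e) (dif (\<lambda>r. dif ?Y r ?e) q ?e) (\<xi> q')"
        using isometry_koszul[OF iso oO sY YO qO \<Phi> \<xi>tY, of ?e] by metis
      have "g (?Y q) (dif ?Y q ?e) (\<xi> q') = 0"
        using normal[OF qO, of ?e] by (simp add: hq static_metric_commute)
      moreover have "ph.Y q \<in> N" using ph.Y_in_N[OF qD] by (simp add: cm)
      then have "pseudo_inner c (fst Z') (nvec c (fst (ph.Y q))) = 0" using Z'(1) tangent_N by blast
      then have "pseudo_inner (-1) (fst Z') (fst (ph.Y q)) = 0" by (simp add: cm nvec_def)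
      ultimately have "koszul c f (?Y q) (dif ?Y q ?e) (dif ?Y q ?e) (dif (\<lambda>r. dif ?Y r ?e) q ?e) (\<xi> q') = 0"
        using ph.Y_null_lines[OF qD, of Z' i] Z'(2,3) unfolding cm by simp
      moreover have "koszul c f (?Y q) (dif ?Y q ?e) (\<xi> (h q)) (dif \<xi> q' (h' ?e)) (dif ?Y q ?e)
          = - koszul c f (?Y q) (dif ?Y q ?e) (dif ?Y q ?e) (dif (\<lambda>r. dif ?Y r ?e) q ?e) (\<xi> (h q))"
        by (rule weingarten[OF oO sY qO in_N_D(2)[OF YN] \<xi>h normal])
      ultimately show ?thesis unfolding Xq h'(2) hq by simp
    qed
    obtain W' where "q \<in> W'" "W' \<subseteq> O'" "open W'"
      and iso_eq: "\<And>r u v. r \<in> W' \<Longrightarrow> g (\<Psi> (?Y r)) (dif (\<lambda>r. \<Psi> (?Y r)) r u) (dif (\<lambda>r. \<Psi> (?Y r)) r v)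
        = g (?Y r) (dif ?Y r u) (dif ?Y r v)"
      using isometry_composition[OF iso oO sY YO qO] by metis
    have "dif (\<lambda>r. \<Psi> (?Y r)) q = dif ph.Y q"
      by (rule dif_cong_open[OF oO qO]) (rule \<Phi>(2))
    then have metric: "g (?X q') (dif ?X q' (h' u)) (dif ?X q' (h' v)) = f (q$1) * (u$1 * v$2 + u$2 * v$1)" for u v
      using iso_eq[OF \<open>q \<in> W'\<close>, of u v] \<Phi>(2)[OF qO] ph.Y_induced[OF qD, of u v]
      unfolding Xq h'(2) by (simp add: cm)
    have "f (q$1) > 0" using f_pos qD by (auto simp: phi_domain_def)
    then show ?thesis
      by (intro umbilical_from_null_pair[OF lp' \<xi> q', of "h' (axis 1 1)" "h' (axis 2 1)"] null_lines)
        (simp_all add: metric[unfolded o_def] metric axis_def del: comp_apply)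
  qed
  show ?thesis
    unfolding totally_umbilical_def
  proof (intro allI impI)
    fix U' :: "(real^2) set" and \<sigma>' \<xi>
    assume "local_param M \<iota> U' \<sigma>' \<and> normal_field N g U' (\<iota> \<circ> \<sigma>') \<xi>"
    then have "\<forall>q\<in>U'. \<exists>m. \<forall>e. shape_operator N g (\<iota> \<circ> \<sigma>') \<xi> q e = m *\<^sub>R dif (\<iota> \<circ> \<sigma>') q e"
      using pointwise by blast
    then show "\<exists>a. \<forall>q\<in>U'. \<forall>e. shape_operator N g (\<iota> \<circ> \<sigma>') \<xi> q e = a q *\<^sub>R dif (\<iota> \<circ> \<sigma>') q e"
      by (rule bchoice)
  qed
qed

end

section \<open>The classification\<close>

theorem proposition5p8:
  fixes c z0 :: real
    and I :: "real set"
    and f :: "real \<Rightarrow> real"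
    and M :: "'m::{t2_space, second_countable_topology} set"
    and \<iota> :: "'m \<Rightarrow> (real^4) \<times> real"
  assumes "c \<in> {-1, 0, 1}"
    and "open I" and "is_interval I" and "z0 \<in> I"
    and "smooth_on I f" and "\<And>z. z \<in> I \<Longrightarrow> f z > 0"
    and "timelike_surface (static_space c I) (static_metric c f) M \<iota>"
    and "lightlike_T c f M \<iota>"
    and "T_eta_nonvanishing c f M \<iota>"
    and "\<not> locally_in_totally_geodesic (static_space c I) (static_metric c f) M \<iota>"
  shows "(c = 0 \<or> c = 1 \<longrightarrow>
            \<not> totally_umbilical (static_space c I) (static_metric c f) M \<iota>)
       \<and> (c = -1 \<longrightarrow>
            (totally_umbilical (static_space c I) (static_metric c f) M \<iota> \<longleftrightarrow>
               (\<exists>k k2. k \<noteq> 0 \<and>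
                  locally_congruent (static_space c I) (static_metric c f) M \<iota>
                    (phi_domain I) (phi_surface f z0 k k2)))
          \<and> (\<forall>k k2. k \<noteq> 0 \<longrightarrow>
               flat_surface (static_space c I) (static_metric c f)
                 (phi_domain I) (phi_surface f z0 k k2)))"
proof -
  interpret timelike_static c I f M \<iota>
    by unfold_locales (use assms in auto)
  have model: "phi_model I f (phi_a k) phi_b phi_n0 (phi_n1 k) (F_int f z0)"
    if "c = -1" "k \<noteq> 0" for k
  proof (intro phi_model.intro phi_model_axioms.intro phi_frame[OF that(2)])
    show "static_space_time (-1) I f" using static_space_time_axioms that(1) by simp
    show "(F_int f z0 has_vector_derivative 1 / f t) (at t)" if "t \<in> I" for t
      by (rule F_int_has_derivative[OF assms(2-4) that smooth_on_continuous[OF assms(5)]])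
        (use assms(6) in force)
  qed
  have "\<not> totally_umbilical (static_space c I) (static_metric c f) M \<iota>" if "c \<noteq> -1"
    using lorentzian_umbilical_in_totally_geodesic[OF that assms(8)] assms(10) by blast
  moreover have "totally_umbilical (static_space c I) (static_metric c f) M \<iota> \<longleftrightarrow>
      (\<exists>k k2. k \<noteq> 0 \<and> locally_congruent (static_space c I) (static_metric c f) M \<iota>
         (phi_domain I) (phi_surface f z0 k k2))" if "c = -1"
    using umbilical_imp_locally_congruent[OF that assms(3,4,8), of 1]
      locally_congruent_imp_umbilical[OF that assms(3,4)] zero_neq_one by metis
  moreover have "flat_surface (static_space c I) (static_metric c f) (phi_domain I) (phi_surface f z0 k k2)"
    if "c = -1" "k \<noteq> 0" for k k2
  proof -
    interpret ph: phi_model I f "phi_a k" phi_b phi_n0 "phi_n1 k" "F_int f z0" "k2 / k" "k2 / (2 * k)"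
      by (rule model[OF that])
    have "phi_surface f z0 k k2 = ph.Y"
      by (rule ext) (simp add: phi_surface_ruled[OF that(2)] ph.Y_def ph.\<Theta>_def ph.S_def)
    then show ?thesis using ph.Y_flat that(1) by simp
  qed
  ultimately show ?thesis by force
qed

end
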